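(* Let $\{Y_n\}_{n\ge 1}$ be a time series that is $I(1)$ in the sense that, for some constant $0<\sigma<\infty$, $N^{-1/2}Y_{\lfloor Ns\rfloor}\Rightarrow \sigma B(s)$, $s\in[0,1]$, in $D[0,1]$ as $N\to\infty$. Let $\kappa\in(0,1)$, let $c$ be the control limit, and let $R_N=\min\{k\le n\le N: U_N(n/N)<c\}$ with $k=\lfloor\kappa N\rfloor$. Then $$N^{-1}R_N\stackrel{d}{\to}\inf\{\kappa\le s\le 1:\ \mathcal{U}_1(s)<c\},\qquad N\to\infty,$$ where $$\mathcal{U}_1(s)=\frac{\zeta s^{-1}\int_0^s K(\zeta(r-s))\left[\int_0^r B(t)\,dt\right]^2 dr}{\int_0^s B(r)^2\,dr}.$$
   Context: $B$ denotes standard Brownian motion on $[0,1]$; $\Rightarrow$ denotes weak convergence in the space of right-continuous functions with left-hand limits, equipped with the Skorohod topology; $\stackrel{d}{\to}$ is convergence in distribution; $\lfloor x\rfloor$ is the floor function. Kernel and bandwidth: $K:\mathbb{R}\to[0,\infty)$ is a Lipschitz continuous probability density, symmetric around $0$, with mean $0$ and finite variance; $h=h_N>0$ is a sequence of bandwidths with $N/h_N\to\zeta\in[1,\infty)$ as $N\to\infty$; $K_h(x)=K(x/h)/h$. The sequential kernel-weighted variance-ratio process is $U_N(s)=0$ for $s\in[0,1/N)$ and $$U_N(s)=\frac{\lfloor Ns\rfloor^{-3}\sum_{i=1}^{\lfloor Ns\rfloor}\left(\sum_{j=1}^i Y_j\right)^2K_h(i-\lfloor Ns\rfloor)}{\lfloor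 Ns\rfloor^{-2}\sum_{j=1}^{\lfloor Ns\rfloor}Y_j^2},\qquad s\in[1/N,1].$$ Conventions: if no $n$ in the defining set of $R_N$ exists, $R_N=N$; correspondingly the infimum in the limit is $1$ if the set is empty. *)

theory Defs
  imports "HOL-Probability.Probability"
begin

section \<open>The space \<open>D[0,1]\<close> with the Skorohod topology\<close>

text \<open>Paths are extensional functions, so that two elements of \<open>D[0,1]\<close> are equal iff they
  agree on \<open>[0,1]\<close>.\<close>

definition D01 :: "(real \<Rightarrow> real) set" where
  "D01 = {f \<in> extensional {0..1}.
            (\<forall>t\<in>{0..<1}. (f \<longlongrightarrow> f t) (at_right t)) \<and>
            (\<forall>t\<in>{0<..1}. \<exists>l. (f \<longlongrightarrow> l) (at_left t))}"

definition time_changes :: "(real \<Rightarrow> real) set" where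
  "time_changes = {l. strict_mono_on {0..1} l \<and> continuous_on {0..1} l \<and> l ` {0..1} = {0..1}}"

definition time_changed_close :: "real \<Rightarrow> (real \<Rightarrow> real) \<Rightarrow> (real \<Rightarrow> real) \<Rightarrow> bool" where
  "time_changed_close e x y \<longleftrightarrow>
     (\<exists>l\<in>time_changes. \<forall>t\<in>{0..1}. \<bar>l t - t\<bar> \<le> e \<and> \<bar>x t - y (l t)\<bar> \<le> e)"

text \<open>The value 0 outside \<open>D[0,1]\<close> is only there because \<^locale>\<open>Metric_space\<close> demands
  nonnegativity and symmetry on the whole type.\<close>

definition skorohod_dist :: "(real \<Rightarrow> real) \<Rightarrow> (real \<Rightarrow> real) \<Rightarrow> real" where
  "skorohod_dist x y =
     (if x \<in> D01 \<and> y \<in> D01 then Inf {e. 0 < e \<and> time_changed_close e x y} else 0)"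

lemma time_changes_endpoint:
  assumes "l \<in> time_changes" shows "l 1 = 1"
proof -
  have im: "l ` {0..1} = {0..1}" and mono: "strict_mono_on {0..1} l"
    using assms by (auto simp: time_changes_def)
  have "1 \<in> l ` {0..1}" using im by simp
  then obtain u where u: "u \<in> {0..1}" "l u = 1" by auto
  have "l 1 \<in> {0..1}" using im by (metis atLeastAtMost_iff image_eqI order_refl zero_le_one)
  moreover have "l u \<le> l 1"
    using mono u by (intro strict_mono_on_leD[OF mono]) auto
  ultimately show ?thesis using u by auto
qed

lemma time_changes_comp:
  assumes "l \<in> time_changes" "m \<in> time_changes" shows "m \<circ> l \<in> time_changes"
proof -
  have l: "l ` {0..1} = {0..1}" "strict_mono_on {0..1} l" "continuous_on {0..1} l"
    and m: "m ` {0..1} = {0..1}" "strict_mono_on {0..1} m" "continuous_on {0..1} m"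
    using assms by (auto simp: time_changes_def)
  have "strict_mono_on {0..1} (m \<circ> l)"
    unfolding strict_mono_on_def comp_def
  proof (intro allI impI)
    fix r s :: real assume *: "r \<in> {0..1} \<and> s \<in> {0..1} \<and> r < s"
    then have "l r \<in> {0..1}" "l s \<in> {0..1}" using l(1) by blast+
    moreover have "l r < l s" using * l(2) by (auto simp: strict_mono_on_def)
    ultimately show "m (l r) < m (l s)" using m(2) by (auto simp: strict_mono_on_def)
  qed
  moreover have "continuous_on {0..1} (m \<circ> l)"
    using l m by (intro continuous_on_compose) auto
  moreover have "(m \<circ> l) ` {0..1} = {0..1}" using l m by (metis image_comp)
  ultimately show ?thesis by (auto simp: time_changes_def)
qed

lemma time_changes_inv:
  assumes "l \<in> time_changes"
  obtains m where "m \<in> time_changes" "\<And>t. t \<in> {0..1} \<Longrightarrow> l (m t) = t"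
proof -
  have l: "l ` {0..1} = {0..1}" "strict_mono_on {0..1} l" "continuous_on {0..1} l"
    using assms by (auto simp: time_changes_def)
  have inj: "inj_on l {0..1}" using l(2) strict_mono_on_imp_inj_on by blast
  define m where "m = the_inv_into {0..1} l"
  have lm: "l (m t) = t" if "t \<in> {0..1}" for t
    unfolding m_def by (rule f_the_inv_into_f[OF inj]) (use that l(1) in simp)
  have mr: "m t \<in> {0..1}" if "t \<in> {0..1}" for t
    unfolding m_def by (rule the_inv_into_into[OF inj]) (use that l(1) in auto)
  have ml: "m (l t) = t" if "t \<in> {0..1}" for t
    unfolding m_def by (rule the_inv_into_f_f[OF inj that])
  have "continuous_on (l ` {0..1}) m"
    by (rule continuous_on_inv[OF l(3)]) (use ml in auto)
  then have "continuous_on {0..1} m" using l(1) by simp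
  moreover have "strict_mono_on {0..1} m"
    unfolding strict_mono_on_def
  proof (intro allI impI)
    fix r s :: real assume *: "r \<in> {0..1} \<and> s \<in> {0..1} \<and> r < s"
    show "m r < m s"
    proof (rule ccontr)
      assume "\<not> m r < m s"
      then have "l (m s) \<le> l (m r)"
        using * mr by (intro strict_mono_on_leD[OF l(2)]) auto
      then show False using * lm by auto
    qed
  qed
  moreover have "m ` {0..1} = {0..1}"
  proof
    show "m ` {0..1} \<subseteq> {0..1}" using mr by blast
    show "{0..1} \<subseteq> m ` {0..1}"
    proof
      fix t :: real assume t: "t \<in> {0..1}"
      then have "l t \<in> {0..1}" using l(1) by blast
      then show "t \<in> m ` {0..1}" using ml[OF t] by (metis image_eqI)
    qed
  qed
  ultimately show ?thesis using that[of m] lm by (auto simp: time_changes_def)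
qed

lemma time_changed_close_sym:
  assumes "time_changed_close e x y" shows "time_changed_close e y x"
proof -
  obtain l where l: "l \<in> time_changes"
    "\<And>t. t \<in> {0..1} \<Longrightarrow> \<bar>l t - t\<bar> \<le> e \<and> \<bar>x t - y (l t)\<bar> \<le> e"
    using assms by (auto simp: time_changed_close_def)
  obtain m where m: "m \<in> time_changes" "\<And>t. t \<in> {0..1} \<Longrightarrow> l (m t) = t"
    using time_changes_inv[OF l(1)] by metis
  have "\<bar>m t - t\<bar> \<le> e \<and> \<bar>y t - x (m t)\<bar> \<le> e" if t: "t \<in> {0..1}" for t
  proof -
    have "m t \<in> {0..1}" using m(1) t by (auto simp: time_changes_def)
    from l(2)[OF this] show ?thesis using m(2)[OF t] by auto
  qed
  then show ?thesis using m(1) unfolding time_changed_close_def by blast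
qed

lemma time_changed_close_trans:
  assumes "time_changed_close e x y" "time_changed_close e' y z"
  shows "time_changed_close (e + e') x z"
proof -
  obtain l where l: "l \<in> time_changes"
    "\<And>t. t \<in> {0..1} \<Longrightarrow> \<bar>l t - t\<bar> \<le> e \<and> \<bar>x t - y (l t)\<bar> \<le> e"
    using assms by (auto simp: time_changed_close_def)
  obtain m where m: "m \<in> time_changes"
    "\<And>t. t \<in> {0..1} \<Longrightarrow> \<bar>m t - t\<bar> \<le> e' \<and> \<bar>y t - z (m t)\<bar> \<le> e'"
    using assms by (auto simp: time_changed_close_def)
  have "\<bar>(m \<circ> l) t - t\<bar> \<le> e + e' \<and> \<bar>x t - z ((m \<circ> l) t)\<bar> \<le> e + e'" if t: "t \<in> {0..1}" for t
  proof -
    have "l t \<in> {0..1}" using l(1) t by (auto simp: time_changes_def)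
    from m(2)[OF this] l(2)[OF t] show ?thesis by auto
  qed
  then show ?thesis
    using time_changes_comp[OF l(1) m(1)] unfolding time_changed_close_def by blast
qed

lemma id_time_change: "(\<lambda>t. t) \<in> time_changes"
  by (auto simp: time_changes_def strict_mono_on_def)

lemma D01_bounded:
  assumes "x \<in> D01" obtains C where "\<And>t. t \<in> {0..1} \<Longrightarrow> \<bar>x t\<bar> \<le> C"
proof -
  have "\<exists>C. \<forall>t\<in>{0..1}\<inter>{0..1}. \<bar>x t\<bar> \<le> C"
  proof (rule Bolzano[where P = "\<lambda>a b. \<exists>C. \<forall>t\<in>{a..b}\<inter>{0..1}. \<bar>x t\<bar> \<le> C"])
    show "0 \<le> (1::real)" by simp
  next
    fix a b c :: real
    assume "\<exists>C. \<forall>t\<in>{a..b}\<inter>{0..1}. \<bar>x t\<bar> \<le> C" "\<exists>C. \<forall>t\<in>{b..c}\<inter>{0..1}. \<bar>x t\<bar> \<le> C"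
    then obtain C C' where "\<forall>t\<in>{a..b}\<inter>{0..1}. \<bar>x t\<bar> \<le> C" "\<forall>t\<in>{b..c}\<inter>{0..1}. \<bar>x t\<bar> \<le> C'" by auto
    then have "\<forall>t\<in>{a..c}\<inter>{0..1}. \<bar>x t\<bar> \<le> max C C'" by (fastforce simp: le_max_iff_disj)
    then show "\<exists>C. \<forall>t\<in>{a..c}\<inter>{0..1}. \<bar>x t\<bar> \<le> C" by blast
  next
    fix s :: real assume s: "0 \<le> s" "s \<le> 1"
    obtain d1 C1 where d1: "d1 > 0" "\<And>t. t \<in> {0..1} \<Longrightarrow> s < t \<Longrightarrow> t < s + d1 \<Longrightarrow> \<bar>x t\<bar> \<le> C1"
    proof (cases "s < 1")
      case True
      then have "(x \<longlongrightarrow> x s) (at_right s)" using assms s by (auto simp: D01_def)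
      then have "\<forall>\<^sub>F t in at_right s. dist (x t) (x s) < 1" by (rule tendstoD) simp
      then obtain b where b: "b > s" "\<forall>y>s. y < b \<longrightarrow> dist (x y) (x s) < 1"
        unfolding eventually_at_right_field by blast
      show ?thesis
        by (rule that[of "b - s" "\<bar>x s\<bar> + 1"]) (use b in \<open>force simp: dist_real_def\<close>)+
    next
      case False then show ?thesis using that[of 1 0] by auto
    qed
    obtain d2 C2 where d2: "d2 > 0" "\<And>t. t \<in> {0..1} \<Longrightarrow> t < s \<Longrightarrow> s - d2 < t \<Longrightarrow> \<bar>x t\<bar> \<le> C2"
    proof (cases "s > 0")
      case True
      then have "\<exists>L. (x \<longlongrightarrow> L) (at_left s)" using assms s by (simp add: D01_def)
      then obtain L where "(x \<longlongrightarrow> L) (at_left s)" ..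
      then have "\<forall>\<^sub>F t in at_left s. dist (x t) L < 1" by (rule tendstoD) simp
      then obtain b where b: "b < s" "\<forall>y>b. y < s \<longrightarrow> dist (x y) L < 1"
        unfolding eventually_at_left_field by blast
      show ?thesis
        by (rule that[of "s - b" "\<bar>L\<bar> + 1"]) (use b in \<open>force simp: dist_real_def\<close>)+
    next
      case False then show ?thesis using that[of 1 0] by auto
    qed
    have "\<exists>C. \<forall>t\<in>{a..b}\<inter>{0..1}. \<bar>x t\<bar> \<le> C" if "a \<le> s \<and> s \<le> b \<and> b - a < min d1 d2" for a b
    proof (intro exI ballI)
      fix t assume t: "t \<in> {a..b}\<inter>{0..1}"
      consider "t < s" | "t = s" | "s < t" by linarith
      then show "\<bar>x t\<bar> \<le> max \<bar>x s\<bar> (max C1 C2)"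
        using d1(2)[of t] d2(2)[of t] t that by cases (auto simp: le_max_iff_disj)
    qed
    then show "\<exists>d>0. \<forall>a b. a \<le> s \<and> s \<le> b \<and> b - a < d \<longrightarrow>
        (\<exists>C. \<forall>t\<in>{a..b}\<inter>{0..1}. \<bar>x t\<bar> \<le> C)"
      using d1(1) d2(1) by (intro exI[of _ "min d1 d2"]) simp
  qed
  then obtain C where "\<forall>t\<in>{0..1}. \<bar>x t\<bar> \<le> C" by auto
  then show ?thesis by (intro that[of C]) blast
qed

lemma skorohod_set_nonempty:
  assumes "x \<in> D01" "y \<in> D01" shows "{e. 0 < e \<and> time_changed_close e x y} \<noteq> {}"
proof -
  obtain C C' where C: "\<And>t. t \<in> {0..1} \<Longrightarrow> \<bar>x t\<bar> \<le> C" "\<And>t. t \<in> {0..1} \<Longrightarrow> \<bar>y t\<bar> \<le> C'"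
    using D01_bounded[OF assms(1)] D01_bounded[OF assms(2)] by metis
  have "C \<ge> 0" "C' \<ge> 0" using C(1)[of 0] C(2)[of 0] by auto
  moreover have "\<bar>x t - y t\<bar> \<le> C + C' + 1" if "t \<in> {0..1}" for t
    using C[OF that] by linarith
  ultimately have "time_changed_close (C + C' + 1) x y"
    unfolding time_changed_close_def by (intro bexI[OF _ id_time_change]) auto
  then show ?thesis using \<open>C \<ge> 0\<close> \<open>C' \<ge> 0\<close> by (auto intro!: exI[of _ "C + C' + 1"])
qed

lemma skorohod_dist_lessD:
  assumes "x \<in> D01" "y \<in> D01" "skorohod_dist x y < r"
  obtains e where "0 < e" "e < r" "time_changed_close e x y"
  using cInf_lessD[OF skorohod_set_nonempty[OF assms(1,2)], of r] assms
  by (auto simp: skorohod_dist_def)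

lemma skorohod_dist_le:
  assumes "x \<in> D01" "y \<in> D01" "0 < e" "time_changed_close e x y"
  shows "skorohod_dist x y \<le> e"
  using assms by (auto simp: skorohod_dist_def intro!: cInf_lower bdd_belowI[of _ 0])

lemma Metric_space_skorohod: "Metric_space D01 skorohod_dist"
proof
  show nonneg: "0 \<le> skorohod_dist x y" for x y
    using skorohod_set_nonempty by (auto simp: skorohod_dist_def intro!: cInf_greatest)
  show "skorohod_dist x y = skorohod_dist y x" for x y
    using time_changed_close_sym[of _ x y] time_changed_close_sym[of _ y x]
    by (auto simp: skorohod_dist_def intro!: arg_cong[where f = Inf])
  show "skorohod_dist x z \<le> skorohod_dist x y + skorohod_dist y z"
    if "x \<in> D01" "y \<in> D01" "z \<in> D01" for x y z
  proof (rule field_le_epsilon)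
    fix e :: real assume e: "e > 0"
    obtain a where a: "0 < a" "a < skorohod_dist x y + e/2" "time_changed_close a x y"
      by (rule skorohod_dist_lessD[of x y "skorohod_dist x y + e/2"]) (use \<open>x \<in> D01\<close> \<open>y \<in> D01\<close> e in auto)
    obtain b where b: "0 < b" "b < skorohod_dist y z + e/2" "time_changed_close b y z"
      by (rule skorohod_dist_lessD[of y z "skorohod_dist y z + e/2"]) (use \<open>y \<in> D01\<close> \<open>z \<in> D01\<close> e in auto)
    have "skorohod_dist x z \<le> a + b"
      using a b that by (intro skorohod_dist_le time_changed_close_trans[of _ _ y]) auto
    then show "skorohod_dist x z \<le> skorohod_dist x y + skorohod_dist y z + e" using a b by simp
  qed
  show "skorohod_dist x y = 0 \<longleftrightarrow> x = y" if x: "x \<in> D01" and y: "y \<in> D01" for x y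
  proof
    assume "x = y"
    have "skorohod_dist x y \<le> e" if "e > 0" for e
      by (rule skorohod_dist_le[OF x y that])
        (use \<open>x = y\<close> that in \<open>auto simp: time_changed_close_def intro!: bexI[OF _ id_time_change]\<close>)
    then have "skorohod_dist x y \<le> 0" by (meson field_le_epsilon dense_ge)
    then show "skorohod_dist x y = 0" using nonneg[of x y] by simp
  next
    assume z: "skorohod_dist x y = 0"
    have small: "\<exists>e>0. e < r \<and> time_changed_close e x y" if "r > 0" for r
      using skorohod_dist_lessD[OF x y, of r] z that by metis
    have "x t = y t" if t: "t \<in> {0..1}" for t
    proof (cases "t = 1")
      case True
      have "\<bar>x 1 - y 1\<bar> \<le> 0 + r" if r: "r > 0" for r
      proof -
        obtain e l where "e < r" "l \<in> time_changes" "\<forall>t\<in>{0..1}. \<bar>x t - y (l t)\<bar> \<le> e"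
          using small[OF r] by (auto simp: time_changed_close_def)
        moreover from this have "\<bar>x 1 - y (l 1)\<bar> \<le> e" by simp
        ultimately show ?thesis using time_changes_endpoint[of l] by simp
      qed
      then have "\<bar>x 1 - y 1\<bar> \<le> 0" by (rule field_le_epsilon)
      then show ?thesis using True by simp
    next
      case False
      then have t1: "0 \<le> t" "t < 1" using t by auto
      have "\<bar>x t - y t\<bar> \<le> 0 + r" if r: "r > 0" for r
      proof -
        have "(x \<longlongrightarrow> x t) (at_right t)" "(y \<longlongrightarrow> y t) (at_right t)"
          using x y t1 by (auto simp: D01_def)
        then have "\<forall>\<^sub>F u in at_right t. dist (x u) (x t) < r/3"
          "\<forall>\<^sub>F u in at_right t. dist (y u) (y t) < r/3"
          using tendstoD[of x "x t" "at_right t" "r/3"] tendstoD[of y "y t" "at_right t" "r/3"] r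
          by simp_all
        then have "\<forall>\<^sub>F u in at_right t. dist (x u) (x t) < r/3 \<and> dist (y u) (y t) < r/3"
          by (rule eventually_conj)
        then obtain b' where b': "b' > t"
          "\<And>u. u > t \<Longrightarrow> u < b' \<Longrightarrow> dist (x u) (x t) < r/3 \<and> dist (y u) (y t) < r/3"
          unfolding eventually_at_right_field by blast
        define b where "b = min b' 1"
        define u where "u = (t + b) / 2"
        have b: "t < b" "b \<le> 1" "b \<le> b'" using b' t1 by (auto simp: b_def)
        have u: "t < u" "u < b" "u \<in> {0..1}" using b t1 by (auto simp: u_def)
        obtain e l where e: "e > 0" "e < min (r/3) (min (u - t) (b - u))"
          and l: "\<forall>t\<in>{0..1}. \<bar>l t - t\<bar> \<le> e \<and> \<bar>x t - y (l t)\<bar> \<le> e"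
          using small[of "min (r/3) (min (u - t) (b - u))"] r u
          by (auto simp: time_changed_close_def)
        have "\<bar>l u - u\<bar> \<le> e" "\<bar>x u - y (l u)\<bar> \<le> e" using l u by auto
        moreover from this have "t < l u" "l u < b'" using e b by auto
        ultimately show ?thesis
          using b'(2)[of u] b'(2)[of "l u"] u b e unfolding dist_real_def by linarith
      qed
      then have "\<bar>x t - y t\<bar> \<le> 0" by (rule field_le_epsilon)
      then show ?thesis by simp
    qed
    then show "x = y" using x y by (intro extensionalityI[of _ "{0..1}"]) (auto simp: D01_def)
  qed
qed

definition skorohod_topology :: "(real \<Rightarrow> real) topology" where
  "skorohod_topology = Metric_space.mtopology D01 skorohod_dist"

definition path01 :: "(real \<Rightarrow> real) \<Rightarrow> real \<Rightarrow> real" where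
  "path01 f = restrict f {0..1}"

section \<open>Weak convergence\<close>

definition borel_of :: "'a topology \<Rightarrow> 'a measure" where
  "borel_of T = sigma (topspace T) {U. openin T U}"

text \<open>Weak convergence of random elements of a topological space; the limit may live on
  a probability space of its own. Measurability is part of the notion: otherwise the Bochner
  integrals below could be 0 by convention.\<close>

definition weakly_converges_in ::
  "'c topology \<Rightarrow> 'a measure \<Rightarrow> (nat \<Rightarrow> 'a \<Rightarrow> 'c) \<Rightarrow> 'b measure \<Rightarrow> ('b \<Rightarrow> 'c) \<Rightarrow> bool" where
  "weakly_converges_in T M X M' Z \<longleftrightarrow>
     (\<forall>N. X N \<in> measurable M (borel_of T)) \<and> Z \<in> measurable M' (borel_of T) \<and>
     (\<forall>F :: 'c \<Rightarrow> real. continuous_map T euclideanreal F \<longrightarrow> (\<exists>C. \<forall>x\<in>topspace T. \<bar>F x\<bar> \<le> C) \<longrightarrow>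
        (\<lambda>N. \<integral>\<omega>. F (X N \<omega>) \<partial>M) \<longlonglongrightarrow> (\<integral>\<omega>. F (Z \<omega>) \<partial>M'))"

definition converges_in_distribution ::
  "'a measure \<Rightarrow> (nat \<Rightarrow> 'a \<Rightarrow> real) \<Rightarrow> 'b measure \<Rightarrow> ('b \<Rightarrow> real) \<Rightarrow> bool" where
  "converges_in_distribution M X M' Z \<longleftrightarrow>
     (\<forall>N. X N \<in> borel_measurable M) \<and> Z \<in> borel_measurable M' \<and>
     weak_conv_m (\<lambda>N. distr M borel (X N)) (distr M' borel Z)"

section \<open>Brownian motion\<close>

definition brownian_motion01 :: "'b measure \<Rightarrow> (real \<Rightarrow> 'b \<Rightarrow> real) \<Rightarrow> bool" where
  "brownian_motion01 M B \<longleftrightarrow>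
     prob_space M \<and>
     (\<forall>t\<in>{0..1}. B t \<in> borel_measurable M) \<and>
     (AE \<omega> in M. B 0 \<omega> = 0) \<and>
     (\<forall>\<omega>\<in>space M. continuous_on {0..1} (\<lambda>t. B t \<omega>)) \<and>
     (\<forall>s t. 0 \<le> s \<and> s < t \<and> t \<le> 1 \<longrightarrow>
        distributed M lborel (\<lambda>\<omega>. B t \<omega> - B s \<omega>) (normal_density 0 (sqrt (t - s)))) \<and>
     (\<forall>(n::nat) \<tau>. strict_mono_on {..n} \<tau> \<and> \<tau> ` {..n} \<subseteq> {0..1} \<longrightarrow>
        prob_space.indep_vars M (\<lambda>_. borel) (\<lambda>i \<omega>. B (\<tau> (Suc i)) \<omega> - B (\<tau> i) \<omega>) {..<n})"

section \<open>Integrated time series\<close>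

text \<open>The series starts at time 1. On \<open>[0, 1/N)\<close>, where \<open>\<lfloor>N s\<rfloor> = 0\<close>, the rescaled path is 0.\<close>

definition rescaled_path :: "(nat \<Rightarrow> real) \<Rightarrow> nat \<Rightarrow> real \<Rightarrow> real" where
  "rescaled_path y N s =
     (let n = nat \<lfloor>real N * s\<rfloor> in if n = 0 then 0 else y n / sqrt (real N))"

definition integrated_I1 ::
  "'a measure \<Rightarrow> (nat \<Rightarrow> 'a \<Rightarrow> real) \<Rightarrow> 'b measure \<Rightarrow> (real \<Rightarrow> 'b \<Rightarrow> real) \<Rightarrow> bool" where
  "integrated_I1 M Y M' B \<longleftrightarrow>
     (\<exists>\<sigma>>0. weakly_converges_in skorohod_topology
        M (\<lambda>N \<omega>. path01 (rescaled_path (\<lambda>n. Y n \<omega>) N))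
        M' (\<lambda>\<omega>. path01 (\<lambda>s. \<sigma> * B s \<omega>)))"

section \<open>Kernel and variance-ratio process\<close>

definition admissible_kernel :: "(real \<Rightarrow> real) \<Rightarrow> bool" where
  "admissible_kernel K \<longleftrightarrow>
     (\<forall>x. 0 \<le> K x) \<and>
     (\<exists>L. L-lipschitz_on UNIV K) \<and>
     has_bochner_integral lborel K 1 \<and>
     (\<forall>x. K (- x) = K x) \<and>
     has_bochner_integral lborel (\<lambda>x. x * K x) 0 \<and>
     integrable lborel (\<lambda>x. x\<^sup>2 * K x)"

definition scaled_kernel :: "(real \<Rightarrow> real) \<Rightarrow> real \<Rightarrow> real \<Rightarrow> real" where
  "scaled_kernel K h x = K (x / h) / h"

definition U_process ::
  "(real \<Rightarrow> real) \<Rightarrow> (nat \<Rightarrow> real) \<Rightarrow> (nat \<Rightarrow> real) \<Rightarrow> nat \<Rightarrow> real \<Rightarrow> real" where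
  "U_process K h y N s =
     (if s < 1 / real N then 0
      else let n = nat \<lfloor>real N * s\<rfloor> in
        (1 / real n ^ 3 *
           (\<Sum>i=1..n. (\<Sum>j=1..i. y j)\<^sup>2 * scaled_kernel K (h N) (real i - real n))) /
        (1 / real n ^ 2 * (\<Sum>j=1..n. (y j)\<^sup>2)))"

definition stopping_time_R ::
  "(real \<Rightarrow> real) \<Rightarrow> (nat \<Rightarrow> real) \<Rightarrow> real \<Rightarrow> real \<Rightarrow> (nat \<Rightarrow> real) \<Rightarrow> nat \<Rightarrow> nat" where
  "stopping_time_R K h c \<kappa> y N =
     (let A = {n. nat \<lfloor>\<kappa> * real N\<rfloor> \<le> n \<and> n \<le> N \<and> U_process K h y N (real n / real N) < c}
      in if A = {} then N else Min A)"

definition U_limit ::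
  "(real \<Rightarrow> real) \<Rightarrow> real \<Rightarrow> (real \<Rightarrow> real) \<Rightarrow> real \<Rightarrow> real" where
  "U_limit K \<zeta> b s =
     (\<zeta> * (1 / s) * integral {0..s} (\<lambda>r. K (\<zeta> * (r - s)) * (integral {0..r} b)\<^sup>2)) /
     integral {0..s} (\<lambda>r. (b r)\<^sup>2)"

definition limit_time ::
  "(real \<Rightarrow> real) \<Rightarrow> real \<Rightarrow> real \<Rightarrow> real \<Rightarrow> (real \<Rightarrow> real) \<Rightarrow> real" where
  "limit_time K \<zeta> c \<kappa> b =
     (let A = {s. \<kappa> \<le> s \<and> s \<le> 1 \<and> U_limit K \<zeta> b s < c} in if A = {} then 1 else Inf A)"

end

theory Submission
  imports Defs
begin

text \<open>The statistic is scale invariant, so \<open>R\<^sub>N / N\<close> is a functional \<open>g\<^sub>N\<close> of the rescaled series \<open>X\<^sub>N\<close>, which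
converges weakly to \<open>\<sigma> B\<close>, and the factor \<open>\<sigma>\<close> cancels in the limit as well. By an extended
continuous mapping theorem (\<open>extended_continuous_mapping\<close>) it suffices that, for almost every path
\<open>b\<close> of \<open>B\<close>, the values \<open>g\<^sub>N(a)\<close> converge to the limiting crossing time of \<open>b\<close> as \<open>N\<close> grows and \<open>a\<close>
approaches \<open>\<sigma> b\<close>. Since \<open>b\<close> is continuous, \<open>a\<close> is then uniformly close to \<open>\<sigma> b\<close>
(\<open>skorohod_close_to_continuous_imp_uniformly_close\<close>).

The deterministic part is a Riemann sum argument. If \<open>n / N\<close> tends to \<open>s\<close>, then numerator and
denominator of the variance ratio at \<open>n\<close> converge to those of the limit process at \<open>s\<close>
(\<open>sample_functionals_tendsto\<close>). A first crossing time of the level \<open>c\<close> inherits this convergence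
unless the limit process touches \<open>c\<close> from above before it crosses
(\<open>stopping_time_tendsto_limit_time\<close>); for \<open>c \<le> 0\<close> there are no crossings and both times take their
default values.

The probabilistic part shows that this does not happen, almost surely. Multiplied by its positive
denominator, the condition that the process is below \<open>c > 0\<close> at time \<open>s\<close> becomes \<open>gap b s < 0\<close>, where
\<open>gap b s\<close> is a quadratic form in \<open>b\<close>. For a narrow tent-shaped path \<open>\<phi>\<close> the integral of \<open>\<phi>\<close> is much
smaller than \<open>\<phi>\<close> itself, so \<open>gap \<phi> s\<close> is negative for all \<open>s\<close>, and \<open>\<epsilon> \<mapsto> gap (b + \<epsilon> \<phi>) s\<close> is a strictly
concave quadratic polynomial. Hence \<open>b + \<epsilon> \<phi>\<close> touches the level for at most two values of \<open>\<epsilon>\<close>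
(\<open>few_translates_touch_zero\<close>). On the other hand the law of \<open>B + \<epsilon> \<phi>\<close> has a Cameron-Martin density
with respect to the law of \<open>B\<close>, and these densities tend to \<open>1\<close> as \<open>\<epsilon>\<close> tends to \<open>0\<close>. If touching had
positive probability for \<open>B\<close>, the probabilities for \<open>B + \<phi> / j\<close> would have an infinite sum over \<open>j\<close>,
which contradicts the bound by two (\<open>null_set_if_finitely_many_translates\<close>).\<close>

section \<open>Continuous mapping for sequences of functionals\<close>

text \<open>The cutoff \<open>1 - min 1 (m * distance to S)\<close>. As \<open>m\<close> grows it decreases to the indicator of the closure
of \<open>S\<close>, which is how bounded continuous test functions detect closed sets. Writing the truncated
distance as the infimum of a set that contains 1 covers the case that \<open>S\<close> is empty.\<close>

lemma (in Metric_space) exists_Lipschitz_cutoff: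
  assumes "S \<subseteq> M" "0 \<le> (m::real)"
  obtains F where "continuous_map mtopology euclideanreal F"
    "\<And>x. 0 \<le> F x" "\<And>x. F x \<le> 1"
    "\<And>x. x \<in> S \<Longrightarrow> F x = 1"
    "\<And>x. (\<And>a. a \<in> S \<Longrightarrow> 1 \<le> m * d a x) \<Longrightarrow> F x = 0"
proof -
  define V where "V x = insert 1 ((\<lambda>a. m * d a x) ` S)" for x
  have bdd: "bdd_below (V x)" for x
    using assms by (auto simp: V_def intro!: bdd_belowI[of _ 0])
  have ne: "V x \<noteq> {}" for x by (simp add: V_def)
  have V0: "0 \<le> Inf (V x)" for x
    by (rule cInf_greatest[OF ne]) (use assms in \<open>auto simp: V_def\<close>)
  have Lip: "Inf (V x) \<le> Inf (V y) + m * d x y" if "x \<in> M" "y \<in> M" for x y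
  proof -
    have "Inf (V x) - m * d x y \<le> v" if v: "v \<in> V y" for v
    proof -
      obtain w where w: "w \<in> V x" "w \<le> v + m * d x y"
      proof (cases "v = 1")
        case True
        then show ?thesis using that[of 1] assms by (simp add: V_def)
      next
        case False
        then obtain a where a: "a \<in> S" "v = m * d a y" using v by (auto simp: V_def)
        have "d a x \<le> d a y + d x y"
          using triangle[of a y x] a assms \<open>x \<in> M\<close> \<open>y \<in> M\<close> by (auto simp: commute)
        then have "m * d a x \<le> m * (d a y + d x y)" using assms by (intro mult_left_mono)
        then show ?thesis using that[of "m * d a x"] a by (auto simp: V_def algebra_simps)
      qed
      then show ?thesis using cInf_lower[OF w(1) bdd] by simp
    qed
    then show ?thesis using cInf_greatest[OF ne, of y "Inf (V x) - m * d x y"] by simp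
  qed
  have "continuous_map mtopology euclideanreal (\<lambda>x. 1 - Inf (V x))"
    unfolding continuous_map_from_metric
  proof (intro conjI ballI allI impI)
    fix a U assume a: "a \<in> M" and U: "openin euclideanreal U \<and> 1 - Inf (V a) \<in> U"
    then obtain e where e: "e > 0" "\<And>y. dist y (1 - Inf (V a)) < e \<Longrightarrow> y \<in> U"
      by (metis open_dist open_openin)
    show "\<exists>r>0. \<forall>x. x \<in> M \<and> d a x < r \<longrightarrow> 1 - Inf (V x) \<in> U"
    proof (intro exI[of _ "e / (m + 1)"] conjI allI impI)
      show "0 < e / (m + 1)" using e assms by simp
      fix x assume x: "x \<in> M \<and> d a x < e / (m + 1)"
      have "m * d a x \<le> (m + 1) * d a x" by (simp add: algebra_simps)
      also have "\<dots> < e" using x assms by (simp add: field_simps)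
      finally have "m * d a x < e" .
      then show "1 - Inf (V x) \<in> U"
        using Lip[of a x] Lip[of x a] x a by (intro e(2)) (auto simp: dist_real_def commute)
    qed
  qed auto
  moreover have "0 \<le> 1 - Inf (V x)" for x
    using cInf_lower[OF _ bdd, of 1 x] by (simp add: V_def)
  moreover have "1 - Inf (V x) \<le> 1" for x
    using V0[of x] by simp
  moreover have "1 - Inf (V x) = 1" if "x \<in> S" for x
  proof -
    have "0 \<in> V x" using that assms by (auto simp: V_def intro!: image_eqI[of _ _ x])
    then have "Inf (V x) \<le> 0" by (rule cInf_lower[OF _ bdd])
    moreover note V0[of x]
    ultimately show ?thesis by simp
  qed
  moreover have "1 - Inf (V x) = 0" if "\<And>a. a \<in> S \<Longrightarrow> 1 \<le> m * d a x" for x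
  proof -
    have "Inf (V x) = 1"
      by (rule cInf_eq_minimum) (use that in \<open>auto simp: V_def\<close>)
    then show ?thesis by simp
  qed
  ultimately show ?thesis by (rule that)
qed

text \<open>The closed-set half of the portmanteau theorem for functionals that change with \<open>N\<close>. The event
\<open>g N (X N) \<in> C\<close> implies that \<open>X N\<close> lies in \<open>S j = {a. \<exists>N\<ge>j. g N a \<in> C}\<close> for every \<open>j \<le> N\<close>. A
continuous cutoff of \<open>S j\<close> with slope \<open>j\<close> therefore dominates the event, and its expectation passes to
the limit in \<open>N\<close>. Letting \<open>j\<close> grow afterwards, the cutoffs vanish at \<open>Z \<omega>\<close> whenever \<open>T \<omega> \<notin> C\<close>:
points of \<open>S j\<close> near \<open>Z \<omega>\<close> would have values of \<open>g\<close> in \<open>C\<close> and near \<open>T \<omega>\<close>.\<close>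

lemma closed_set_probability_limit:
  fixes g :: "nat \<Rightarrow> 'c \<Rightarrow> real" and D :: "'c set"
  assumes D: "Metric_space D d" and M: "prob_space M" and M': "prob_space M'"
    and W: "weakly_converges_in (Metric_space.mtopology D d) M X M' Z"
    and meas: "\<And>N. (\<lambda>\<omega>. g N (X N \<omega>)) \<in> borel_measurable M"
    and T: "T \<in> borel_measurable M'"
    and cc: "AE \<omega> in M'. \<forall>e>0. \<exists>\<delta>>0. \<exists>N0. \<forall>N\<ge>N0. \<forall>a\<in>D. d a (Z \<omega>) < \<delta> \<longrightarrow> \<bar>g N a - T \<omega>\<bar> < e"
    and C: "closed C" and \<epsilon>: "0 < \<epsilon>"
  shows "\<forall>\<^sub>F N in sequentially. measure M {\<omega>\<in>space M. g N (X N \<omega>) \<in> C}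
           \<le> measure M' {\<omega>\<in>space M'. T \<omega> \<in> C} + \<epsilon>"
proof -
  interpret D: Metric_space D d by fact
  interpret M: prob_space M by fact
  interpret M': prob_space M' by fact
  define S where "S j = {a\<in>D. \<exists>N\<ge>j. g N a \<in> C}" for j
  have "\<exists>F. continuous_map D.mtopology euclideanreal F \<and> (\<forall>x. 0 \<le> F x) \<and> (\<forall>x. F x \<le> 1) \<and>
      (\<forall>x. x \<in> S j \<longrightarrow> F x = 1) \<and> (\<forall>x. (\<forall>a\<in>S j. 1 \<le> real j * d a x) \<longrightarrow> F x = 0)" for j
    by (rule D.exists_Lipschitz_cutoff[of "S j" "real j"]) (auto simp: S_def)
  then obtain F where F: "\<And>j. continuous_map D.mtopology euclideanreal (F j)"
    and Frange: "\<And>j x. 0 \<le> F j x" "\<And>j x. F j x \<le> 1"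
    and Fone: "\<And>j x. x \<in> S j \<Longrightarrow> F j x = 1"
    and Fzero: "\<And>j x. (\<And>a. a \<in> S j \<Longrightarrow> 1 \<le> real j * d a x) \<Longrightarrow> F j x = 0"
    by metis
  have Xm: "X N \<in> measurable M (borel_of D.mtopology)" for N
    using W by (auto simp: weakly_converges_in_def)
  have Zm: "Z \<in> measurable M' (borel_of D.mtopology)"
    using W by (auto simp: weakly_converges_in_def)
  have sp: "space (borel_of D.mtopology) = D"
    by (simp add: borel_of_def space_measure_of_conv)
  have open_meas: "W \<in> sets (borel_of D.mtopology)" if "openin D.mtopology W" for W
    unfolding borel_of_def using that openin_subset by (intro in_measure_of) blast+
  have Fm: "F j \<in> borel_measurable (borel_of D.mtopology)" for j
  proof (rule borel_measurableI)
    fix U :: "real set" assume U: "open U"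
    have "openin D.mtopology {x \<in> topspace D.mtopology. F j x \<in> U}"
      using openin_continuous_map_preimage[OF F, of U j] U by (simp flip: open_openin)
    moreover have "F j -` U \<inter> space (borel_of D.mtopology) = {x \<in> topspace D.mtopology. F j x \<in> U}"
      using sp by auto
    ultimately show "F j -` U \<inter> space (borel_of D.mtopology) \<in> sets (borel_of D.mtopology)"
      using open_meas by metis
  qed
  have FX [measurable]: "(\<lambda>\<omega>. F j (X N \<omega>)) \<in> borel_measurable M" for j N
    using measurable_compose[OF Xm Fm] .
  have FZ [measurable]: "(\<lambda>\<omega>. F j (Z \<omega>)) \<in> borel_measurable M'" for j
    using measurable_compose[OF Zm Fm] .
  note T [measurable] and meas [measurable]
  have [measurable]: "C \<in> sets borel" using C by (rule borel_closed)
  define A where "A = {\<omega>\<in>space M'. T \<omega> \<in> C}"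
  have A [measurable]: "A \<in> sets M'" unfolding A_def by measurable
  have lim: "(\<lambda>j. \<integral>\<omega>. max (F j (Z \<omega>)) (indicator A \<omega>) \<partial>M') \<longlonglongrightarrow> (\<integral>\<omega>. indicator A \<omega> \<partial>M')"
  proof (rule integral_dominated_convergence[where w = "\<lambda>_. 1"])
    show "AE \<omega> in M'. (\<lambda>j. max (F j (Z \<omega>)) (indicator A \<omega>)) \<longlonglongrightarrow> (indicator A \<omega> :: real)"
      using cc AE_space
    proof eventually_elim
      case (elim \<omega>)
      show ?case
      proof (cases "T \<omega> \<in> C")
        case True
        then show ?thesis using Frange elim(2) by (simp add: A_def max_absorb2)
      next
        case False
        then obtain e where e: "e > 0" "\<And>y. dist y (T \<omega>) < e \<Longrightarrow> y \<notin> C"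
          using C by (metis ComplD ComplI closed_def open_dist)
        obtain \<delta> N0 where \<delta>: "\<delta> > 0"
          "\<And>N a. N \<ge> N0 \<Longrightarrow> a \<in> D \<Longrightarrow> d a (Z \<omega>) < \<delta> \<Longrightarrow> \<bar>g N a - T \<omega>\<bar> < e"
          using elim(1) e(1) by metis
        have "F j (Z \<omega>) = 0" if j: "j \<ge> max N0 (nat \<lceil>1 / \<delta>\<rceil>)" for j
        proof (rule Fzero)
          fix a assume a: "a \<in> S j"
          then obtain N where N: "a \<in> D" "N \<ge> j" "g N a \<in> C" by (auto simp: S_def)
          \<comment> \<open>A member of \<open>S j\<close> closer than \<open>\<delta>\<close> would have a value of
            \<open>g\<close> both in \<open>C\<close> and within \<open>e\<close> of \<open>T
            \<omega>\<close>.\<close>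
          then have "\<not> d a (Z \<omega>) < \<delta>"
            using \<delta>(2)[of N a] e(2)[of "g N a"] j by (auto simp: dist_real_def)
          moreover have "1 / \<delta> \<le> real j" using j by linarith
          ultimately have "1 / \<delta> * \<delta> \<le> real j * d a (Z \<omega>)"
            using \<delta>(1) by (intro mult_mono) auto
          then show "1 \<le> real j * d a (Z \<omega>)" using \<delta>(1) by simp
        qed
        then have "\<forall>\<^sub>F j in sequentially. max (F j (Z \<omega>)) (indicator A \<omega>) = (indicator A \<omega> :: real)"
          unfolding eventually_sequentially by (intro exI[of _ "max N0 (nat \<lceil>1 / \<delta>\<rceil>)"]) simp
        then show ?thesis by (rule tendsto_eventually)
      qed
    qed
    show "AE \<omega> in M'. norm (max (F j (Z \<omega>)) (indicator A \<omega>)) \<le> 1" for j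
      using Frange by (intro AE_I2) (auto simp: abs_le_iff indicator_def intro: order_trans[OF _ Frange(1)])
  qed auto
  have "(\<lambda>j. \<integral>\<omega>. max (F j (Z \<omega>)) (indicator A \<omega>) \<partial>M') \<longlonglongrightarrow> measure M' A"
    using lim by simp
  then have "\<forall>\<^sub>F j in sequentially. (\<integral>\<omega>. max (F j (Z \<omega>)) (indicator A \<omega>) \<partial>M') < measure M' A + \<epsilon> / 2"
    by (rule order_tendstoD) (use \<epsilon> in simp)
  then obtain j where j: "(\<integral>\<omega>. max (F j (Z \<omega>)) (indicator A \<omega>) \<partial>M') < measure M' A + \<epsilon> / 2"
    by (auto simp: eventually_sequentially)
  have intA: "integrable M' (indicat_real A)"
    by (rule M'.integrable_const_bound[of _ 1]) auto
  have intZ: "integrable M' (\<lambda>\<omega>. F j (Z \<omega>))"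
    by (rule M'.integrable_const_bound[of _ 1]) (use Frange in auto)
  have "(\<integral>\<omega>. F j (Z \<omega>) \<partial>M') \<le> (\<integral>\<omega>. max (F j (Z \<omega>)) (indicator A \<omega>) \<partial>M')"
    by (rule integral_mono[OF intZ]) (auto intro!: integrable_max intZ intA)
  then have EZ: "(\<integral>\<omega>. F j (Z \<omega>) \<partial>M') < measure M' A + \<epsilon> / 2" using j by simp
  have "(\<lambda>N. \<integral>\<omega>. F j (X N \<omega>) \<partial>M) \<longlonglongrightarrow> (\<integral>\<omega>. F j (Z \<omega>) \<partial>M')"
    using W F[of j] Frange unfolding weakly_converges_in_def
    by (metis abs_of_nonneg)
  then have "\<forall>\<^sub>F N in sequentially. (\<integral>\<omega>. F j (X N \<omega>) \<partial>M) < measure M' A + \<epsilon>"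
    by (rule order_tendstoD) (use EZ \<epsilon> in simp)
  moreover have "\<forall>\<^sub>F N in sequentially. N \<ge> j" by (rule eventually_ge_at_top)
  ultimately show ?thesis
  proof eventually_elim
    case (elim N)
    define E where "E = {\<omega>\<in>space M. g N (X N \<omega>) \<in> C}"
    have E [measurable]: "E \<in> sets M" unfolding E_def by measurable
    have "measure M E = (\<integral>\<omega>. indicator E \<omega> \<partial>M)" by simp
    also have "\<dots> \<le> (\<integral>\<omega>. F j (X N \<omega>) \<partial>M)"
    proof (rule integral_mono)
      show "integrable M (\<lambda>\<omega>. F j (X N \<omega>))"
        by (rule M.integrable_const_bound[of _ 1]) (use Frange in auto)
      fix \<omega> assume \<omega>: "\<omega> \<in> space M"
      then have "X N \<omega> \<in> D" using measurable_space[OF Xm] sp by auto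
      then show "indicator E \<omega> \<le> F j (X N \<omega>)"
      proof (cases "g N (X N \<omega>) \<in> C")
        case True
        then have "X N \<omega> \<in> S j" using \<open>X N \<omega> \<in> D\<close> elim(2) by (auto simp: S_def)
        then show ?thesis using Fone by (simp add: indicator_def)
      next
        case False
        then show ?thesis using Frange(1) by (simp add: E_def)
      qed
    qed (auto intro!: M.integrable_const_bound[of _ 1])
    finally show ?case using elim(1) by (simp add: E_def A_def)
  qed
qed

text \<open>Continuous mapping for a sequence of functionals that converges continuously at almost every value of
the limit. At a continuity point \<open>x\<close> of the limiting distribution function both \<open>{..x}\<close> and \<open>{x..}\<close>
are closed, so the preceding bound controls the probability of \<open>{..x}\<close> from above and from below.\<close>

lemma extended_continuous_mapping:
  fixes g :: "nat \<Rightarrow> 'c \<Rightarrow> real" and D :: "'c set"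
  assumes D: "Metric_space D d" and M: "prob_space M" and M': "prob_space M'"
    and W: "weakly_converges_in (Metric_space.mtopology D d) M X M' Z"
    and meas: "\<And>N. (\<lambda>\<omega>. g N (X N \<omega>)) \<in> borel_measurable M"
    and T: "T \<in> borel_measurable M'"
    and cc: "AE \<omega> in M'. \<forall>e>0. \<exists>\<delta>>0. \<exists>N0. \<forall>N\<ge>N0. \<forall>a\<in>D. d a (Z \<omega>) < \<delta> \<longrightarrow> \<bar>g N a - T \<omega>\<bar> < e"
  shows "converges_in_distribution M (\<lambda>N \<omega>. g N (X N \<omega>)) M' T"
  unfolding converges_in_distribution_def weak_conv_m_def weak_conv_def
proof (intro conjI allI impI meas T)
  interpret M: prob_space M by fact
  interpret M': prob_space M' by fact
  note T [measurable] and meas [measurable]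
  fix x assume x: "isCont (cdf (distr M' borel T)) x"
  interpret dT: real_distribution "distr M' borel T" by simp
  have cdfX: "cdf (distr M borel (\<lambda>\<omega>. g N (X N \<omega>))) x = M.prob {\<omega>\<in>space M. g N (X N \<omega>) \<in> {..x}}" for N
    by (subst cdf_def2, subst measure_distr) (auto intro!: arg_cong[where f = M.prob])
  have cdfT: "cdf (distr M' borel T) x = M'.prob {\<omega>\<in>space M'. T \<omega> \<in> {..x}}"
    by (subst cdf_def2, subst measure_distr) (auto intro!: arg_cong[where f = M'.prob])
  have zero: "M'.prob {\<omega>\<in>space M'. T \<omega> = x} = 0"
  proof -
    have "measure (distr M' borel T) {x} = 0" using x dT.isCont_cdf by simp
    then show ?thesis
      by (subst (asm) measure_distr) (auto simp: vimage_def Int_def conj_commute)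
  qed
  have split: "M'.prob {\<omega>\<in>space M'. T \<omega> \<in> {x..}} = 1 - M'.prob {\<omega>\<in>space M'. T \<omega> \<in> {..x}}"
  proof -
    have "M'.prob {\<omega>\<in>space M'. T \<omega> \<in> {x..}}
        = M'.prob ({\<omega>\<in>space M'. T \<omega> > x} \<union> {\<omega>\<in>space M'. T \<omega> = x})"
      by (auto intro!: arg_cong[where f = M'.prob])
    also have "\<dots> = M'.prob {\<omega>\<in>space M'. T \<omega> > x} + 0"
      by (subst M'.finite_measure_Union) (auto simp: zero)
    also have "{\<omega>\<in>space M'. T \<omega> > x} = space M' - {\<omega>\<in>space M'. T \<omega> \<in> {..x}}" by auto
    also have "M'.prob \<dots> = 1 - M'.prob {\<omega>\<in>space M'. T \<omega> \<in> {..x}}"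
      by (rule M'.prob_compl) measurable
    finally show ?thesis by simp
  qed
  show "(\<lambda>N. cdf (distr M borel (\<lambda>\<omega>. g N (X N \<omega>))) x) \<longlonglongrightarrow> cdf (distr M' borel T) x"
    unfolding cdfX cdfT
  proof (rule tendstoI)
    fix e :: real assume e: "e > 0"
    have "\<forall>\<^sub>F N in sequentially. M.prob {\<omega>\<in>space M. g N (X N \<omega>) \<in> {..x}}
           \<le> M'.prob {\<omega>\<in>space M'. T \<omega> \<in> {..x}} + e / 2"
      by (rule closed_set_probability_limit[OF D M M' W meas T cc]) (use e in auto)
    moreover have "\<forall>\<^sub>F N in sequentially. M.prob {\<omega>\<in>space M. g N (X N \<omega>) \<in> {x..}}
           \<le> M'.prob {\<omega>\<in>space M'. T \<omega> \<in> {x..}} + e / 2"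
      by (rule closed_set_probability_limit[OF D M M' W meas T cc]) (use e in auto)
    ultimately show "\<forall>\<^sub>F N in sequentially. dist (M.prob {\<omega>\<in>space M. g N (X N \<omega>) \<in> {..x}})
           (M'.prob {\<omega>\<in>space M'. T \<omega> \<in> {..x}}) < e"
    proof eventually_elim
      case (elim N)
      have "1 - M.prob {\<omega>\<in>space M. g N (X N \<omega>) \<in> {..x}}
           = M.prob (space M - {\<omega>\<in>space M. g N (X N \<omega>) \<in> {..x}})"
        by (rule M.prob_compl[symmetric]) measurable
      also have "\<dots> \<le> M.prob {\<omega>\<in>space M. g N (X N \<omega>) \<in> {x..}}"
        by (rule M.finite_measure_mono) auto
      finally show ?case using elim split e by (auto simp: dist_real_def)
    qed
  qed
qed

section \<open>Skorohod neighbourhoods of continuous paths\<close>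

text \<open>A time change within \<open>\<epsilon>\<close> of the identity moves a uniformly continuous path by little, so near a
continuous path the Skorohod metric and the uniform metric define the same neighbourhoods.\<close>

lemma skorohod_close_to_continuous_imp_uniformly_close:
  assumes z: "z \<in> D01" "continuous_on {0..1} z" and "0 < \<epsilon>"
  obtains \<delta> where "0 < \<delta>"
    "\<And>x t. x \<in> D01 \<Longrightarrow> skorohod_dist x z < \<delta> \<Longrightarrow> t \<in> {0..1} \<Longrightarrow> \<bar>x t - z t\<bar> \<le> \<epsilon>"
proof -
  have "uniformly_continuous_on {0..1} z" using z(2) by (intro compact_uniformly_continuous) auto
  then obtain d where d: "d > 0"
    "\<And>s t. s \<in> {0..1} \<Longrightarrow> t \<in> {0..1} \<Longrightarrow> dist s t < d \<Longrightarrow> dist (z s) (z t) < \<epsilon> / 2"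
    using \<open>0 < \<epsilon>\<close> unfolding uniformly_continuous_on_def by (metis half_gt_zero)
  show ?thesis
  proof (rule that[of "min d (\<epsilon> / 2)"])
    show "0 < min d (\<epsilon> / 2)" using d \<open>0 < \<epsilon>\<close> by simp
    fix x t assume x: "x \<in> D01" "skorohod_dist x z < min d (\<epsilon> / 2)" and t: "t \<in> {0..(1::real)}"
    obtain e where e: "0 < e" "e < min d (\<epsilon> / 2)" "time_changed_close e x z"
      by (rule skorohod_dist_lessD[OF x(1) z(1) x(2)])
    then obtain l where l: "l \<in> time_changes" "\<bar>l t - t\<bar> \<le> e" "\<bar>x t - z (l t)\<bar> \<le> e"
      using t unfolding time_changed_close_def by blast
    have "l t \<in> {0..1}" using l(1) t by (auto simp: time_changes_def)
    then have "dist (z (l t)) (z t) < \<epsilon> / 2" using t l(2) e(2) by (intro d(2)) (auto simp: dist_real_def)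
    then show "\<bar>x t - z t\<bar> \<le> \<epsilon>" using l(3) e(2) unfolding dist_real_def by linarith
  qed
qed

section \<open>Riemann sums and integrals with a moving end point\<close>

lemma sum_eq_set_integral_step:
  fixes g :: "nat \<Rightarrow> real"
  assumes "0 < N"
  shows "(\<Sum>i=1..N. g i) / real N = (LINT r:{0<..1}|lborel. g (nat \<lceil>real N * r\<rceil>))"
proof -
  have ind: "indicator {0<..1} r *\<^sub>R g (nat \<lceil>real N * r\<rceil>)
      = (\<Sum>i=1..N. indicator {(real i - 1) / N<..real i / N} r *\<^sub>R g i)" for r
  proof (cases "r \<in> {0<..1}")
    case True
    define k where "k = nat \<lceil>real N * r\<rceil>"
    have pos: "0 < real N * r" "real N * r \<le> real N" using True assms by auto
    have k: "k \<in> {1..N}" "real k - 1 < real N * r" "real N * r \<le> real k"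
      using pos unfolding k_def by (auto simp: le_nat_iff nat_le_iff ceiling_le_iff) linarith+
    have "indicator {(real i - 1) / N<..real i / N} r = (if i = k then 1 else 0 :: real)" for i
    proof -
      have "r \<in> {(real i - 1) / N<..real i / N} \<longleftrightarrow> real i - 1 < real N * r \<and> real N * r \<le> real i"
        using assms by (auto simp: field_simps)
      also have "\<dots> \<longleftrightarrow> i = k" using k by force
      finally show ?thesis by (simp add: indicator_def)
    qed
    then have "(\<Sum>i=1..N. indicator {(real i - 1) / N<..real i / N} r *\<^sub>R g i)
        = (\<Sum>i=1..N. if i = k then g k else 0)" by (intro sum.cong) auto
    also have "\<dots> = g k" using k by simp
    finally show ?thesis using True by (simp add: k_def)
  next
    case False
    have "indicator {(real i - 1) / N<..real i / N} r = (0::real)" if "i \<in> {1..N}" for i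
    proof -
      have "0 \<le> (real i - 1) / N" "real i / N \<le> 1" using that assms by auto
      then have "{(real i - 1) / N<..real i / N} \<subseteq> {0<..1}" by auto
      then show ?thesis using False by (auto simp: indicator_def)
    qed
    then show ?thesis using False by simp
  qed
  have "(LINT r:{0<..1}|lborel. g (nat \<lceil>real N * r\<rceil>))
      = (\<integral>r. (\<Sum>i=1..N. indicator {(real i - 1) / N<..real i / N} r *\<^sub>R g i) \<partial>lborel)"
    unfolding set_lebesgue_integral_def ind ..
  also have "\<dots> = (\<Sum>i=1..N. \<integral>r. indicator {(real i - 1) / N<..real i / N} r *\<^sub>R g i \<partial>lborel)"
    by (intro Bochner_Integration.integral_sum integrable_scaleR_left impI integrable_real_indicator)
       (auto simp: divide_right_mono)
  also have "\<dots> = (\<Sum>i=1..N. g i / N)"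
    using assms by (intro sum.cong) (auto simp: field_simps)
  finally show ?thesis by (simp add: sum_divide_distrib)
qed

lemma ceiling_ratio_tendsto:
  assumes "filterlim N at_top sequentially"
  shows "(\<lambda>j. real (nat \<lceil>real (N j) * r\<rceil>) / real (N j)) \<longlonglongrightarrow> max 0 r"
proof (rule tendsto_sandwich)
  have N': "filterlim (\<lambda>j. real (N j)) at_top sequentially"
    using assms by (rule filterlim_compose[OF filterlim_real_sequentially])
  have *: "max 0 r \<le> real (nat \<lceil>real k * r\<rceil>) / real k" "real (nat \<lceil>real k * r\<rceil>) / real k \<le> max 0 r + 1 / real k"
    if "0 < k" for k
  proof -
    have "real k * r \<le> real (nat \<lceil>real k * r\<rceil>)" "real (nat \<lceil>real k * r\<rceil>) \<le> real k * max 0 r + 1"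
      by (linarith, cases "0 \<le> r") (auto simp: max_def mult_nonneg_nonpos intro: of_nat_ceiling)
    then show "max 0 r \<le> real (nat \<lceil>real k * r\<rceil>) / real k" "real (nat \<lceil>real k * r\<rceil>) / real k \<le> max 0 r + 1 / real k"
      using that by (auto simp: field_simps max_def)
  qed
  have Npos: "\<forall>\<^sub>F j in sequentially. 0 < N j"
    using eventually_compose_filterlim[OF eventually_gt_at_top assms] .
  show "\<forall>\<^sub>F j in sequentially. max 0 r \<le> real (nat \<lceil>real (N j) * r\<rceil>) / real (N j)"
    using Npos by eventually_elim (rule *)
  show "\<forall>\<^sub>F j in sequentially. real (nat \<lceil>real (N j) * r\<rceil>) / real (N j) \<le> max 0 r + 1 / real (N j)"
    using Npos by eventually_elim (rule *)
  have "(\<lambda>j. max 0 r + 1 / real (N j)) \<longlonglongrightarrow> max 0 r + 0"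
    by (intro tendsto_intros tendsto_divide_0[OF tendsto_const] filterlim_at_top_imp_at_infinity N')
  then show "(\<lambda>j. max 0 r + 1 / real (N j)) \<longlonglongrightarrow> max 0 r" by simp
qed auto

text \<open>Written as an integral of a step function, the sum converges by dominated convergence. The
hypothesis \<open>conv\<close> asks for convergence along every index sequence \<open>i j\<close> with \<open>i j / N j \<longlonglongrightarrow> r\<close>,
because then the conclusion has the same form: the lemma can be applied to its own result, as the
nested sums of the variance ratio require. The endpoint \<open>n j / N j\<close> moves with \<open>j\<close>, which only
matters at \<open>r = s\<close>.\<close>

lemma truncated_Riemann_sum_tendsto:
  fixes g :: "nat \<Rightarrow> nat \<Rightarrow> real" and f :: "real \<Rightarrow> real"
  assumes N: "filterlim N at_top sequentially"
    and Npos: "\<And>j. 0 < N j"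
    and n: "\<And>j. n j \<le> N j" and ns: "(\<lambda>j. real (n j) / real (N j)) \<longlonglongrightarrow> s"
    and bound: "\<And>j i. i \<in> {1..N j} \<Longrightarrow> \<bar>g j i\<bar> \<le> C"
    and conv: "\<And>i r. 0 < r \<Longrightarrow> r < 1 \<Longrightarrow> (\<And>j. i j \<le> N j) \<Longrightarrow> (\<lambda>j. real (i j) / real (N j)) \<longlonglongrightarrow> r \<Longrightarrow>
               (\<lambda>j. g j (i j)) \<longlonglongrightarrow> f r"
    and f: "continuous_on {0..1} f"
  shows "(\<lambda>j. (\<Sum>i=1..n j. g j i) / real (N j)) \<longlonglongrightarrow> integral {0..s} f"
proof -
  have "\<forall>j. real (n j) / real (N j) \<le> 1" using n Npos by (simp add: divide_le_eq_1)
  then have s: "0 \<le> s" "s \<le> 1"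
    using LIMSEQ_le_const[OF ns, of 0] LIMSEQ_le_const2[OF ns, of 1] by auto
  define G where "G j r = indicator {0<..1} r *\<^sub>R (if nat \<lceil>real (N j) * r\<rceil> \<le> n j then g j (nat \<lceil>real (N j) * r\<rceil>) else 0)" for j and r :: real
  have eq: "(\<Sum>i=1..n j. g j i) / real (N j) = integral\<^sup>L lborel (G j)" for j
  proof -
    have "(\<Sum>i=1..n j. g j i) = (\<Sum>i=1..N j. if i \<le> n j then g j i else 0)"
      using n[of j] by (intro sum.mono_neutral_cong_left) auto
    then show ?thesis
      using sum_eq_set_integral_step[OF Npos, of "\<lambda>i. if i \<le> n j then g j i else 0"]
      unfolding set_lebesgue_integral_def G_def by simp
  qed
  have "(\<lambda>j. integral\<^sup>L lborel (G j)) \<longlonglongrightarrow> (\<integral>r. indicator {0..s} r *\<^sub>R f r \<partial>lborel)"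
  proof (rule integral_dominated_convergence[where w = "\<lambda>r. indicator {0..1} r *\<^sub>R max C 0"])
    show "integrable lborel (\<lambda>r::real. indicator {0..1} r *\<^sub>R max C 0)"
      by (intro integrable_scaleR_left impI integrable_real_indicator) auto
    have "continuous_on {0..s} f" using f s by (auto intro: continuous_on_subset)
    then show "(\<lambda>r. indicator {0..s} r *\<^sub>R f r) \<in> borel_measurable lborel"
      using borel_integrable_atLeastAtMost'[of 0 s f] unfolding set_integrable_def by auto
    show "G j \<in> borel_measurable lborel" for j
      unfolding G_def by measurable
    show "AE r in lborel. norm (G j r) \<le> indicator {0..1} r *\<^sub>R max C 0" for j
    proof (rule AE_I2)
      fix r :: real
      have "nat \<lceil>real (N j) * r\<rceil> \<in> {1..N j}" if "0 < r" "nat \<lceil>real (N j) * r\<rceil> \<le> n j"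
      proof -
        have "0 < real (N j) * r" using that Npos[of j] by simp
        then show ?thesis using that n[of j] by (simp only: atLeastAtMost_iff) linarith
      qed
      from bound[OF this] show "norm (G j r) \<le> indicator {0..1} r *\<^sub>R max C 0"
        by (auto simp: G_def indicator_def le_max_iff_disj)
    qed
    \<comment> \<open>At \<open>r = s\<close> the comparison of \<open>\<lceil>N r\<rceil>\<close> with
      \<open>n\<close> need not settle, and \<open>conv\<close> says nothing about \<open>0\<close> and
      \<open>1\<close>.\<close>
    have "AE r in lborel. r \<noteq> 0 \<and> r \<noteq> s \<and> r \<noteq> 1"
      by (intro AE_conjI AE_lborel_singleton)
    then show "AE r in lborel. (\<lambda>j. G j r) \<longlonglongrightarrow> indicator {0..s} r *\<^sub>R f r"
    proof eventually_elim
      case (elim r)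
      consider "r < 0 \<or> 1 < r" | "0 < r" "r < s" | "s < r" "r < 1" "0 < r" using elim s by linarith
      then show ?case
      proof cases
        case 1
        then show ?thesis using s by (auto simp: G_def indicator_def)
      next
        case 2
        define i where "i j = nat \<lceil>real (N j) * r\<rceil>" for j
        have i: "(\<lambda>j. real (i j) / real (N j)) \<longlonglongrightarrow> r"
          using ceiling_ratio_tendsto[OF N, of r] 2 by (simp add: i_def)
        have "i j \<le> N j" for j
          unfolding i_def using 2 s by (auto simp: nat_le_iff ceiling_le_iff mult_left_le)
        then have "(\<lambda>j. g j (i j)) \<longlonglongrightarrow> f r" using 2 s i by (intro conv) auto
        moreover have "\<forall>\<^sub>F j in sequentially. real (i j) / real (N j) < real (n j) / real (N j)"
          using order_tendstoD(1)[OF tendsto_diff[OF ns i], of 0] 2 by simp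
        then have "\<forall>\<^sub>F j in sequentially. g j (i j) = G j r"
        proof eventually_elim
          case (elim j)
          then have "i j \<le> n j" using Npos[of j] by (simp add: divide_less_cancel)
          then show ?case using 2 s by (auto simp: G_def i_def)
        qed
        ultimately show ?thesis using 2 s by (auto intro: Lim_transform_eventually simp: indicator_def)
      next
        case 3
        have i: "(\<lambda>j. real (nat \<lceil>real (N j) * r\<rceil>) / real (N j)) \<longlonglongrightarrow> r"
          using ceiling_ratio_tendsto[OF N, of r] 3 by simp
        have "\<forall>\<^sub>F j in sequentially. real (n j) / real (N j) < real (nat \<lceil>real (N j) * r\<rceil>) / real (N j)"
          using order_tendstoD(1)[OF tendsto_diff[OF i ns], of 0] 3 by simp
        then have "\<forall>\<^sub>F j in sequentially. G j r = 0"
        proof eventually_elim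
          case (elim j)
          then have "\<not> nat \<lceil>real (N j) * r\<rceil> \<le> n j"
            using Npos[of j] by (simp only: divide_less_cancel of_nat_less_iff not_le)
          then show ?case unfolding G_def by (simp only: if_False scaleR_zero_right)
        qed
        then show ?thesis using 3 by (auto intro: tendsto_eventually simp: indicator_def)
      qed
    qed
  qed
  moreover have "(\<integral>r. indicator {0..s} r *\<^sub>R f r \<partial>lborel) = integral {0..s} f"
    using set_borel_integral_eq_integral(2)[of "{0..s}" f] borel_integrable_atLeastAtMost'[of 0 s f]
      continuous_on_subset[OF f, of "{0..s}"] s
    unfolding set_lebesgue_integral_def by auto
  ultimately show ?thesis unfolding eq by simp
qed


lemma continuous_on_integral_upper_param:
  fixes f :: "real \<Rightarrow> real \<Rightarrow> real"
  assumes f: "continuous_on ({0..1} \<times> {0..1}) (\<lambda>(s, r). f s r)"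
  shows "continuous_on {0..1} (\<lambda>s. integral {0..s} (f s))"
  unfolding continuous_on_sequentially
proof (intro allI ballI impI)
  fix x s assume s: "s \<in> {0..(1::real)}" and x: "(\<forall>j::nat. x j \<in> {0..1}) \<and> x \<longlonglongrightarrow> s"
  obtain C where C: "\<And>s r. s \<in> {0..1} \<Longrightarrow> r \<in> {0..1} \<Longrightarrow> \<bar>f s r\<bar> \<le> C"
  proof -
    have "compact ((\<lambda>(s, r). f s r) ` ({0..1} \<times> {0..1}))"
      by (intro compact_continuous_image f compact_Times) auto
    then have "bounded ((\<lambda>(s, r). f s r) ` ({0..1} \<times> {0..1}))" by (rule compact_imp_bounded)
    then show ?thesis using that by (fastforce simp: bounded_iff)
  qed
  have cont: "continuous_on {0..1} (f s)" if "s \<in> {0..1}" for s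
  proof -
    have "continuous_on {0..1} (\<lambda>r. (s, r))"
      by (intro continuous_on_Pair continuous_on_const continuous_on_id)
    then have "continuous_on {0..1} (\<lambda>r. (\<lambda>(s, r). f s r) (s, r))"
      by (rule continuous_on_compose2[OF f]) (use that in auto)
    then show ?thesis by simp
  qed
  have cont_s: "continuous_on {0..s} (f s)" if "s \<in> {0..1}" for s
    using cont[OF that] that by (auto intro: continuous_on_subset)
  have int_eq: "integral {0..s} (f s) = (\<integral>r. indicator {0..s} r *\<^sub>R f s r \<partial>lborel)"
    and int_meas: "(\<lambda>r. indicator {0..s} r *\<^sub>R f s r) \<in> borel_measurable lborel"
    if "s \<in> {0..1}" for s
  proof -
    have "set_integrable lborel {0..s} (f s)"
      using that by (intro borel_integrable_atLeastAtMost' cont_s)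
    from set_borel_integral_eq_integral(2)[OF this] this
    show "integral {0..s} (f s) = (\<integral>r. indicator {0..s} r *\<^sub>R f s r \<partial>lborel)"
      "(\<lambda>r. indicator {0..s} r *\<^sub>R f s r) \<in> borel_measurable lborel"
      unfolding set_lebesgue_integral_def set_integrable_def by auto
  qed
  have "(\<lambda>j. \<integral>r. indicator {0..x j} r *\<^sub>R f (x j) r \<partial>lborel) \<longlonglongrightarrow> (\<integral>r. indicator {0..s} r *\<^sub>R f s r \<partial>lborel)"
  proof (rule integral_dominated_convergence[where w = "\<lambda>r. indicator {0..1} r *\<^sub>R max C 0"])
    show "integrable lborel (\<lambda>r::real. indicator {0..1} r *\<^sub>R max C 0)"
      by (intro integrable_scaleR_left impI integrable_real_indicator) auto
    show "(\<lambda>r. indicator {0..s} r *\<^sub>R f s r) \<in> borel_measurable lborel" using s by (rule int_meas)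
    show "(\<lambda>r. indicator {0..x j} r *\<^sub>R f (x j) r) \<in> borel_measurable lborel" for j
      using x by (intro int_meas) auto
    show "AE r in lborel. norm (indicator {0..x j} r *\<^sub>R f (x j) r) \<le> indicator {0..1} r *\<^sub>R max C 0" for j
    proof (rule AE_I2)
      fix r
      have "x j \<in> {0..1}" using x by auto
      then show "norm (indicator {0..x j} r *\<^sub>R f (x j) r) \<le> indicator {0..1} r *\<^sub>R max C 0"
        using C[of "x j" r] by (auto simp: indicator_def le_max_iff_disj)
    qed
    have "AE r in lborel. r \<noteq> s" by (rule AE_lborel_singleton)
    then show "AE r in lborel. (\<lambda>j. indicator {0..x j} r *\<^sub>R f (x j) r) \<longlonglongrightarrow> indicator {0..s} r *\<^sub>R f s r"
    proof eventually_elim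
      case (elim r)
      consider "r < 0" | "0 \<le> r" "r < s" | "s < r" using elim by linarith
      then show ?case
      proof cases
        case 2
        have "\<forall>\<^sub>F j in sequentially. r < x j"
          using x 2 by (intro order_tendstoD) auto
        then have "\<forall>\<^sub>F j in sequentially. f (x j) r = indicator {0..x j} r *\<^sub>R f (x j) r"
          by eventually_elim (use 2 in auto)
        moreover have "(\<lambda>j. f (x j) r) \<longlonglongrightarrow> f s r"
        proof -
          have "continuous_on {0..1} (\<lambda>s. f s r)"
          proof -
            have "continuous_on {0..1} (\<lambda>s. (s, r))"
              by (intro continuous_on_Pair continuous_on_const continuous_on_id)
            then have "continuous_on {0..1} (\<lambda>s. (\<lambda>(s, r). f s r) (s, r))"
              by (rule continuous_on_compose2[OF f]) (use 2 s in auto)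
            then show ?thesis by simp
          qed
          then show ?thesis using x s unfolding continuous_on_sequentially comp_def by auto
        qed
        ultimately show ?thesis using 2 by (auto intro: Lim_transform_eventually)
      next
        case 3
        have "\<forall>\<^sub>F j in sequentially. x j < r"
          using x 3 by (intro order_tendstoD) auto
        then have "\<forall>\<^sub>F j in sequentially. indicator {0..x j} r *\<^sub>R f (x j) r = 0"
          by eventually_elim auto
        then show ?thesis using 3 by (auto intro: tendsto_eventually)
      qed auto
    qed
  qed
  moreover have "x j \<in> {0..1}" for j using x by auto
  ultimately show "((\<lambda>s. integral {0..s} (f s)) \<circ> x) \<longlonglongrightarrow> integral {0..s} (f s)"
    using s by (simp add: int_eq comp_def)
qed

section \<open>Convergence of the variance ratio\<close>

text \<open>Numerator and denominator of the limit process, with the factor \<open>1 / s\<close> split off, so that both are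
quadratic functionals of the path.\<close>

definition limit_num :: "(real \<Rightarrow> real) \<Rightarrow> real \<Rightarrow> (real \<Rightarrow> real) \<Rightarrow> real \<Rightarrow> real" where
  "limit_num K \<zeta> b s = \<zeta> * integral {0..s} (\<lambda>r. K (\<zeta> * (r - s)) * (integral {0..r} b)\<^sup>2)"

definition limit_den :: "(real \<Rightarrow> real) \<Rightarrow> real \<Rightarrow> real" where
  "limit_den b s = integral {0..s} (\<lambda>r. (b r)\<^sup>2)"

text \<open>The finite-sample counterparts for a path \<open>a\<close> that is sampled at the points \<open>l / N\<close>. The powers of
\<open>N\<close> are distributed such that each sum is a Riemann sum and each quantity converges separately.\<close>

definition sample_num :: "(real \<Rightarrow> real) \<Rightarrow> real \<Rightarrow> nat \<Rightarrow> (real \<Rightarrow> real) \<Rightarrow> nat \<Rightarrow> real" where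
  "sample_num K H N a n =
     (\<Sum>i=1..n. real N / H * K ((real i - real n) / H) * ((\<Sum>l=1..i. a (real l / real N)) / real N)\<^sup>2) / real N"

definition sample_den :: "nat \<Rightarrow> (real \<Rightarrow> real) \<Rightarrow> nat \<Rightarrow> real" where
  "sample_den N a n = (\<Sum>i=1..n. (a (real i / real N))\<^sup>2) / real N"

lemma U_limit_eq: "U_limit K \<zeta> b s = limit_num K \<zeta> b s / (s * limit_den b s)"
  by (simp add: U_limit_def limit_num_def limit_den_def field_simps)

lemma U_process_eq:
  assumes "1 \<le> n" "n \<le> N"
  shows "U_process K h (\<lambda>l. a (real l / real N)) N (real n / real N)
    = sample_num K (h N) N a n / (real n / real N * sample_den N a n)"
proof -
  have N: "0 < real N" and n: "0 < real n" using assms by auto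
  have 1: "nat \<lfloor>real N * (real n / real N)\<rfloor> = n" using N by simp
  have 2: "\<not> real n / real N < 1 / real N" using assms N by (simp add: divide_less_cancel)
  define P where "P i = (\<Sum>l=1..i. a (real l / real N))" for i
  define S1 where "S1 = (\<Sum>i=1..n. (P i)\<^sup>2 * scaled_kernel K (h N) (real i - real n))"
  define S2 where "S2 = (\<Sum>j=1..n. (a (real j / real N))\<^sup>2)"
  have "sample_num K (h N) N a n = S1 / (real N)\<^sup>2"
    unfolding sample_num_def S1_def P_def[symmetric] sum_divide_distrib
    using N by (intro sum.cong) (auto simp: scaled_kernel_def power_divide power2_eq_square field_simps)
  moreover have "sample_den N a n = S2 / real N"
    by (simp add: sample_den_def S2_def)
  moreover have "U_process K h (\<lambda>l. a (real l / real N)) N (real n / real N)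
      = (1 / real n ^ 3 * S1) / (1 / real n ^ 2 * S2)"
    using 1 2 by (simp only: U_process_def Let_def if_False S1_def S2_def P_def)
  ultimately show ?thesis
    using N n by (cases "S2 = 0") (auto simp: field_simps power2_eq_square power3_eq_cube)
qed

lemma continuous_on_limit_den:
  assumes "continuous_on {0..1} b"
  shows "continuous_on {0..1} (limit_den b)"
  unfolding limit_den_def using assms
  by (intro indefinite_integral_continuous_1 integrable_continuous_interval continuous_intros)

lemma continuous_on_limit_num:
  assumes b: "continuous_on {0..1} b" and K: "continuous_on UNIV K"
  shows "continuous_on {0..1} (limit_num K \<zeta> b)"
  unfolding limit_num_def
proof (intro continuous_on_mult continuous_on_const continuous_on_integral_upper_param)
  have A: "continuous_on {0..1} (\<lambda>r. integral {0..r} b)"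
    using b by (intro indefinite_integral_continuous_1 integrable_continuous_interval)
  show "continuous_on ({0..1} \<times> {0..1}) (\<lambda>(s, r). K (\<zeta> * (r - s)) * (integral {0..r} b)\<^sup>2)"
    unfolding case_prod_beta
    by (intro continuous_on_mult continuous_on_power continuous_on_compose2[OF K] continuous_on_compose2[OF A]
        continuous_intros) auto
qed

text \<open>Three applications of the Riemann sum lemma: to the partial sums of the path, to the squares of the
path, and to the squared partial sums weighted with the kernel. In the last one
\<open>(i - n) / H = N / H * (i / N - n / N)\<close>, which tends to \<open>\<zeta> * (r - s)\<close>. The path \<open>a j\<close> may vary with
\<open>j\<close>, as only uniform convergence to a continuous path is known.\<close>

lemma sample_functionals_tendsto:
  fixes a :: "nat \<Rightarrow> real \<Rightarrow> real"
  assumes N: "filterlim N at_top sequentially" and Npos: "\<And>j. 0 < N j"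
    and H: "\<And>j. 0 < H j" and NH: "(\<lambda>j. real (N j) / H j) \<longlonglongrightarrow> \<zeta>"
    and n: "\<And>j. n j \<le> N j" and ns: "(\<lambda>j. real (n j) / real (N j)) \<longlonglongrightarrow> s"
    and close: "\<And>j t. t \<in> {0..1} \<Longrightarrow> \<bar>a j t - b t\<bar> \<le> e j" and e: "e \<longlonglongrightarrow> 0"
    and b: "continuous_on {0..1} b" and K: "continuous_on UNIV K"
  shows "(\<lambda>j. sample_num K (H j) (N j) (a j) (n j)) \<longlonglongrightarrow> limit_num K \<zeta> b s"
    and "(\<lambda>j. sample_den (N j) (a j) (n j)) \<longlonglongrightarrow> limit_den b s"
proof -
  have "bounded (b ` {0..1})" using b by (intro compact_imp_bounded compact_continuous_image) auto
  then obtain Cb where "\<forall>t\<in>{0..1}. \<bar>b t\<bar> \<le> Cb" by (auto simp: bounded_iff)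
  then have Cb: "\<bar>b t\<bar> \<le> Cb" if "t \<in> {0..1}" for t using that by blast
  obtain Ce where Ce: "\<And>j. \<bar>e j\<bar> \<le> Ce"
    using convergent_imp_Bseq[OF convergentI[OF e]] by (auto simp: Bseq_def)
  define C where "C = Cb + Ce"
  have C: "\<bar>a j t\<bar> \<le> C" if "t \<in> {0..1}" for j t
    using close[OF that, of j] Cb[OF that] Ce[of j] unfolding C_def by linarith
  have C0: "0 \<le> C" using C[of 0 0] by simp
  have grid: "real i / real (N j) \<in> {0..1}" if "i \<le> N j" for i j using that by (auto simp: divide_le_eq_1)
  have value_conv: "(\<lambda>j. a j (real (i j) / real (N j))) \<longlonglongrightarrow> b r"
    if "0 < r" "r < 1" "\<And>j. i j \<le> N j" "(\<lambda>j. real (i j) / real (N j)) \<longlonglongrightarrow> r" for i r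
  proof -
    have "(\<lambda>j. b (real (i j) / real (N j))) \<longlonglongrightarrow> b r"
      using b that grid unfolding continuous_on_sequentially comp_def by auto
    moreover have "(\<lambda>j. a j (real (i j) / real (N j)) - b (real (i j) / real (N j))) \<longlonglongrightarrow> 0"
      by (rule Lim_null_comparison[OF _ e]) (use close grid that in auto)
    ultimately show ?thesis by (auto dest: tendsto_add)
  qed
  have sum_conv: "(\<lambda>j. (\<Sum>l=1..i j. a j (real l / real (N j))) / real (N j)) \<longlonglongrightarrow> integral {0..r} b"
    if "\<And>j. i j \<le> N j" "(\<lambda>j. real (i j) / real (N j)) \<longlonglongrightarrow> r" for i r
    by (rule truncated_Riemann_sum_tendsto[where C = C and N = N, OF N Npos that])
      (use C grid value_conv b in auto)
  have sum_bound: "\<bar>(\<Sum>l=1..i. a j (real l / real (N j))) / real (N j)\<bar> \<le> C" if "i \<le> N j" for i j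
  proof -
    have "\<bar>\<Sum>l=1..i. a j (real l / real (N j))\<bar> \<le> (\<Sum>l=1..i. C)"
      using that by (intro order_trans[OF sum_abs] sum_mono C grid) auto
    also have "\<dots> \<le> real (N j) * C" using that C0 by (simp add: mult_right_mono)
    finally show ?thesis using Npos[of j] by (simp add: divide_le_eq mult.commute)
  qed
  show "(\<lambda>j. sample_den (N j) (a j) (n j)) \<longlonglongrightarrow> limit_den b s"
    unfolding sample_den_def limit_den_def
  proof (rule truncated_Riemann_sum_tendsto[where C = "C\<^sup>2" and N = N, OF N Npos n ns])
    show "\<bar>(a j (real i / real (N j)))\<^sup>2\<bar> \<le> C\<^sup>2" if "i \<in> {1..N j}" for i j
      using C[of "real i / real (N j)" j] grid[of i j] that C0 by (simp add: power2_le_iff_abs_le)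
  qed (use value_conv b in \<open>auto intro!: tendsto_intros continuous_intros\<close>)
  obtain CH where "\<forall>j. \<bar>real (N j) / H j\<bar> \<le> CH"
    using convergent_imp_Bseq[OF convergentI[OF NH]] by (auto simp: Bseq_def)
  then have CH: "real (N j) / H j \<le> CH" for j by (meson abs_le_D1)
  have "bounded (K ` {-CH..CH})"
    using K by (intro compact_imp_bounded compact_continuous_image) (auto intro: continuous_on_subset)
  then obtain CK where "\<forall>x\<in>{-CH..CH}. \<bar>K x\<bar> \<le> CK" by (auto simp: bounded_iff)
  then have CK: "\<bar>K x\<bar> \<le> CK" if "\<bar>x\<bar> \<le> CH" for x using that by (simp add: abs_le_iff)
  have A: "continuous_on {0..1} (\<lambda>r. integral {0..r} b)"
    using b by (intro indefinite_integral_continuous_1 integrable_continuous_interval)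
  have "(\<lambda>j. sample_num K (H j) (N j) (a j) (n j))
      \<longlonglongrightarrow> integral {0..s} (\<lambda>r. \<zeta> * K (\<zeta> * (r - s)) * (integral {0..r} b)\<^sup>2)"
    unfolding sample_num_def
  proof (rule truncated_Riemann_sum_tendsto[where C = "CH * CK * C\<^sup>2" and N = N, OF N Npos n ns])
    fix j i assume i: "i \<in> {1..N j}"
    have "\<bar>real i - real (n j)\<bar> \<le> real (N j)" using i n[of j] by auto
    then have "\<bar>(real i - real (n j)) / H j\<bar> \<le> real (N j) / H j"
      using H[of j] by (simp add: divide_right_mono)
    then have "\<bar>K ((real i - real (n j)) / H j)\<bar> \<le> CK" using CH[of j] by (intro CK) linarith
    moreover have "\<bar>real (N j) / H j\<bar> \<le> CH" using CH[of j] H[of j] by simp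
    moreover have "((\<Sum>l=1..i. a j (real l / real (N j))) / real (N j))\<^sup>2 \<le> C\<^sup>2"
      using sum_bound[of i j] i C0 by (simp add: power2_le_iff_abs_le)
    moreover have "0 \<le> CK" "0 \<le> CH"
      using calculation(1,2) by - (rule order_trans[OF abs_ge_zero], assumption)+
    ultimately show "\<bar>real (N j) / H j * K ((real i - real (n j)) / H j) *
        ((\<Sum>l=1..i. a j (real l / real (N j))) / real (N j))\<^sup>2\<bar> \<le> CH * CK * C\<^sup>2"
      unfolding abs_mult by (intro mult_mono) auto
  next
    fix i r assume r: "0 < r" "r < 1" "\<And>j. i j \<le> N j" "(\<lambda>j. real (i j) / real (N j)) \<longlonglongrightarrow> r"
    have "(\<lambda>j. real (N j) / H j * (real (i j) / real (N j) - real (n j) / real (N j))) \<longlonglongrightarrow> \<zeta> * (r - s)"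
      by (intro tendsto_intros NH r ns)
    moreover have "real (N j) / H j * (real (i j) / real (N j) - real (n j) / real (N j))
        = (real (i j) - real (n j)) / H j" for j
      using Npos[of j] H[of j] by (simp add: field_simps)
    ultimately have "(\<lambda>j. (real (i j) - real (n j)) / H j) \<longlonglongrightarrow> \<zeta> * (r - s)" by (simp only:)
    then have "(\<lambda>j. K ((real (i j) - real (n j)) / H j)) \<longlonglongrightarrow> K (\<zeta> * (r - s))"
      using K by (intro isCont_tendsto_compose[where g = K]) (simp_all add: continuous_on_eq_continuous_at)
    then show "(\<lambda>j. real (N j) / H j * K ((real (i j) - real (n j)) / H j) *
          ((\<Sum>l=1..i j. a j (real l / real (N j))) / real (N j))\<^sup>2)
        \<longlonglongrightarrow> \<zeta> * K (\<zeta> * (r - s)) * (integral {0..r} b)\<^sup>2"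
      by (intro tendsto_intros NH sum_conv r)
  next
    show "continuous_on {0..1} (\<lambda>r. \<zeta> * K (\<zeta> * (r - s)) * (integral {0..r} b)\<^sup>2)"
      by (intro continuous_intros A continuous_on_compose2[OF K]) auto
  qed
  then show "(\<lambda>j. sample_num K (H j) (N j) (a j) (n j)) \<longlonglongrightarrow> limit_num K \<zeta> b s"
    by (simp add: limit_num_def mult.assoc)
qed

section \<open>Continuity of the first crossing time\<close>

text \<open>The sign of the gap decides whether the limit process is below \<open>c\<close>. Unlike the ratio it is a
quadratic form in the path.\<close>

definition gap :: "(real \<Rightarrow> real) \<Rightarrow> real \<Rightarrow> real \<Rightarrow> (real \<Rightarrow> real) \<Rightarrow> real \<Rightarrow> real" where
  "gap K \<zeta> c b s = limit_num K \<zeta> b s - c * (s * limit_den b s)"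

text \<open>A function that touches zero without going below is the one configuration in which a small
perturbation can create a crossing that the function itself does not have.\<close>

definition touches_zero :: "(real \<Rightarrow> real) \<Rightarrow> real set \<Rightarrow> bool" where
  "touches_zero f S \<longleftrightarrow> (\<forall>s\<in>S. 0 \<le> f s) \<and> (\<exists>s\<in>S. f s = 0)"

text \<open>Paths at which the crossing time is continuous. Positivity of \<open>limit_den b \<kappa>\<close> keeps the denominator
away from zero on \<open>[\<kappa>, 1]\<close>. Rational end points suffice because a contact at
some time before the crossing persists up to every later end point before the crossing, and there are
only countably many of them to discard. For \<open>c \<le> 0\<close> no crossing ever happens, as the
ratios are nonnegative.\<close>

definition regular_path :: "(real \<Rightarrow> real) \<Rightarrow> real \<Rightarrow> real \<Rightarrow> real \<Rightarrow> (real \<Rightarrow> real) \<Rightarrow> bool" where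
  "regular_path K \<zeta> c \<kappa> b \<longleftrightarrow>
     c \<le> 0 \<or> (0 < limit_den b \<kappa> \<and> (\<forall>x\<in>\<rat>. \<kappa> < x \<longrightarrow> x < 1 \<longrightarrow> \<not> touches_zero (gap K \<zeta> c b) {\<kappa>..x}))"

lemma limit_den_mono:
  assumes b: "continuous_on {0..1} b" and "0 \<le> s" "s \<le> t" "t \<le> 1"
  shows "limit_den b s \<le> limit_den b t"
  unfolding limit_den_def using assms
  by (intro integral_subset_le integrable_continuous_interval continuous_intros)
     (auto intro: continuous_on_subset)

lemma limit_den_nonneg:
  assumes b: "continuous_on {0..1} b" and "0 \<le> s" "s \<le> 1"
  shows "0 \<le> limit_den b s"
  unfolding limit_den_def using assms
  by (intro integral_nonneg integrable_continuous_interval continuous_intros)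
     (auto intro: continuous_on_subset)

lemma limit_num_nonneg:
  assumes b: "continuous_on {0..1} b" and K: "continuous_on UNIV K" "\<And>x. 0 \<le> K x"
    and "0 \<le> \<zeta>" "0 \<le> s" "s \<le> 1"
  shows "0 \<le> limit_num K \<zeta> b s"
proof -
  have "continuous_on {0..1} (\<lambda>r. integral {0..r} b)"
    using b by (intro indefinite_integral_continuous_1 integrable_continuous_interval)
  then have "continuous_on {0..s} (\<lambda>r. integral {0..r} b)"
    by (rule continuous_on_subset) (use assms in auto)
  then have "continuous_on {0..s} (\<lambda>r. K (\<zeta> * (r - s)) * (integral {0..r} b)\<^sup>2)"
    by (intro continuous_intros continuous_on_compose2[OF K(1)]) auto
  then show ?thesis
    unfolding limit_num_def using assms
    by (intro mult_nonneg_nonneg integral_nonneg integrable_continuous_interval) auto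
qed

lemma U_limit_less_iff:
  assumes "0 < s" "0 < limit_den b s"
  shows "U_limit K \<zeta> b s < c \<longleftrightarrow> gap K \<zeta> c b s < 0"
  unfolding U_limit_eq gap_def using assms by (simp add: divide_less_eq)

lemma continuous_on_gap:
  assumes "continuous_on {0..1} b" "continuous_on UNIV K"
  shows "continuous_on {0..1} (gap K \<zeta> c b)"
  unfolding gap_def
  by (intro continuous_intros continuous_on_limit_num continuous_on_limit_den assms)

lemma limit_time_le:
  "\<kappa> \<le> s \<Longrightarrow> s \<le> 1 \<Longrightarrow> U_limit K \<zeta> b s < c \<Longrightarrow> limit_time K \<zeta> c \<kappa> b \<le> s"
  unfolding limit_time_def Let_def by (auto intro!: cInf_lower bdd_belowI[of _ \<kappa>])

lemma limit_time_le_1: "limit_time K \<zeta> c \<kappa> b \<le> 1"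
proof (cases "\<exists>s. \<kappa> \<le> s \<and> s \<le> 1 \<and> U_limit K \<zeta> b s < c")
  case True
  then show ?thesis using limit_time_le by (metis order_trans)
next
  case False
  then show ?thesis by (auto simp: limit_time_def)
qed

lemma limit_time_lessE:
  assumes "limit_time K \<zeta> c \<kappa> b < y" "y \<le> 1"
  obtains s where "\<kappa> \<le> s" "s < y" "U_limit K \<zeta> b s < c"
proof -
  define A where "A = {s. \<kappa> \<le> s \<and> s \<le> 1 \<and> U_limit K \<zeta> b s < c}"
  have T: "limit_time K \<zeta> c \<kappa> b = (if A = {} then 1 else Inf A)"
    unfolding limit_time_def A_def Let_def ..
  have "A \<noteq> {}" using assms T by (auto split: if_splits)
  then obtain s where "s \<in> A" "s < y" using T assms cInf_lessD[of A y] by auto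
  then show ?thesis using that by (auto simp: A_def)
qed

lemma stopping_time_R_le:
  "nat \<lfloor>\<kappa> * real N\<rfloor> \<le> n \<Longrightarrow> n \<le> N \<Longrightarrow> U_process K h y N (real n / real N) < c \<Longrightarrow>
   stopping_time_R K h c \<kappa> y N \<le> n"
  unfolding stopping_time_R_def Let_def by (auto intro!: Min_le)

lemma stopping_time_R_cases:
  obtains "stopping_time_R K h c \<kappa> y N = N"
    "\<And>n. nat \<lfloor>\<kappa> * real N\<rfloor> \<le> n \<Longrightarrow> n \<le> N \<Longrightarrow> \<not> U_process K h y N (real n / real N) < c"
  | "nat \<lfloor>\<kappa> * real N\<rfloor> \<le> stopping_time_R K h c \<kappa> y N" "stopping_time_R K h c \<kappa> y N \<le> N"
    "U_process K h y N (real (stopping_time_R K h c \<kappa> y N) / real N) < c"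
proof -
  define A where "A = {n. nat \<lfloor>\<kappa> * real N\<rfloor> \<le> n \<and> n \<le> N \<and> U_process K h y N (real n / real N) < c}"
  have R: "stopping_time_R K h c \<kappa> y N = (if A = {} then N else Min A)"
    unfolding stopping_time_R_def A_def Let_def ..
  have fin: "finite A" by (rule finite_subset[of _ "{..N}"]) (auto simp: A_def)
  show ?thesis
  proof (cases "A = {}")
    case True
    then have "\<not> U_process K h y N (real n / real N) < c" if "nat \<lfloor>\<kappa> * real N\<rfloor> \<le> n" "n \<le> N" for n
      using that unfolding A_def by blast
    then show ?thesis using R True by (intro that(1)) simp_all
  next
    case False
    then have "stopping_time_R K h c \<kappa> y N \<in> A" using R Min_in[OF fin] by simp
    then show ?thesis unfolding A_def by (intro that(2)) blast+
  qed
qed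

lemma stopping_time_R_le_N: "stopping_time_R K h c \<kappa> y N \<le> N"
  by (rule stopping_time_R_cases[of K h c \<kappa> y N]) auto

lemma floor_ratio_tendsto:
  assumes N: "filterlim N at_top sequentially" and Npos: "\<And>j. 0 < N j" and "0 \<le> s"
  shows "(\<lambda>j. real (nat \<lfloor>s * real (N j)\<rfloor>) / real (N j)) \<longlonglongrightarrow> s"
proof (rule tendsto_sandwich)
  have N': "filterlim (\<lambda>j. real (N j)) at_top sequentially"
    using N by (rule filterlim_compose[OF filterlim_real_sequentially])
  have *: "s - 1 / real k \<le> real (nat \<lfloor>s * real k\<rfloor>) / real k" "real (nat \<lfloor>s * real k\<rfloor>) / real k \<le> s"
    if "0 < k" for k
  proof -
    have "s * real k - 1 \<le> real (nat \<lfloor>s * real k\<rfloor>)" "real (nat \<lfloor>s * real k\<rfloor>) \<le> s * real k"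
      using assms(3) by (linarith, simp)
    then have "(s * real k - 1) / real k \<le> real (nat \<lfloor>s * real k\<rfloor>) / real k"
      "real (nat \<lfloor>s * real k\<rfloor>) / real k \<le> s * real k / real k"
      by (intro divide_right_mono; simp)+
    then show "s - 1 / real k \<le> real (nat \<lfloor>s * real k\<rfloor>) / real k" "real (nat \<lfloor>s * real k\<rfloor>) / real k \<le> s"
      using that by (auto simp: diff_divide_distrib)
  qed
  show "\<forall>\<^sub>F j in sequentially. s - 1 / real (N j) \<le> real (nat \<lfloor>s * real (N j)\<rfloor>) / real (N j)"
    "\<forall>\<^sub>F j in sequentially. real (nat \<lfloor>s * real (N j)\<rfloor>) / real (N j) \<le> s"
    using *[OF Npos] by (auto intro: always_eventually)
  have "(\<lambda>j. s - 1 / real (N j)) \<longlonglongrightarrow> s - 0"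
    by (intro tendsto_intros tendsto_divide_0[OF tendsto_const] filterlim_at_top_imp_at_infinity N')
  then show "(\<lambda>j. s - 1 / real (N j)) \<longlonglongrightarrow> s" by simp
qed auto

lemma sample_num_nonneg:
  "0 < H \<Longrightarrow> (\<And>x. 0 \<le> K x) \<Longrightarrow> 0 \<le> sample_num K H N a n"
  unfolding sample_num_def by (intro divide_nonneg_nonneg sum_nonneg mult_nonneg_nonneg) auto

lemma sample_den_nonneg: "0 \<le> sample_den N a n"
  unfolding sample_den_def by (intro divide_nonneg_nonneg sum_nonneg) auto

text \<open>For \<open>c \<le> 0\<close> both times take their default values. Otherwise, if the limit is below \<open>c\<close> at some \<open>s\<close>, then the sampled ratios at \<open>\<lfloor>s N\<rfloor>\<close> eventually are as
well, which bounds the stopping times from above. If the stopping times stayed below some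
\<open>y < T\<close> along a subsequence, then they would accumulate at a time \<open>s \<le> y\<close> where the gap is at most
zero; before \<open>T\<close> the gap is nonnegative, so it would touch zero there, which a regular path
excludes.\<close>

lemma stopping_time_tendsto_limit_time:
  fixes a :: "nat \<Rightarrow> real \<Rightarrow> real"
  assumes N: "filterlim N at_top sequentially" and Npos: "\<And>j. 0 < N j"
    and h: "\<And>N. N \<ge> 1 \<Longrightarrow> 0 < h N" and Nh: "(\<lambda>N. real N / h N) \<longlonglongrightarrow> \<zeta>"
    and close: "\<And>j t. t \<in> {0..1} \<Longrightarrow> \<bar>a j t - b t\<bar> \<le> e j" and e: "e \<longlonglongrightarrow> 0"
    and b: "continuous_on {0..1} b" and K: "continuous_on UNIV K" "\<And>x. 0 \<le> K x"
    and \<zeta>: "0 \<le> \<zeta>" and \<kappa>: "0 < \<kappa>" "\<kappa> < 1"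
    and reg: "regular_path K \<zeta> c \<kappa> b"
  shows "(\<lambda>j. real (stopping_time_R K h c \<kappa> (\<lambda>l. a j (real l / real (N j))) (N j)) / real (N j))
           \<longlonglongrightarrow> limit_time K \<zeta> c \<kappa> b"
proof -
  define R where "R j = stopping_time_R K h c \<kappa> (\<lambda>l. a j (real l / real (N j))) (N j)" for j
  define U where "U j n = U_process K h (\<lambda>l. a j (real l / real (N j))) (N j) (real n / real (N j))" for j n
  define T where "T = limit_time K \<zeta> c \<kappa> b"
  have H: "0 < h (N j)" for j using h[of "N j"] Npos[of j] by simp
  have NH: "(\<lambda>j. real (N j) / h (N j)) \<longlonglongrightarrow> \<zeta>" using filterlim_compose[OF Nh N] .
  have floor_le: "nat \<lfloor>x * real k\<rfloor> \<le> k" if "x \<le> 1" for x :: real and k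
  proof -
    have "x * real k \<le> 1 * real k" using that by (intro mult_right_mono) auto
    then show ?thesis by linarith
  qed
  have R_le: "real (R j) / real (N j) \<le> 1" for j
    using stopping_time_R_le_N[of K h c \<kappa> _ "N j"] Npos[of j] by (simp add: R_def)
  have \<kappa>N: "(\<lambda>j. real (nat \<lfloor>\<kappa> * real (N j)\<rfloor>) / real (N j)) \<longlonglongrightarrow> \<kappa>"
    using \<kappa> by (intro floor_ratio_tendsto[OF N Npos]) auto
  have R_cases: "R j = N j \<and> (\<forall>n. nat \<lfloor>\<kappa> * real (N j)\<rfloor> \<le> n \<longrightarrow> n \<le> N j \<longrightarrow> \<not> U j n < c)
      \<or> nat \<lfloor>\<kappa> * real (N j)\<rfloor> \<le> R j \<and> U j (R j) < c" for j
    by (rule stopping_time_R_cases[of K h c \<kappa> "\<lambda>l. a j (real l / real (N j))" "N j"])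
      (auto simp: R_def U_def)
  have U_eq: "U j n = sample_num K (h (N j)) (N j) (a j) n / (real n / real (N j) * sample_den (N j) (a j) n)"
    if "1 \<le> n" "n \<le> N j" for j n
    unfolding U_def by (rule U_process_eq[OF that])
  have T1: "T \<le> 1" unfolding T_def by (rule limit_time_le_1)
  show ?thesis
  proof (cases "c \<le> 0")
    case True
    have "T = 1"
    proof (rule ccontr)
      assume "T \<noteq> 1"
      then obtain s where s: "\<kappa> \<le> s" "s < 1" "U_limit K \<zeta> b s < c"
        using limit_time_lessE[of K \<zeta> c \<kappa> b 1] T1 by (auto simp: T_def)
      moreover have "0 \<le> U_limit K \<zeta> b s"
        unfolding U_limit_eq using s \<kappa>
        by (intro divide_nonneg_nonneg mult_nonneg_nonneg limit_num_nonneg limit_den_nonneg b K \<zeta>) auto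
      ultimately show False using True by simp
    qed
    moreover have "\<forall>\<^sub>F j in sequentially. 0 < real (nat \<lfloor>\<kappa> * real (N j)\<rfloor>) / real (N j)"
      by (rule order_tendstoD(1)[OF \<kappa>N \<kappa>(1)])
    then have "\<forall>\<^sub>F j in sequentially. real (R j) / real (N j) = 1"
    proof eventually_elim
      case (elim j)
      have "0 < nat \<lfloor>\<kappa> * real (N j)\<rfloor>" by (rule ccontr) (use elim in simp)
      moreover have "0 \<le> U j n" if "1 \<le> n" "n \<le> N j" for n
        unfolding U_eq[OF that]
        by (intro divide_nonneg_nonneg mult_nonneg_nonneg sample_num_nonneg sample_den_nonneg H K) auto
      moreover have "R j \<le> N j" unfolding R_def by (rule stopping_time_R_le_N)
      ultimately have "\<not> (nat \<lfloor>\<kappa> * real (N j)\<rfloor> \<le> R j \<and> U j (R j) < c)"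
        using True by (smt (verit) One_nat_def Suc_leI le_trans)
      then have "R j = N j" using R_cases[of j] by blast
      then show ?case using Npos[of j] by simp
    qed
    ultimately show ?thesis unfolding R_def[symmetric] T_def[symmetric] by (simp add: tendsto_eventually)
  next
    case False
    then have c: "0 < c" by simp
    have den\<kappa>: "0 < limit_den b \<kappa>"
      and touch: "\<And>x. x \<in> \<rat> \<Longrightarrow> \<kappa> < x \<Longrightarrow> x < 1 \<Longrightarrow> \<not> touches_zero (gap K \<zeta> c b) {\<kappa>..x}"
      using reg False unfolding regular_path_def by auto
    have den: "0 < limit_den b s" if "\<kappa> \<le> s" "s \<le> 1" for s
      using limit_den_mono[OF b, of \<kappa> s] den\<kappa> \<kappa> that by simp
    \<comment> \<open>For a sequence of times that tends to \<open>s\<close>, crossing at level \<open>c\<close> is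
      eventually the same as a negative sampled gap, since the sampled denominators have a positive limit.\<close>
    have key: "\<forall>\<^sub>F j in sequentially. 1 \<le> n j \<and> (U (r j) (n j) < c \<longleftrightarrow> q j < 0)"
      and key_lim: "q \<longlonglongrightarrow> gap K \<zeta> c b s"
      if r: "filterlim r at_top sequentially" and n: "\<And>j. n j \<le> N (r j)"
        and ns: "(\<lambda>j. real (n j) / real (N (r j))) \<longlonglongrightarrow> s" and s: "\<kappa> \<le> s" "s \<le> 1"
        and q: "q = (\<lambda>j. sample_num K (h (N (r j))) (N (r j)) (a (r j)) (n j)
           - c * (real (n j) / real (N (r j)) * sample_den (N (r j)) (a (r j)) (n j)))"
      for r n s q
    proof -
      have Nr: "filterlim (\<lambda>j. N (r j)) at_top sequentially"
        using filterlim_compose[OF N r] .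
      have lims: "(\<lambda>j. sample_num K (h (N (r j))) (N (r j)) (a (r j)) (n j)) \<longlonglongrightarrow> limit_num K \<zeta> b s"
        "(\<lambda>j. sample_den (N (r j)) (a (r j)) (n j)) \<longlonglongrightarrow> limit_den b s"
        by (rule sample_functionals_tendsto[where a = "\<lambda>j. a (r j)" and e = "\<lambda>j. e (r j)",
            OF Nr Npos H filterlim_compose[OF Nh Nr] n ns close filterlim_compose[OF e r] b K(1)]; assumption)+
      show "q \<longlonglongrightarrow> gap K \<zeta> c b s"
        unfolding q gap_def by (intro tendsto_intros lims ns)
      have "\<forall>\<^sub>F j in sequentially. 0 < sample_den (N (r j)) (a (r j)) (n j)"
        by (rule order_tendstoD(1)[OF lims(2) den[OF s]])
      moreover have "\<forall>\<^sub>F j in sequentially. 0 < real (n j) / real (N (r j))"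
        by (rule order_tendstoD(1)[OF ns]) (use s \<kappa> in simp)
      ultimately show "\<forall>\<^sub>F j in sequentially. 1 \<le> n j \<and> (U (r j) (n j) < c \<longleftrightarrow> q j < 0)"
      proof eventually_elim
        case (elim j)
        then have nj: "1 \<le> n j" by (cases "n j") auto
        have "0 < real (n j) / real (N (r j)) * sample_den (N (r j)) (a (r j)) (n j)"
          using elim by (intro mult_pos_pos)
        then show ?case unfolding U_eq[OF nj n] q
          by (simp only: nj divide_less_eq if_True) simp
      qed
    qed
    have "(\<lambda>j. real (R j) / real (N j)) \<longlonglongrightarrow> T"
    proof (rule order_tendstoI)
      fix y assume y: "T < y"
      show "\<forall>\<^sub>F j in sequentially. real (R j) / real (N j) < y"
      proof (cases "1 < y")
        case True
        then show ?thesis using R_le by (auto intro!: always_eventually intro: le_less_trans)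
      next
        case False
        then obtain s where s: "\<kappa> \<le> s" "s < y" "U_limit K \<zeta> b s < c" "s \<le> 1"
          using limit_time_lessE[of K \<zeta> c \<kappa> b y] y by (auto simp: T_def)
        define n where "n j = nat \<lfloor>s * real (N j)\<rfloor>" for j
        have ns: "(\<lambda>j. real (n j) / real (N j)) \<longlonglongrightarrow> s"
          unfolding n_def using s \<kappa> by (intro floor_ratio_tendsto[OF N Npos]) auto
        have n: "n j \<le> N j" for j unfolding n_def using s by (intro floor_le)
        have "gap K \<zeta> c b s < 0"
          using U_limit_less_iff[of s b K \<zeta> c] den[of s] s \<kappa> by simp
        note neg = order_tendstoD(2)[OF key_lim[OF filterlim_ident n ns s(1) s(4) refl] this]
        show ?thesis using key[OF filterlim_ident n ns s(1) s(4) refl] neg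
          order_tendstoD(2)[OF ns s(2)]
        proof eventually_elim
          case (elim j)
          have "nat \<lfloor>\<kappa> * real (N j)\<rfloor> \<le> n j"
            unfolding n_def using s by (intro nat_mono floor_mono mult_right_mono) auto
          then have "R j \<le> n j"
            using elim n[of j] stopping_time_R_le[of \<kappa> "N j" "n j" K h _ c] unfolding R_def U_def by blast
          then have "real (R j) / real (N j) \<le> real (n j) / real (N j)"
            by (intro divide_right_mono) auto
          then show ?case using elim by simp
        qed
      qed
    next
      fix y assume y: "y < T"
      show "\<forall>\<^sub>F j in sequentially. y < real (R j) / real (N j)"
      proof (rule ccontr)
        assume "\<not> ?thesis"
        then have freq: "\<exists>\<^sub>F j in sequentially. real (R j) / real (N j) \<le> y"
          by (simp add: frequently_def not_le)
        then obtain r0 :: "nat \<Rightarrow> nat" where r0: "strict_mono r0" "\<And>j. real (R (r0 j)) / real (N (r0 j)) \<le> y"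
        proof -
          have "infinite {j. real (R j) / real (N j) \<le> y}"
            using freq
            by (simp add: frequently_cofinite flip: cofinite_eq_sequentially)
          from infinite_enumerate[OF this] show ?thesis using that by auto
        qed
        have "\<forall>j. real (R (r0 j)) / real (N (r0 j)) \<in> {0..1}" using R_le by simp
        then obtain s r1 where s01: "s \<in> {0..1}" and r1: "strict_mono (r1 :: nat \<Rightarrow> nat)"
          and sub: "((\<lambda>j. real (R (r0 j)) / real (N (r0 j))) \<circ> r1) \<longlonglongrightarrow> s"
          by (rule seq_compactE[OF compact_imp_seq_compact[OF compact_Icc]])
        define r where "r = r0 \<circ> r1"
        have r: "filterlim r at_top sequentially"
          unfolding r_def using r0(1) r1 by (intro filterlim_subseq strict_mono_o)
        have lim: "(\<lambda>j. real (R (r j)) / real (N (r j))) \<longlonglongrightarrow> s"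
          using sub by (simp add: r_def comp_def)
        have sy: "s \<le> y"
          by (rule LIMSEQ_le_const2[OF lim]) (use r0(2) in \<open>auto simp: r_def\<close>)
        \<comment> \<open>The bound \<open>y < 1\<close> excludes the default value \<open>N\<close> of the stopping
          time, so these indices are genuine crossings.\<close>
        have hit: "nat \<lfloor>\<kappa> * real (N (r j))\<rfloor> \<le> R (r j) \<and> U (r j) (R (r j)) < c" for j
        proof -
          have "real (R (r j)) / real (N (r j)) \<le> y" using r0(2) by (simp add: r_def)
          then have "R (r j) \<noteq> N (r j)" using y T1 Npos[of "r j"] by auto
          then show ?thesis using R_cases[of "r j"] by blast
        qed
        have "(\<lambda>j. real (nat \<lfloor>\<kappa> * real (N (r j))\<rfloor>) / real (N (r j))) \<longlonglongrightarrow> \<kappa>"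
          using filterlim_compose[OF \<kappa>N r] .
        then have \<kappa>s: "\<kappa> \<le> s"
          by (rule LIMSEQ_le[OF _ lim]) (use hit in \<open>auto intro!: divide_right_mono\<close>)
        have s1: "s \<le> 1" using s01 by simp
        have Rn: "R (r j) \<le> N (r j)" for j unfolding R_def by (rule stopping_time_R_le_N)
        have "\<forall>\<^sub>F j in sequentially. sample_num K (h (N (r j))) (N (r j)) (a (r j)) (R (r j))
           - c * (real (R (r j)) / real (N (r j)) * sample_den (N (r j)) (a (r j)) (R (r j))) \<le> 0"
          using key[OF r Rn lim \<kappa>s s1 refl] by eventually_elim (use hit in auto)
        then have "gap K \<zeta> c b s \<le> 0"
          by (intro tendsto_upperbound[OF key_lim[OF r Rn lim \<kappa>s s1 refl]]) auto
        moreover have nonneg: "0 \<le> gap K \<zeta> c b t" if t: "\<kappa> \<le> t" "t < T" for t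
        proof -
          have "\<not> U_limit K \<zeta> b t < c"
            using limit_time_le[of \<kappa> t K \<zeta> b c] t T1 by (auto simp: T_def)
          then show ?thesis using U_limit_less_iff[of t b K \<zeta> c] den[of t] t T1 \<kappa> by simp
        qed
        moreover have "s < T" using sy y by simp
        ultimately have "gap K \<zeta> c b s = 0" using \<kappa>s by (simp add: order_antisym)
        obtain x where x: "x \<in> \<rat>" "s < x" "x < T" using Rats_dense_in_real[OF \<open>s < T\<close>] by auto
        have "touches_zero (gap K \<zeta> c b) {\<kappa>..x}"
          unfolding touches_zero_def
          using x \<open>gap K \<zeta> c b s = 0\<close> \<kappa>s by (auto intro!: nonneg bexI[of _ s])
        then show False using touch[of x] x \<kappa>s T1 by auto
      qed
    qed
    then show ?thesis unfolding R_def T_def .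
  qed
qed

section \<open>A Cameron-Martin formula for Brownian motion\<close>

text \<open>Completing the square; this is the one-dimensional Cameron-Martin formula for variance \<open>d\<close> and shift
\<open>\<alpha> * d\<close>.\<close>

lemma normal_shift_density:
  assumes "0 < d"
  shows "normal_density 0 (sqrt d) (x - \<alpha> * d) = normal_density 0 (sqrt d) x * exp (\<alpha> * x - \<alpha>\<^sup>2 * d / 2)"
proof -
  have "- (x - \<alpha> * d)\<^sup>2 / (2 * d) = - x\<^sup>2 / (2 * d) + (\<alpha> * x - \<alpha>\<^sup>2 * d / 2)"
    using assms by (simp add: field_simps power2_eq_square)
  then show ?thesis using assms by (simp add: normal_density_def mult.assoc flip: exp_add)
qed

lemma nn_integral_normal_shift:
  assumes X: "distributed M lborel X (normal_density 0 (sqrt d))" and d: "0 < d"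
    and [measurable]: "A \<in> sets borel"
  shows "(\<integral>\<^sup>+\<omega>. indicator A (X \<omega> + \<alpha> * d) \<partial>M)
       = (\<integral>\<^sup>+\<omega>. indicator A (X \<omega>) * ennreal (exp (\<alpha> * X \<omega> - \<alpha>\<^sup>2 * d / 2)) \<partial>M)"
proof -
  have "(\<integral>\<^sup>+\<omega>. indicator A (X \<omega> + \<alpha> * d) \<partial>M)
      = (\<integral>\<^sup>+x. ennreal (normal_density 0 (sqrt d) x) * indicator A (x + \<alpha> * d) \<partial>lborel)"
    by (rule distributed_nn_integral[OF X, symmetric]) measurable
  also have "\<dots> = (\<integral>\<^sup>+x. ennreal (normal_density 0 (sqrt d) (x - \<alpha> * d)) * indicator A x \<partial>lborel)"
    using nn_integral_real_affine[of "\<lambda>x. ennreal (normal_density 0 (sqrt d) (x - \<alpha> * d)) * indicator A x" 1 "\<alpha> * d"]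
    by (simp add: add.commute)
  also have "\<dots> = (\<integral>\<^sup>+x. ennreal (normal_density 0 (sqrt d) x) *
      (indicator A x * ennreal (exp (\<alpha> * x - \<alpha>\<^sup>2 * d / 2))) \<partial>lborel)"
    by (intro nn_integral_cong) (simp add: normal_shift_density[OF d] ennreal_mult' mult_ac)
  also have "\<dots> = (\<integral>\<^sup>+\<omega>. indicator A (X \<omega>) * ennreal (exp (\<alpha> * X \<omega> - \<alpha>\<^sup>2 * d / 2)) \<partial>M)"
    by (rule distributed_nn_integral[OF X]) measurable
  finally show ?thesis .
qed

lemma emeasure_distr_nn_integral:
  assumes V: "V \<in> measurable M N" and S: "S \<in> sets N"
  shows "emeasure (distr M N V) S = (\<integral>\<^sup>+\<omega>. indicator S (V \<omega>) \<partial>M)"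
proof -
  have "emeasure (distr M N V) S = (\<integral>\<^sup>+\<omega>. indicator (V -` S \<inter> space M) \<omega> \<partial>M)"
    using S V by (simp add: emeasure_distr measurable_sets[OF V S])
  also have "\<dots> = (\<integral>\<^sup>+\<omega>. indicator S (V \<omega>) \<partial>M)"
    by (intro nn_integral_cong) (simp add: indicator_def)
  finally show ?thesis .
qed

lemma emeasure_distr_density_nn_integral:
  fixes Z :: "'a \<Rightarrow> real"
  assumes V: "V \<in> measurable M N" and Z: "Z \<in> borel_measurable M" and S: "S \<in> sets N"
  shows "emeasure (distr (density M Z) N V) S = (\<integral>\<^sup>+\<omega>. ennreal (Z \<omega>) * indicator S (V \<omega>) \<partial>M)"
proof -
  have "emeasure (distr (density M Z) N V) S = emeasure (density M Z) (V -` S \<inter> space M)"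
    using S V by (simp add: emeasure_distr)
  also have "\<dots> = (\<integral>\<^sup>+\<omega>. ennreal (Z \<omega>) * indicator (V -` S \<inter> space M) \<omega> \<partial>M)"
    using measurable_sets[OF V S] Z by (intro emeasure_density) auto
  also have "\<dots> = (\<integral>\<^sup>+\<omega>. ennreal (Z \<omega>) * indicator S (V \<omega>) \<partial>M)"
    by (intro nn_integral_cong) (simp add: indicator_def)
  finally show ?thesis .
qed

text \<open>Both sides define measures on a finite product. On boxes the expectations factorise by
independence and agree factor by factor by the one-dimensional formula; boxes determine the
measure.\<close>

lemma (in prob_space) nn_integral_indep_normal_shift:
  fixes X :: "nat \<Rightarrow> 'a \<Rightarrow> real"
  assumes indep: "indep_vars (\<lambda>_. borel) X {..<n}"
    and X: "\<And>i. i < n \<Longrightarrow> distributed M lborel (X i) (normal_density 0 (sqrt (d i)))"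
    and d: "\<And>i. i < n \<Longrightarrow> 0 < d i"
    and Q: "Q \<in> sets (PiM {..<n} (\<lambda>_. borel))"
  shows "(\<integral>\<^sup>+\<omega>. indicator Q (\<lambda>i\<in>{..<n}. X i \<omega> + \<alpha> i * d i) \<partial>M)
       = (\<integral>\<^sup>+\<omega>. indicator Q (\<lambda>i\<in>{..<n}. X i \<omega>) *
             ennreal (exp ((\<Sum>i<n. \<alpha> i * X i \<omega>) - (\<Sum>i<n. (\<alpha> i)\<^sup>2 * d i) / 2)) \<partial>M)"
proof -
  let ?Pi = "PiM {..<n} (\<lambda>_. borel :: real measure)"
  have Xm [measurable]: "X i \<in> borel_measurable M" if "i < n" for i
    using distributed_measurable[OF X[OF that]] by simp
  define V where "V \<omega> = (\<lambda>i\<in>{..<n}. X i \<omega> + \<alpha> i * d i)" for \<omega>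
  define W where "W \<omega> = (\<lambda>i\<in>{..<n}. X i \<omega>)" for \<omega>
  define z where "z i x = exp (\<alpha> i * x - (\<alpha> i)\<^sup>2 * d i / 2)" for i x
  define Z where "Z \<omega> = exp ((\<Sum>i<n. \<alpha> i * X i \<omega>) - (\<Sum>i<n. (\<alpha> i)\<^sup>2 * d i) / 2)" for \<omega>
  have V [measurable]: "V \<in> measurable M ?Pi" and W [measurable]: "W \<in> measurable M ?Pi"
    unfolding V_def W_def by (intro measurable_restrict; simp)+
  have Z [measurable]: "Z \<in> borel_measurable M"
    unfolding Z_def by measurable
  have Z_prod: "Z \<omega> = (\<Prod>i<n. z i (X i \<omega>))" for \<omega>
    unfolding Z_def z_def by (simp add: exp_sum sum_subtractf sum_divide_distrib flip: exp_sum)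
  have [measurable]: "z i \<in> borel_measurable borel" for i unfolding z_def by measurable
  note emV = emeasure_distr_nn_integral[OF V] and emW = emeasure_distr_density_nn_integral[OF W Z]
  have "distr M ?Pi V = distr (density M Z) ?Pi W"
  proof (rule measure_eqI_PiM_finite)
    fix A :: "nat \<Rightarrow> real set" assume A: "\<And>i. i \<in> {..<n} \<Longrightarrow> A i \<in> sets borel"
    have PA: "Pi\<^sub>E {..<n} A \<in> sets ?Pi" using A by (intro sets_PiM_I_finite) auto
    have "emeasure (distr M ?Pi V) (Pi\<^sub>E {..<n} A) = (\<integral>\<^sup>+\<omega>. indicator (Pi\<^sub>E {..<n} A) (V \<omega>) \<partial>M)"
      by (rule emV[OF PA])
    also have "\<dots> = (\<integral>\<^sup>+\<omega>. (\<Prod>i<n. indicator (A i) (X i \<omega> + \<alpha> i * d i)) \<partial>M)"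
      by (intro nn_integral_cong) (auto simp: V_def indicator_def PiE_iff prod_zero_iff)
    also have "\<dots> = (\<Prod>i<n. \<integral>\<^sup>+\<omega>. indicator (A i) (X i \<omega> + \<alpha> i * d i) \<partial>M)"
    proof (rule indep_vars_nn_integral)
      show "indep_vars (\<lambda>_. borel) (\<lambda>i \<omega>. indicator (A i) (X i \<omega> + \<alpha> i * d i) :: ennreal) {..<n}"
        by (rule indep_vars_compose2[OF indep, of "\<lambda>i x. indicator (A i) (x + \<alpha> i * d i)"])
          (use A in measurable)
    qed auto
    also have "\<dots> = (\<Prod>i<n. \<integral>\<^sup>+\<omega>. indicator (A i) (X i \<omega>) * ennreal (z i (X i \<omega>)) \<partial>M)"
      unfolding z_def by (intro prod.cong nn_integral_normal_shift X d A) auto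
    also have "\<dots> = (\<integral>\<^sup>+\<omega>. (\<Prod>i<n. indicator (A i) (X i \<omega>) * ennreal (z i (X i \<omega>))) \<partial>M)"
    proof (rule indep_vars_nn_integral[symmetric])
      show "indep_vars (\<lambda>_. borel) (\<lambda>i \<omega>. indicator (A i) (X i \<omega>) * ennreal (z i (X i \<omega>))) {..<n}"
        by (rule indep_vars_compose2[OF indep, of "\<lambda>i x. indicator (A i) x * ennreal (z i x)"])
          (use A in measurable)
    qed auto
    also have "\<dots> = (\<integral>\<^sup>+\<omega>. ennreal (Z \<omega>) * indicator (Pi\<^sub>E {..<n} A) (W \<omega>) \<partial>M)"
    proof (intro nn_integral_cong)
      fix \<omega>
      have "(\<Prod>i<n. indicator (A i) (X i \<omega>) :: ennreal) = indicator (Pi\<^sub>E {..<n} A) (W \<omega>)"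
        by (auto simp: W_def indicator_def PiE_iff prod_zero_iff)
      moreover have "(\<Prod>i<n. ennreal (z i (X i \<omega>))) = ennreal (Z \<omega>)"
        unfolding Z_prod by (rule prod_ennreal) (simp add: z_def)
      ultimately show "(\<Prod>i<n. indicator (A i) (X i \<omega>) * ennreal (z i (X i \<omega>))) =
          ennreal (Z \<omega>) * indicator (Pi\<^sub>E {..<n} A) (W \<omega>)"
        by (simp add: prod.distrib mult.commute)
    qed
    also have "\<dots> = emeasure (distr (density M Z) ?Pi W) (Pi\<^sub>E {..<n} A)"
      by (rule emW[OF PA, symmetric])
    finally show "emeasure (distr M ?Pi V) (Pi\<^sub>E {..<n} A) = emeasure (distr (density M Z) ?Pi W) (Pi\<^sub>E {..<n} A)" .
  next
    show "range (\<lambda>_::nat. Pi\<^sub>E {..<n} (\<lambda>_. UNIV)) \<subseteq> prod_algebra {..<n} (\<lambda>_. borel :: real measure)"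
      by (auto intro!: prod_algebraI_finite)
    show "emeasure (distr M ?Pi V) (Pi\<^sub>E {..<n} (\<lambda>_. UNIV)) \<noteq> \<infinity>" for i :: nat
      using finite_measure.emeasure_finite[OF finite_measure_distr[OF V]] by simp
  qed (auto simp: space_PiM)
  then have "(\<integral>\<^sup>+\<omega>. indicator Q (V \<omega>) \<partial>M) = (\<integral>\<^sup>+\<omega>. ennreal (Z \<omega>) * indicator Q (W \<omega>) \<partial>M)"
    using emV[OF Q] emW[OF Q] by simp
  then show ?thesis by (simp add: V_def W_def Z_def mult.commute)
qed


text \<open>A path of slope \<open>1\<close> on \<open>[0, \<eta>]\<close>, slope \<open>-1\<close> on \<open>[\<eta>, 2\<eta>]\<close>, and value \<open>0\<close> afterwards.\<close>

definition tent :: "real \<Rightarrow> real \<Rightarrow> real" where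
  "tent \<eta> t = max 0 (\<eta> - \<bar>t - \<eta>\<bar>)"

lemma finite_set_as_strict_mono_sequence:
  fixes S :: "real set"
  assumes S: "finite S" "S \<noteq> {}"
  obtains n :: nat and \<tau> :: "nat \<Rightarrow> real" where "strict_mono_on {..n} \<tau>" "\<tau> ` {..n} = S"
proof -
  define xs where "xs = sorted_list_of_set S"
  have xs: "set xs = S" "sorted_wrt (<) xs" "xs \<noteq> []" using S by (auto simp: xs_def)
  have n: "{..length xs - 1} = {..<length xs}" using xs(3) by (cases xs) auto
  show ?thesis
  proof (rule that[of "length xs - 1" "\<lambda>i. xs ! i"])
    show "strict_mono_on {..length xs - 1} (\<lambda>i. xs ! i)"
      unfolding n strict_mono_on_def using sorted_wrt_nth_less[OF xs(2)] by auto
    show "(\<lambda>i. xs ! i) ` {..length xs - 1} = S"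
      unfolding n using xs(1) by (simp add: set_conv_nth image_def Bex_def lessThan_def) blast
  qed
qed

text \<open>The density is \<open>exp (\<epsilon> W - \<epsilon>\<^sup>2 E / 2)\<close>, where \<open>W = B \<eta> - (B (2\<eta>) - B \<eta>)\<close> is the Wiener integral of the
derivative of the tent and \<open>E = 2\<eta>\<close> is the integral of its square. It suffices to compare
cylinder sets. On a finite grid that contains \<open>0\<close>, \<open>\<eta>\<close> and \<open>2\<eta>\<close> the shift acts on the independent
increments, and the density does not depend on the grid since \<open>W\<close> and \<open>E\<close> are telescoping sums.\<close>

lemma Cameron_Martin_tent:
  assumes BM: "brownian_motion01 M B" and \<eta>: "0 < \<eta>" "2 * \<eta> \<le> 1"
    and E: "E \<in> sets (PiM {0..1} (\<lambda>_. borel))"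
  shows "(\<integral>\<^sup>+\<omega>. indicator E (\<lambda>t\<in>{0..1}. B t \<omega> + \<epsilon> * tent \<eta> t) \<partial>M)
       = (\<integral>\<^sup>+\<omega>. ennreal (exp (\<epsilon> * (2 * B \<eta> \<omega> - B (2 * \<eta>) \<omega>) - \<epsilon>\<^sup>2 * \<eta>)) *
            indicator E (\<lambda>t\<in>{0..1}. B t \<omega>) \<partial>M)"
proof -
  interpret prob_space M using BM by (simp add: brownian_motion01_def)
  let ?P = "PiM {0..1} (\<lambda>_. borel :: real measure)"
  have Bm [measurable]: "B t \<in> borel_measurable M" if "t \<in> {0..1}" for t
    using BM that by (simp add: brownian_motion01_def)
  have B0: "AE \<omega> in M. B 0 \<omega> = 0" using BM by (simp add: brownian_motion01_def)
  define Z where "Z \<omega> = exp (\<epsilon> * (2 * B \<eta> \<omega> - B (2 * \<eta>) \<omega>) - \<epsilon>\<^sup>2 * \<eta>)" for \<omega>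
  have Z [measurable]: "Z \<in> borel_measurable M"
  proof -
    have [measurable]: "B \<eta> \<in> borel_measurable M" "B (2 * \<eta>) \<in> borel_measurable M"
      using \<eta> by (intro Bm; simp)+
    show ?thesis unfolding Z_def by measurable
  qed
  define V where "V \<omega> = (\<lambda>t\<in>{0..1}. B t \<omega> + \<epsilon> * tent \<eta> t)" for \<omega>
  define W where "W \<omega> = (\<lambda>t\<in>{0..1}. B t \<omega>)" for \<omega>
  have V: "V \<in> measurable M ?P" and W: "W \<in> measurable M ?P"
    unfolding V_def W_def by (intro measurable_restrict; measurable)+
  have "distr M ?P V = distr (density M Z) ?P W"
  proof (rule measure_eqI_PiM_infinite)
    fix A :: "real \<Rightarrow> real set" and J
    assume J: "finite J" "J \<subseteq> {0..1}" and A: "\<And>t. t \<in> J \<Longrightarrow> A t \<in> sets borel"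
    let ?C = "prod_emb {0..1} (\<lambda>_. borel :: real measure) J (Pi\<^sub>E J A)"
    have C: "?C \<in> sets ?P" using J A by (intro sets_PiM_I) auto
    define S where "S = insert 0 (insert \<eta> (insert (2 * \<eta>) J))"
    have S: "finite S" "S \<noteq> {}" "S \<subseteq> {0..1}" using J \<eta> by (auto simp: S_def)
    obtain n :: nat and \<tau> :: "nat \<Rightarrow> real" where \<tau>: "strict_mono_on {..n} \<tau>" and \<tau>S: "\<tau> ` {..n} = S"
      by (rule finite_set_as_strict_mono_sequence[OF S(1,2)])
    have \<tau>_le: "\<tau> i \<le> \<tau> j" if "i \<le> j" "j \<le> n" for i j
      using strict_mono_on_leD[OF \<tau>, of i j] that by auto
    have \<tau>_less: "\<tau> i < \<tau> (Suc i)" if "i < n" for i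
      using strict_mono_onD[OF \<tau>, of i "Suc i"] that by auto
    have "\<forall>t\<in>S. \<exists>k\<le>n. \<tau> k = t" using \<tau>S by auto
    then obtain k where k: "\<And>t. t \<in> S \<Longrightarrow> k t \<le> n" "\<And>t. t \<in> S \<Longrightarrow> \<tau> (k t) = t" by metis
    have gapfree: "t \<le> \<tau> i \<or> \<tau> (Suc i) \<le> t" if "t \<in> S" "i < n" for t i
    proof (cases "k t \<le> i")
      case True
      then show ?thesis using \<tau>_le[of "k t" i] k[OF that(1)] that(2) by auto
    next
      case False
      then show ?thesis using \<tau>_le[of "Suc i" "k t"] k[OF that(1)] by auto
    qed
    have grid: "0 \<in> S" "\<eta> \<in> S" "2 * \<eta> \<in> S" by (auto simp: S_def)
    have \<tau>01: "0 \<le> \<tau> i" "\<tau> i \<le> 1" if "i \<le> n" for i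
      using that \<tau>S S(3) by auto
    have \<tau>0: "\<tau> 0 = 0"
      using \<tau>_le[of 0 "k 0"] k[OF grid(1)] \<tau>01(1)[of 0] by simp
    have \<tau>n: "2 * \<eta> \<le> \<tau> n"
      using \<tau>_le[of "k (2 * \<eta>)" n] k[OF grid(3)] by simp
    define X where "X i \<omega> = B (\<tau> (Suc i)) \<omega> - B (\<tau> i) \<omega>" for i \<omega>
    define d where "d i = \<tau> (Suc i) - \<tau> i" for i
    \<comment> \<open>\<open>\<epsilon>\<close> times the slope of the tent on the \<open>i\<close>-th grid cell; no
      cell straddles \<open>\<eta>\<close> or \<open>2\<eta>\<close>.\<close>
    define \<alpha> where "\<alpha> i = (if \<tau> (Suc i) \<le> \<eta> then \<epsilon> else if \<tau> (Suc i) \<le> 2 * \<eta> then - \<epsilon> else 0)" for i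
    have indep: "indep_vars (\<lambda>_. borel) X {..<n}"
      using BM \<tau> \<tau>S S(3) unfolding brownian_motion01_def X_def by auto
    have dist: "distributed M lborel (X i) (normal_density 0 (sqrt (d i)))" if "i < n" for i
      using BM \<tau>_less[OF that] \<tau>01(1)[of i] \<tau>01(2)[of "Suc i"] that
      unfolding brownian_motion01_def X_def d_def by auto
    have d: "0 < d i" if "i < n" for i using \<tau>_less[OF that] by (simp add: d_def)
    have shift: "(\<Sum>i<m. \<alpha> i * d i) = \<epsilon> * tent \<eta> (\<tau> m)" if "m \<le> n" for m
    proof -
      have "(\<Sum>i<m. \<alpha> i * d i) = (\<Sum>i<m. \<epsilon> * tent \<eta> (\<tau> (Suc i)) - \<epsilon> * tent \<eta> (\<tau> i))"
      proof (intro sum.cong refl)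
        fix i assume "i \<in> {..<m}"
        then have i: "i < n" using that by simp
        show "\<alpha> i * d i = \<epsilon> * tent \<eta> (\<tau> (Suc i)) - \<epsilon> * tent \<eta> (\<tau> i)"
          using gapfree[OF grid(2) i] gapfree[OF grid(3) i] \<tau>_less[OF i] \<tau>01(1)[of i] i \<eta>
          by (auto simp: \<alpha>_def d_def tent_def max_def abs_if algebra_simps)
      qed
      also have "\<dots> = \<epsilon> * tent \<eta> (\<tau> m)"
        using \<eta> by (subst sum_lessThan_telescope) (simp add: \<tau>0 tent_def)
      finally show ?thesis .
    qed
    have energy: "(\<Sum>i<n. (\<alpha> i)\<^sup>2 * d i) = 2 * (\<epsilon>\<^sup>2 * \<eta>)"
    proof -
      have "(\<Sum>i<n. (\<alpha> i)\<^sup>2 * d i) = (\<Sum>i<n. \<epsilon>\<^sup>2 * min (\<tau> (Suc i)) (2 * \<eta>) - \<epsilon>\<^sup>2 * min (\<tau> i) (2 * \<eta>))"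
      proof (intro sum.cong refl)
        fix i assume "i \<in> {..<n}"
        then have i: "i < n" by simp
        show "(\<alpha> i)\<^sup>2 * d i = \<epsilon>\<^sup>2 * min (\<tau> (Suc i)) (2 * \<eta>) - \<epsilon>\<^sup>2 * min (\<tau> i) (2 * \<eta>)"
          using gapfree[OF grid(2) i] gapfree[OF grid(3) i] \<tau>_less[OF i] \<eta>
          by (auto simp: \<alpha>_def d_def min_def algebra_simps)
      qed
      also have "\<dots> = 2 * (\<epsilon>\<^sup>2 * \<eta>)"
        using \<eta> \<tau>n by (subst sum_lessThan_telescope) (simp add: \<tau>0)
      finally show ?thesis .
    qed
    have wiener: "(\<Sum>i<n. \<alpha> i * X i \<omega>) = \<epsilon> * (2 * B \<eta> \<omega> - B (2 * \<eta>) \<omega>)" if "B 0 \<omega> = 0" for \<omega>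
    proof -
      \<comment> \<open>The Wiener integral of the slope of the tent up to time \<open>t\<close>.\<close>
      define \<xi> where "\<xi> t = (if t \<le> \<eta> then B t \<omega> else if t \<le> 2 * \<eta> then 2 * B \<eta> \<omega> - B t \<omega>
          else 2 * B \<eta> \<omega> - B (2 * \<eta>) \<omega>)" for t
      have "(\<Sum>i<n. \<alpha> i * X i \<omega>) = (\<Sum>i<n. \<epsilon> * \<xi> (\<tau> (Suc i)) - \<epsilon> * \<xi> (\<tau> i))"
      proof (intro sum.cong refl)
        fix i assume "i \<in> {..<n}"
        then have i: "i < n" by simp
        consider "\<tau> (Suc i) \<le> \<eta>" | "\<eta> = \<tau> i" "\<tau> (Suc i) \<le> 2 * \<eta>" | "\<eta> < \<tau> i" "\<tau> (Suc i) \<le> 2 * \<eta>"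
          | "2 * \<eta> = \<tau> i" | "2 * \<eta> < \<tau> i"
          using gapfree[OF grid(2) i] gapfree[OF grid(3) i] by linarith
        then show "\<alpha> i * X i \<omega> = \<epsilon> * \<xi> (\<tau> (Suc i)) - \<epsilon> * \<xi> (\<tau> i)"
          using \<tau>_less[OF i] \<eta>
          by cases (auto simp: \<alpha>_def X_def \<xi>_def algebra_simps)
      qed
      also have "\<dots> = \<epsilon> * (2 * B \<eta> \<omega> - B (2 * \<eta>) \<omega>)"
        using \<eta> \<tau>n that by (subst sum_lessThan_telescope) (auto simp: \<tau>0 \<xi>_def)
      finally show ?thesis .
    qed
    have increments: "(\<Sum>i<k t. X i \<omega>) = B t \<omega>" if "B 0 \<omega> = 0" "t \<in> J" for t \<omega>
    proof -
      have "t \<in> S" using that by (simp add: S_def)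
      have "(\<Sum>i<k t. X i \<omega>) = B (\<tau> (k t)) \<omega> - B (\<tau> 0) \<omega>"
        unfolding X_def by (rule sum_lessThan_telescope)
      then show ?thesis using k(2)[OF \<open>t \<in> S\<close>] that \<tau>0 by simp
    qed
    define Q where "Q = {x \<in> space (PiM {..<n} (\<lambda>_. borel :: real measure)). \<forall>t\<in>J. (\<Sum>i<k t. x i) \<in> A t}"
    have kn: "k t \<le> n" if "t \<in> J" for t using k(1)[of t] that by (simp add: S_def)
    have Q: "Q \<in> sets (PiM {..<n} (\<lambda>_. borel))"
    proof -
      have "(\<lambda>x. \<Sum>i<k t. x i) \<in> borel_measurable (PiM {..<n} (\<lambda>_. borel :: real measure))" if "t \<in> J" for t
        using kn[OF that] by (intro borel_measurable_sum measurable_component_singleton) auto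
      then show ?thesis
        unfolding Q_def using J(1) A by (intro sets.sets_Collect_finite_All predE pred_sets2) auto
    qed
    have memC: "(\<lambda>t\<in>{0..1}. f t) \<in> ?C \<longleftrightarrow> (\<forall>t\<in>J. f t \<in> A t)" for f
    proof -
      have "restrict (\<lambda>t\<in>{0..1}. f t) J = restrict f J"
        using J(2) by (intro restrict_ext) auto
      then show ?thesis by (simp add: prod_emb_def space_PiM PiE_iff)
    qed
    have memQ: "(\<lambda>i\<in>{..<n}. f i) \<in> Q \<longleftrightarrow> (\<forall>t\<in>J. (\<Sum>i<k t. f i) \<in> A t)" for f
    proof -
      have "(\<Sum>i<k t. (\<lambda>i\<in>{..<n}. f i) i) = (\<Sum>i<k t. f i)" if "t \<in> J" for t
        using kn[OF that] by (intro sum.cong) auto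
      then show ?thesis by (simp add: Q_def space_PiM PiE_iff)
    qed
    have "emeasure (distr M ?P V) ?C = (\<integral>\<^sup>+\<omega>. indicator ?C (V \<omega>) \<partial>M)"
      by (rule emeasure_distr_nn_integral[OF V C])
    also have "\<dots> = (\<integral>\<^sup>+\<omega>. indicator Q (\<lambda>i\<in>{..<n}. X i \<omega> + \<alpha> i * d i) \<partial>M)"
    proof (rule nn_integral_cong_AE, use B0 in eventually_elim)
      case (elim \<omega>)
      have "(\<Sum>i<k t. X i \<omega> + \<alpha> i * d i) = B t \<omega> + \<epsilon> * tent \<eta> t" if "t \<in> J" for t
        using increments[OF elim that] shift[OF kn[OF that]] k(2)[of t] that
        by (simp add: sum.distrib S_def)
      then show ?case unfolding V_def indicator_def memC memQ by simp
    qed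
    also have "\<dots> = (\<integral>\<^sup>+\<omega>. indicator Q (\<lambda>i\<in>{..<n}. X i \<omega>) *
             ennreal (exp ((\<Sum>i<n. \<alpha> i * X i \<omega>) - (\<Sum>i<n. (\<alpha> i)\<^sup>2 * d i) / 2)) \<partial>M)"
      by (rule nn_integral_indep_normal_shift[OF indep dist d Q])
    also have "\<dots> = (\<integral>\<^sup>+\<omega>. ennreal (Z \<omega>) * indicator ?C (W \<omega>) \<partial>M)"
    proof (rule nn_integral_cong_AE, use B0 in eventually_elim)
      case (elim \<omega>)
      have "indicator Q (\<lambda>i\<in>{..<n}. X i \<omega>) = (indicator ?C (W \<omega>) :: ennreal)"
        using increments[OF elim] unfolding W_def indicator_def memC memQ by simp
      then show ?case
        unfolding wiener[OF elim] energy Z_def by (simp add: mult.commute[of "indicator _ _"])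
    qed
    also have "\<dots> = emeasure (distr (density M Z) ?P W) ?C"
      by (rule emeasure_distr_density_nn_integral[OF W Z C, symmetric])
    finally show "emeasure (distr M ?P V) ?C = emeasure (distr (density M Z) ?P W) ?C" .
  qed (auto intro: finite_measure_distr V)
  then have "emeasure (distr M ?P V) E = emeasure (distr (density M Z) ?P W) E" by simp
  then show ?thesis
    using emeasure_distr_nn_integral[OF V E] emeasure_distr_density_nn_integral[OF W Z E]
    by (simp add: V_def W_def Z_def)
qed

text \<open>The translates by \<open>\<epsilon>\<close> times the tent, for \<open>\<epsilon> = 1, 1/2, 1/3, \<dots>\<close>, hit \<open>E\<close> at most \<open>m\<close> times, so their
probabilities of hitting \<open>E\<close> have a sum of at most \<open>m\<close>. By the Cameron-Martin formula this sum is
the integral over \<open>{B \<in> E}\<close> of the sum of the densities, and that sum is infinite everywhere because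
the densities tend to \<open>1\<close> as \<open>\<epsilon>\<close> tends to \<open>0\<close>. Hence \<open>{B \<in> E}\<close> is a null set.\<close>

lemma null_set_if_finitely_many_translates:
  assumes BM: "brownian_motion01 M B" and \<eta>: "0 < \<eta>" "2 * \<eta> \<le> 1"
    and E: "E \<in> sets (PiM {0..1} (\<lambda>_. borel))"
    and few: "\<And>\<omega>. \<omega> \<in> space M \<Longrightarrow> finite {\<epsilon>. (\<lambda>t\<in>{0..1}. B t \<omega> + \<epsilon> * tent \<eta> t) \<in> E} \<and>
               card {\<epsilon>. (\<lambda>t\<in>{0..1}. B t \<omega> + \<epsilon> * tent \<eta> t) \<in> E} \<le> m"
  shows "AE \<omega> in M. (\<lambda>t\<in>{0..1}. B t \<omega>) \<notin> E"
proof -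
  interpret prob_space M using BM by (simp add: brownian_motion01_def)
  let ?P = "PiM {0..1} (\<lambda>_. borel :: real measure)"
  have Bm [measurable]: "B t \<in> borel_measurable M" if "t \<in> {0..1}" for t
    using BM that by (simp add: brownian_motion01_def)
  define \<epsilon> where "\<epsilon> j = 1 / real (Suc j)" for j
  define V where "V j \<omega> = (\<lambda>t\<in>{0..1}. B t \<omega> + \<epsilon> j * tent \<eta> t)" for j \<omega>
  define W where "W \<omega> = (\<lambda>t\<in>{0..1}. B t \<omega>)" for \<omega>
  define Z where "Z j \<omega> = exp (\<epsilon> j * (2 * B \<eta> \<omega> - B (2 * \<eta>) \<omega>) - (\<epsilon> j)\<^sup>2 * \<eta>)" for j \<omega>
  have V: "V j \<in> measurable M ?P" for j
    unfolding V_def by (intro measurable_restrict; measurable)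
  have W: "W \<in> measurable M ?P"
    unfolding W_def by (intro measurable_restrict; measurable)
  have Z [measurable]: "Z j \<in> borel_measurable M" for j
  proof -
    have [measurable]: "B \<eta> \<in> borel_measurable M" "B (2 * \<eta>) \<in> borel_measurable M"
      using \<eta> by (intro Bm; simp)+
    show ?thesis unfolding Z_def by measurable
  qed
  have indV [measurable]: "(\<lambda>\<omega>. indicator E (V j \<omega>) :: ennreal) \<in> borel_measurable M" for j
    using measurable_compose[OF V borel_measurable_indicator[OF E]] .
  have indW [measurable]: "(\<lambda>\<omega>. indicator E (W \<omega>) :: ennreal) \<in> borel_measurable M"
    using measurable_compose[OF W borel_measurable_indicator[OF E]] .
  have "(\<integral>\<^sup>+\<omega>. (\<Sum>j. ennreal (Z j \<omega>) * indicator E (W \<omega>)) \<partial>M) = (\<Sum>j. \<integral>\<^sup>+\<omega>. ennreal (Z j \<omega>) * indicator E (W \<omega>) \<partial>M)"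
    by (rule nn_integral_suminf) measurable
  also have "\<dots> = (\<Sum>j. \<integral>\<^sup>+\<omega>. indicator E (V j \<omega>) \<partial>M)"
    unfolding V_def W_def Z_def using Cameron_Martin_tent[OF BM \<eta> E] by simp
  also have "\<dots> = (\<integral>\<^sup>+\<omega>. (\<Sum>j. indicator E (V j \<omega>)) \<partial>M)"
    by (rule nn_integral_suminf[symmetric]) measurable
  also have "\<dots> \<le> (\<integral>\<^sup>+\<omega>. of_nat m \<partial>M)"
  proof (rule nn_integral_mono)
    fix \<omega> assume \<omega>: "\<omega> \<in> space M"
    have "(\<Sum>j<l. indicator E (V j \<omega>)) \<le> (of_nat m :: ennreal)" for l
    proof -
      have "(\<Sum>j<l. indicator E (V j \<omega>)) = (of_nat (card {j\<in>{..<l}. V j \<omega> \<in> E}) :: ennreal)"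
        by (simp add: indicator_def sum.If_cases Int_def)
      also have "card {j\<in>{..<l}. V j \<omega> \<in> E} = card (\<epsilon> ` {j\<in>{..<l}. V j \<omega> \<in> E})"
        by (rule card_image[symmetric]) (auto simp: inj_on_def \<epsilon>_def)
      also have "\<dots> \<le> card {\<epsilon>. (\<lambda>t\<in>{0..1}. B t \<omega> + \<epsilon> * tent \<eta> t) \<in> E}"
        using few[OF \<omega>] by (intro card_mono) (auto simp: V_def)
      also have "\<dots> \<le> m" using few[OF \<omega>] by simp
      finally show ?thesis by simp
    qed
    then show "(\<Sum>j. indicator E (V j \<omega>)) \<le> (of_nat m :: ennreal)"
      unfolding suminf_eq_SUP by (intro SUP_least)
  qed
  also have "\<dots> < \<infinity>" by (simp add: emeasure_space_1 of_nat_less_top)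
  finally have "AE \<omega> in M. (\<Sum>j. ennreal (Z j \<omega>) * indicator E (W \<omega>)) \<noteq> \<infinity>"
    by (intro nn_integral_PInf_AE) auto
  then show ?thesis
  proof eventually_elim
    case (elim \<omega>)
    show ?case
    proof
      assume "(\<lambda>t\<in>{0..1}. B t \<omega>) \<in> E"
      then have "(\<Sum>j. ennreal (Z j \<omega>)) \<noteq> top" using elim by (simp add: W_def)
      then have "summable (\<lambda>j. Z j \<omega>)"
        by (intro summable_suminf_not_top) (auto simp: Z_def)
      then have "(\<lambda>j. Z j \<omega>) \<longlonglongrightarrow> 0" by (rule summable_LIMSEQ_zero)
      moreover have "(\<lambda>j. Z j \<omega>) \<longlonglongrightarrow> exp (0 * (2 * B \<eta> \<omega> - B (2 * \<eta>) \<omega>) - 0\<^sup>2 * \<eta>)"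
      proof -
        have "\<epsilon> \<longlonglongrightarrow> 0" unfolding \<epsilon>_def using LIMSEQ_inverse_real_of_nat by (simp add: inverse_eq_divide)
        then show ?thesis unfolding Z_def by (intro tendsto_intros)
      qed
      ultimately show False using LIMSEQ_unique by fastforce
    qed
  qed
qed

section \<open>Concavity of the gap along tents\<close>

text \<open>The identity \<open>((1 - l) x + l y)\<^sup>2 = (1 - l) x\<^sup>2 + l y\<^sup>2 - l (1 - l) (x - y)\<^sup>2\<close>, integrated. In this form the
second-order behaviour of a quadratic form along a line is available without its polarisation.\<close>

lemma limit_den_convex_combination:
  assumes u: "continuous_on {0..1} u" and v: "continuous_on {0..1} v" and s: "0 \<le> s" "s \<le> 1"
  shows "limit_den (\<lambda>t. (1 - l) * u t + l * v t) s
       = (1 - l) * limit_den u s + l * limit_den v s - l * (1 - l) * limit_den (\<lambda>t. u t - v t) s"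
proof -
  have cu: "continuous_on {0..s} u" and cv: "continuous_on {0..s} v"
    using u v s by (auto intro: continuous_on_subset)
  have "(\<lambda>t. ((1 - l) * u t + l * v t)\<^sup>2)
      = (\<lambda>t. (1 - l) * (u t)\<^sup>2 + l * (v t)\<^sup>2 - l * (1 - l) * (u t - v t)\<^sup>2)"
    by (simp add: fun_eq_iff power2_eq_square algebra_simps)
  moreover have "integral {0..s} (\<lambda>t. (1 - l) * (u t)\<^sup>2 + l * (v t)\<^sup>2 - l * (1 - l) * (u t - v t)\<^sup>2)
      = integral {0..s} (\<lambda>t. (1 - l) * (u t)\<^sup>2) + integral {0..s} (\<lambda>t. l * (v t)\<^sup>2)
        - integral {0..s} (\<lambda>t. l * (1 - l) * (u t - v t)\<^sup>2)"
    by (subst integral_diff; (subst integral_add)?)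
       (intro integrable_continuous_interval continuous_intros cu cv refl)+
  ultimately show ?thesis by (simp add: limit_den_def)
qed

lemma limit_num_convex_combination:
  assumes u: "continuous_on {0..1} u" and v: "continuous_on {0..1} v" and K: "continuous_on UNIV K"
    and s: "0 \<le> s" "s \<le> 1"
  shows "limit_num K \<zeta> (\<lambda>t. (1 - l) * u t + l * v t) s
       = (1 - l) * limit_num K \<zeta> u s + l * limit_num K \<zeta> v s - l * (1 - l) * limit_num K \<zeta> (\<lambda>t. u t - v t) s"
proof -
  define I where "I b r = integral {0..r} b" for b :: "real \<Rightarrow> real" and r
  define k where "k r = K (\<zeta> * (r - s))" for r
  have int: "u integrable_on {0..r}" "v integrable_on {0..r}" if "r \<le> s" for r
    using u v s that by (auto intro!: integrable_continuous_interval intro: continuous_on_subset)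
  have lin: "I (\<lambda>t. (1 - l) * u t + l * v t) r = (1 - l) * I u r + l * I v r"
    "I (\<lambda>t. u t - v t) r = I u r - I v r" if "r \<le> s" for r
    unfolding I_def using int[OF that]
    by (simp_all add: integral_add integral_diff integrable_on_mult_right)
  have cI: "continuous_on {0..s} (I b)" if "continuous_on {0..1} b" for b
  proof -
    have "continuous_on {0..1} (\<lambda>r. integral {0..r} b)"
      using that by (intro indefinite_integral_continuous_1 integrable_continuous_interval)
    then show ?thesis unfolding I_def by (rule continuous_on_subset) (use s in auto)
  qed
  have ck: "continuous_on {0..s} k"
    unfolding k_def by (intro continuous_on_compose2[OF K] continuous_intros) auto
  have "integral {0..s} (\<lambda>r. k r * (I (\<lambda>t. (1 - l) * u t + l * v t) r)\<^sup>2)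
      = integral {0..s} (\<lambda>r. (1 - l) * (k r * (I u r)\<^sup>2) + l * (k r * (I v r)\<^sup>2) - l * (1 - l) * (k r * (I u r - I v r)\<^sup>2))"
  proof (intro integral_cong)
    fix r assume "r \<in> {0..s}"
    then have "I (\<lambda>t. (1 - l) * u t + l * v t) r = (1 - l) * I u r + l * I v r" by (simp only: lin atLeastAtMost_iff)
    then show "k r * (I (\<lambda>t. (1 - l) * u t + l * v t) r)\<^sup>2
      = (1 - l) * (k r * (I u r)\<^sup>2) + l * (k r * (I v r)\<^sup>2) - l * (1 - l) * (k r * (I u r - I v r)\<^sup>2)"
      by (simp only: power2_eq_square) (simp add: algebra_simps)
  qed
  also have "\<dots> = integral {0..s} (\<lambda>r. (1 - l) * (k r * (I u r)\<^sup>2)) + integral {0..s} (\<lambda>r. l * (k r * (I v r)\<^sup>2))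
        - integral {0..s} (\<lambda>r. l * (1 - l) * (k r * (I u r - I v r)\<^sup>2))"
    by (subst integral_diff; (subst integral_add)?)
       (intro integrable_continuous_interval continuous_intros cI ck u v refl)+
  also have "integral {0..s} (\<lambda>r. l * (1 - l) * (k r * (I u r - I v r)\<^sup>2))
      = integral {0..s} (\<lambda>r. l * (1 - l) * (k r * (I (\<lambda>t. u t - v t) r)\<^sup>2))"
    by (intro integral_cong) (simp add: lin)
  finally have "integral {0..s} (\<lambda>r. k r * (I (\<lambda>t. (1 - l) * u t + l * v t) r)\<^sup>2)
      = (1 - l) * integral {0..s} (\<lambda>r. k r * (I u r)\<^sup>2) + l * integral {0..s} (\<lambda>r. k r * (I v r)\<^sup>2)
        - l * (1 - l) * integral {0..s} (\<lambda>r. k r * (I (\<lambda>t. u t - v t) r)\<^sup>2)"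
    by simp
  from arg_cong[OF this, of "\<lambda>x. \<zeta> * x"] show ?thesis
    unfolding limit_num_def I_def k_def by (simp add: algebra_simps)
qed

lemma gap_convex_combination:
  assumes u: "continuous_on {0..1} u" and v: "continuous_on {0..1} v" and K: "continuous_on UNIV K"
    and s: "0 \<le> s" "s \<le> 1"
  shows "gap K \<zeta> c (\<lambda>t. (1 - l) * u t + l * v t) s
       = (1 - l) * gap K \<zeta> c u s + l * gap K \<zeta> c v s - l * (1 - l) * gap K \<zeta> c (\<lambda>t. u t - v t) s"
  unfolding gap_def limit_num_convex_combination[OF assms] limit_den_convex_combination[OF u v s]
  by (simp add: algebra_simps)

lemma limit_den_scale: "limit_den (\<lambda>t. a * b t) s = a\<^sup>2 * limit_den b s"
  unfolding limit_den_def by (simp add: power_mult_distrib)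

lemma limit_num_scale: "limit_num K \<zeta> (\<lambda>t. a * b t) s = a\<^sup>2 * limit_num K \<zeta> b s"
  unfolding limit_num_def by (simp add: power_mult_distrib mult.left_commute[of _ "a\<^sup>2"])

lemma gap_scale: "gap K \<zeta> c (\<lambda>t. a * b t) s = a\<^sup>2 * gap K \<zeta> c b s"
  unfolding gap_def limit_num_scale limit_den_scale by (simp add: algebra_simps)

lemma U_limit_scale: "a \<noteq> 0 \<Longrightarrow> U_limit K \<zeta> (\<lambda>t. a * b t) s = U_limit K \<zeta> b s"
  unfolding U_limit_eq limit_num_scale limit_den_scale by simp

lemma limit_time_scale: "a \<noteq> 0 \<Longrightarrow> limit_time K \<zeta> c \<kappa> (\<lambda>t. a * b t) = limit_time K \<zeta> c \<kappa> b"
  unfolding limit_time_def by (simp add: U_limit_scale)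

lemma regular_path_scale: "a \<noteq> 0 \<Longrightarrow> regular_path K \<zeta> c \<kappa> (\<lambda>t. a * b t) \<longleftrightarrow> regular_path K \<zeta> c \<kappa> b"
  unfolding regular_path_def touches_zero_def gap_scale limit_den_scale
  by (simp add: zero_less_mult_iff zero_le_mult_iff)

lemma continuous_on_tent: "continuous_on S (tent \<eta>)"
  unfolding tent_def[abs_def] by (intro continuous_intros)

text \<open>A tent of height \<open>\<eta>\<close> has area of order \<open>\<eta>\<^sup>2\<close>, which makes the numerator of order \<open>\<eta>\<^sup>4\<close>, whereas its
square has an integral of order \<open>\<eta>\<^sup>3\<close>. For small \<open>\<eta>\<close> the subtracted term therefore dominates,
uniformly in \<open>s\<close>.\<close>

lemma exists_tent_with_negative_gap:
  assumes K: "continuous_on UNIV K" and c: "0 < c" and \<kappa>: "0 < \<kappa>" "\<kappa> < 1" and \<zeta>: "0 \<le> \<zeta>"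
  obtains \<eta> where "0 < \<eta>" "2 * \<eta> \<le> 1" "\<And>s. \<kappa> \<le> s \<Longrightarrow> s \<le> 1 \<Longrightarrow> gap K \<zeta> c (tent \<eta>) s < 0"
proof -
  have "bounded (K ` {-\<zeta>..\<zeta>})"
    using K by (intro compact_imp_bounded compact_continuous_image) (auto intro: continuous_on_subset)
  then obtain CK where "\<forall>x\<in>{-\<zeta>..\<zeta>}. \<bar>K x\<bar> \<le> CK" by (auto simp: bounded_iff)
  then have CK: "\<bar>K x\<bar> \<le> CK" if "\<bar>x\<bar> \<le> \<zeta>" for x using that by (simp add: abs_le_iff)
  have CK0: "0 \<le> CK" using CK[of 0] \<zeta> by simp
  \<comment> \<open>With kernel bound \<open>CK\<close> the numerator is at most \<open>4 * \<zeta> * CK * \<eta> ^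
    4\<close> and the subtracted term is at least \<open>c * \<kappa> * \<eta> ^ 3 / 4\<close>; hence the constant
    \<open>16\<close>. Adding \<open>1\<close> keeps \<open>q\<close> positive.\<close>
  define q where "q = 16 * (\<zeta> * CK) + 1"
  have q: "0 < q" "16 * (\<zeta> * CK) < q" unfolding q_def using CK0 \<zeta> by (auto intro: add_nonneg_pos)
  define \<eta> where "\<eta> = min (\<kappa> / 2) (c * \<kappa> / q)"
  have \<eta>: "0 < \<eta>" "2 * \<eta> \<le> \<kappa>" "\<eta> * q \<le> c * \<kappa>"
    using q c \<kappa> by (auto simp: \<eta>_def min_def field_simps)
  have int: "tent \<eta> integrable_on {a..b}" for a b
    by (intro integrable_continuous_interval continuous_on_tent)
  have area: "\<bar>integral {0..r} (tent \<eta>)\<bar> \<le> 2 * \<eta>\<^sup>2" if r: "0 \<le> r" for r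
  proof -
    define m where "m = min r (2 * \<eta>)"
    have m: "0 \<le> m" "m \<le> r" "m \<le> 2 * \<eta>" using r \<eta> by (auto simp: m_def)
    have "integral {m..r} (tent \<eta>) = 0"
    proof (cases "r \<le> 2 * \<eta>")
      case True
      then show ?thesis by (simp add: m_def)
    next
      case False
      then have "integral {m..r} (tent \<eta>) = integral {m..r} (\<lambda>_. 0)"
        using \<eta> by (intro integral_cong) (auto simp: m_def tent_def)
      then show ?thesis by simp
    qed
    then have "integral {0..r} (tent \<eta>) = integral {0..m} (tent \<eta>)"
      using Henstock_Kurzweil_Integration.integral_combine[OF m(1,2) int] by simp
    moreover have "norm (integral {0..m} (tent \<eta>)) \<le> \<eta> * (m - 0)"
      using m(1) \<eta> by (intro integral_bound continuous_on_tent) (auto simp: tent_def)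
    moreover have "\<eta> * (m - 0) \<le> \<eta> * (2 * \<eta>)" using m \<eta> by (intro mult_left_mono) auto
    ultimately show ?thesis by (simp add: power2_eq_square)
  qed
  show ?thesis
  proof (rule that[of \<eta>])
    show "0 < \<eta>" "2 * \<eta> \<le> 1" using \<eta> \<kappa> by auto
    fix s assume s: "\<kappa> \<le> s" "s \<le> 1"
    have "norm (integral {0..s} (\<lambda>r. K (\<zeta> * (r - s)) * (integral {0..r} (tent \<eta>))\<^sup>2)) \<le> (CK * (2 * \<eta>\<^sup>2)\<^sup>2) * (s - 0)"
    proof (rule integral_bound)
      have "continuous_on {0..s} (\<lambda>r. integral {0..r} (tent \<eta>))"
        by (intro indefinite_integral_continuous_1 int)
      then show "continuous_on {0..s} (\<lambda>r. K (\<zeta> * (r - s)) * (integral {0..r} (tent \<eta>))\<^sup>2)"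
        by (intro continuous_intros continuous_on_compose2[OF K]) auto
      fix r assume r: "r \<in> {0..s}"
      have "\<bar>\<zeta> * (r - s)\<bar> \<le> \<zeta> * 1"
        unfolding abs_mult using \<zeta> r s by (intro mult_mono) auto
      then have "\<bar>K (\<zeta> * (r - s))\<bar> \<le> CK" by (intro CK) simp
      moreover have "(integral {0..r} (tent \<eta>))\<^sup>2 \<le> (2 * \<eta>\<^sup>2)\<^sup>2"
        using area[of r] r by (subst power2_le_iff_abs_le) auto
      ultimately show "norm (K (\<zeta> * (r - s)) * (integral {0..r} (tent \<eta>))\<^sup>2) \<le> CK * (2 * \<eta>\<^sup>2)\<^sup>2"
        unfolding real_norm_def abs_mult using CK0 by (intro mult_mono) auto
    qed (use s \<kappa> in simp)
    also have "\<dots> \<le> CK * (2 * \<eta>\<^sup>2)\<^sup>2 * 1" using s CK0 by (intro mult_left_mono) auto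
    finally have "integral {0..s} (\<lambda>r. K (\<zeta> * (r - s)) * (integral {0..r} (tent \<eta>))\<^sup>2) \<le> CK * (2 * \<eta>\<^sup>2)\<^sup>2"
      by simp
    then have num: "limit_num K \<zeta> (tent \<eta>) s \<le> \<zeta> * (CK * (2 * \<eta>\<^sup>2)\<^sup>2)"
      unfolding limit_num_def using \<zeta> by (intro mult_left_mono)
    \<comment> \<open>On the middle half of its support the tent is at least \<open>\<eta> / 2\<close>.\<close>
    have "integral {\<eta> / 2..3 * \<eta> / 2} (\<lambda>_. (\<eta> / 2)\<^sup>2) \<le> integral {\<eta> / 2..3 * \<eta> / 2} (\<lambda>r. (tent \<eta> r)\<^sup>2)"
      using \<eta> by (intro integral_le integrable_continuous_interval continuous_intros continuous_on_tent power_mono)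
        (auto simp: tent_def max_def abs_if field_simps)
    also have "\<dots> \<le> limit_den (tent \<eta>) s"
      unfolding limit_den_def using \<eta> s \<kappa>
      by (intro integral_subset_le integrable_continuous_interval continuous_intros continuous_on_tent) auto
    finally have "\<eta> ^ 3 / 4 \<le> limit_den (tent \<eta>) s"
      using \<eta> by (simp add: power2_eq_square power3_eq_cube field_simps)
    then have den: "c * (\<kappa> * (\<eta> ^ 3 / 4)) \<le> c * (s * limit_den (tent \<eta>) s)"
      using c \<kappa> s \<eta> by (intro mult_left_mono mult_mono) auto
    have "\<zeta> * (CK * (2 * \<eta>\<^sup>2)\<^sup>2) = 16 * (\<zeta> * CK) * \<eta> * (\<eta> ^ 3 / 4)"
      by (simp add: power2_eq_square power3_eq_cube)
    also have "\<dots> < q * \<eta> * (\<eta> ^ 3 / 4)" using q \<eta> by (intro mult_strict_right_mono) auto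
    also have "\<dots> \<le> c * \<kappa> * (\<eta> ^ 3 / 4)" using \<eta> by (intro mult_right_mono) (auto simp: mult.commute)
    finally show "gap K \<zeta> c (tent \<eta>) s < 0" using num den by (simp add: gap_def)
  qed
qed

text \<open>For fixed \<open>s\<close> the gap of \<open>b + \<epsilon> * \<phi>\<close> is a quadratic polynomial in \<open>\<epsilon>\<close> with the negative leading
coefficient \<open>gap \<phi> s\<close>, hence strictly concave. Between two values of \<open>\<epsilon>\<close> for which it is nonnegative
it is positive. So a third, intermediate value cannot touch zero at any \<open>s\<close>.\<close>

lemma few_translates_touch_zero:
  assumes b: "continuous_on {0..1} b" and \<phi>: "continuous_on {0..1} \<phi>" and K: "continuous_on UNIV K"
    and S: "S \<subseteq> {0..1}" and neg: "\<And>s. s \<in> S \<Longrightarrow> gap K \<zeta> c \<phi> s < 0"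
  shows "finite {\<epsilon>. touches_zero (gap K \<zeta> c (\<lambda>t. b t + \<epsilon> * \<phi> t)) S} \<and>
         card {\<epsilon>. touches_zero (gap K \<zeta> c (\<lambda>t. b t + \<epsilon> * \<phi> t)) S} \<le> 2"
proof -
  define T where "T = {\<epsilon>. touches_zero (gap K \<zeta> c (\<lambda>t. b t + \<epsilon> * \<phi> t)) S}"
  have no3: False if "x \<in> T" "y \<in> T" "z \<in> T" "x < y" "y < z" for x y z
  proof -
    obtain s where s: "s \<in> S" "gap K \<zeta> c (\<lambda>t. b t + y * \<phi> t) s = 0"
      using \<open>y \<in> T\<close> by (auto simp: T_def touches_zero_def)
    have nn: "0 \<le> gap K \<zeta> c (\<lambda>t. b t + x * \<phi> t) s" "0 \<le> gap K \<zeta> c (\<lambda>t. b t + z * \<phi> t) s"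
      using that s(1) by (auto simp: T_def touches_zero_def)
    define l where "l = (y - x) / (z - x)"
    have l: "0 < l" "l < 1" using that by (auto simp: l_def)
    have "l * (z - x) = y - x" using that by (simp add: l_def)
    then have y: "y = (1 - l) * x + l * z" by (simp add: algebra_simps)
    have comb: "(\<lambda>t. b t + y * \<phi> t) = (\<lambda>t. (1 - l) * (b t + x * \<phi> t) + l * (b t + z * \<phi> t))"
      by (simp add: fun_eq_iff y algebra_simps)
    have diff: "(\<lambda>t. (b t + x * \<phi> t) - (b t + z * \<phi> t)) = (\<lambda>t. (x - z) * \<phi> t)"
      by (simp add: fun_eq_iff algebra_simps)
    have diff': "(x - z)\<^sup>2 * gap K \<zeta> c \<phi> s = gap K \<zeta> c (\<lambda>t. (b t + x * \<phi> t) - (b t + z * \<phi> t)) s"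
      unfolding diff by (rule gap_scale[symmetric])
    have "gap K \<zeta> c (\<lambda>t. b t + y * \<phi> t) s
        = (1 - l) * gap K \<zeta> c (\<lambda>t. b t + x * \<phi> t) s + l * gap K \<zeta> c (\<lambda>t. b t + z * \<phi> t) s
          - l * (1 - l) * ((x - z)\<^sup>2 * gap K \<zeta> c \<phi> s)"
      unfolding comb diff'
      by (rule gap_convex_combination) (use s S in \<open>auto intro!: continuous_intros b \<phi> K\<close>)
    moreover have "0 \<le> (1 - l) * gap K \<zeta> c (\<lambda>t. b t + x * \<phi> t) s" "0 \<le> l * gap K \<zeta> c (\<lambda>t. b t + z * \<phi> t) s"
      using l nn by (auto intro!: mult_nonneg_nonneg)
    moreover have "l * (1 - l) * ((x - z)\<^sup>2 * gap K \<zeta> c \<phi> s) < 0"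
      using l neg[OF s(1)] that by (intro mult_pos_neg) auto
    ultimately show False using s(2) by simp
  qed
  have small: "finite F \<Longrightarrow> F \<subseteq> T \<Longrightarrow> card F \<le> 2" for F
  proof (rule ccontr)
    assume F: "finite F" "F \<subseteq> T" and "\<not> card F \<le> 2"
    have "\<not> F \<subseteq> {Min F, Max F}"
    proof
      assume "F \<subseteq> {Min F, Max F}"
      then have "card F \<le> card {Min F, Max F}" by (intro card_mono) auto
      also have "\<dots> \<le> 2" by (simp add: card_insert_if)
      finally show False using \<open>\<not> card F \<le> 2\<close> by simp
    qed
    then obtain y where y: "y \<in> F" "y \<noteq> Min F" "y \<noteq> Max F" by auto
    then have "F \<noteq> {}" by auto
    have "Min F \<le> y" "y \<le> Max F" using F y by auto
    then have "Min F < y" "y < Max F" using y by auto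
    then show False using no3[of "Min F" y "Max F"] F y Min_in[OF F(1) \<open>F \<noteq> {}\<close>] Max_in[OF F(1) \<open>F \<noteq> {}\<close>] by auto
  qed
  have "finite T"
    using infinite_arbitrarily_large[of T 3] small by fastforce
  then show ?thesis using small[of T] unfolding T_def by simp
qed

section \<open>Measurability and almost sure regularity\<close>

lemma sample_num_measurable:
  assumes "\<And>t. t \<in> {0..1} \<Longrightarrow> (\<lambda>\<omega>. f \<omega> t) \<in> borel_measurable M" "n \<le> N"
  shows "(\<lambda>\<omega>. sample_num K H N (f \<omega>) n) \<in> borel_measurable M"
proof -
  have "(\<lambda>\<omega>. f \<omega> (real l / real N)) \<in> borel_measurable M" if "l \<le> N" for l
    using that by (intro assms) (auto simp: divide_le_eq_1)
  moreover define P where "P i \<omega> = (\<Sum>l=1..i. f \<omega> (real l / real N))" for i \<omega>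
  ultimately have "P i \<in> borel_measurable M" if "i \<le> N" for i
    unfolding P_def[abs_def] using that by (intro borel_measurable_sum) auto
  then show ?thesis
    unfolding sample_num_def P_def[symmetric] using assms(2)
    by (intro borel_measurable_divide borel_measurable_sum borel_measurable_times borel_measurable_power borel_measurable_const) auto
qed

lemma sample_den_measurable:
  assumes "\<And>t. t \<in> {0..1} \<Longrightarrow> (\<lambda>\<omega>. f \<omega> t) \<in> borel_measurable M" "n \<le> N"
  shows "(\<lambda>\<omega>. sample_den N (f \<omega>) n) \<in> borel_measurable M"
  unfolding sample_den_def using assms(2)
  by (intro borel_measurable_divide borel_measurable_sum borel_measurable_power borel_measurable_const assms(1))
     (auto simp: divide_le_eq_1)

text \<open>The index of time \<open>s\<close> in the grid of mesh \<open>1 / N\<close> with \<open>N = Suc j\<close>. These grids exhibit the limit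
functionals of a continuous path as limits of functions of finitely many of its values.\<close>

definition grid_index :: "real \<Rightarrow> nat \<Rightarrow> nat" where
  "grid_index s j = nat \<lfloor>s * real (Suc j)\<rfloor>"

lemma grid_index_le: "s \<le> 1 \<Longrightarrow> grid_index s j \<le> Suc j"
proof -
  assume "s \<le> 1"
  then have "s * real (Suc j) \<le> 1 * real (Suc j)" by (intro mult_right_mono) auto
  from floor_mono[OF this] show ?thesis
    unfolding grid_index_def by (simp add: nat_le_iff del: of_nat_Suc)
qed

lemma grid_functionals_tendsto:
  assumes b: "continuous_on {0..1} b" and K: "continuous_on UNIV K" and \<zeta>: "0 < \<zeta>" and s: "0 \<le> s" "s \<le> 1"
  shows "(\<lambda>j. sample_num K (real (Suc j) / \<zeta>) (Suc j) b (grid_index s j)) \<longlonglongrightarrow> limit_num K \<zeta> b s"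
    and "(\<lambda>j. sample_den (Suc j) b (grid_index s j)) \<longlonglongrightarrow> limit_den b s"
proof -
  have N: "filterlim Suc at_top sequentially" by (rule filterlim_Suc)
  have ns: "(\<lambda>j. real (grid_index s j) / real (Suc j)) \<longlonglongrightarrow> s"
    unfolding grid_index_def by (rule floor_ratio_tendsto[OF N _ s(1)]) simp
  have NH: "(\<lambda>j. real (Suc j) / (real (Suc j) / \<zeta>)) \<longlonglongrightarrow> \<zeta>" using \<zeta> by simp
  note lims = sample_functionals_tendsto[where N = Suc and a = "\<lambda>_. b" and e = "\<lambda>_. 0", OF N _ _ NH _ ns _ _ b K]
  show "(\<lambda>j. sample_num K (real (Suc j) / \<zeta>) (Suc j) b (grid_index s j)) \<longlonglongrightarrow> limit_num K \<zeta> b s"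
    by (rule lims(1)) (use \<zeta> s in \<open>auto intro: grid_index_le\<close>)
  show "(\<lambda>j. sample_den (Suc j) b (grid_index s j)) \<longlonglongrightarrow> limit_den b s"
    by (rule lims(2)) (use \<zeta> s in \<open>auto intro: grid_index_le\<close>)
qed

context
  fixes M :: "'a measure" and B :: "real \<Rightarrow> 'a \<Rightarrow> real" and K :: "real \<Rightarrow> real" and \<zeta> :: real
  assumes B_meas: "\<And>t. t \<in> {0..1} \<Longrightarrow> B t \<in> borel_measurable M"
    and B_cont: "\<And>\<omega>. \<omega> \<in> space M \<Longrightarrow> continuous_on {0..1} (\<lambda>t. B t \<omega>)"
    and K_cont: "continuous_on UNIV K" and \<zeta>_pos: "0 < \<zeta>"
begin

lemma limit_num_measurable:
  assumes "0 \<le> s" "s \<le> 1"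
  shows "(\<lambda>\<omega>. limit_num K \<zeta> (\<lambda>t. B t \<omega>) s) \<in> borel_measurable M"
proof (rule borel_measurable_LIMSEQ_real)
  show "(\<lambda>\<omega>. sample_num K (real (Suc j) / \<zeta>) (Suc j) (\<lambda>t. B t \<omega>) (grid_index s j)) \<in> borel_measurable M" for j
    using assms by (intro sample_num_measurable B_meas grid_index_le)
  show "(\<lambda>j. sample_num K (real (Suc j) / \<zeta>) (Suc j) (\<lambda>t. B t \<omega>) (grid_index s j))
      \<longlonglongrightarrow> limit_num K \<zeta> (\<lambda>t. B t \<omega>) s" if "\<omega> \<in> space M" for \<omega>
    by (intro grid_functionals_tendsto B_cont that K_cont \<zeta>_pos assms)
qed

lemma limit_den_measurable:
  assumes "0 \<le> s" "s \<le> 1"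
  shows "(\<lambda>\<omega>. limit_den (\<lambda>t. B t \<omega>) s) \<in> borel_measurable M"
proof (rule borel_measurable_LIMSEQ_real)
  show "(\<lambda>\<omega>. sample_den (Suc j) (\<lambda>t. B t \<omega>) (grid_index s j)) \<in> borel_measurable M" for j
    using assms by (intro sample_den_measurable B_meas grid_index_le)
  show "(\<lambda>j. sample_den (Suc j) (\<lambda>t. B t \<omega>) (grid_index s j)) \<longlonglongrightarrow> limit_den (\<lambda>t. B t \<omega>) s"
    if "\<omega> \<in> space M" for \<omega>
    by (intro grid_functionals_tendsto(2)[where K = K and \<zeta> = \<zeta>] B_cont that K_cont \<zeta>_pos assms)
qed

lemma U_limit_measurable:
  assumes "0 \<le> s" "s \<le> 1"
  shows "(\<lambda>\<omega>. U_limit K \<zeta> (\<lambda>t. B t \<omega>) s) \<in> borel_measurable M"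
  unfolding U_limit_eq
  by (intro borel_measurable_divide borel_measurable_times borel_measurable_const
      limit_num_measurable limit_den_measurable assms)

end

text \<open>Where \<open>limit_den b \<kappa>\<close> is positive the crossing condition is open in time, so a rational time is
available. Where it is zero the ratio at \<open>\<kappa>\<close> has a zero denominator and the value \<open>0\<close>, which is below
\<open>c\<close>; hence the exceptional time \<open>\<kappa>\<close>.\<close>

lemma rational_crossing:
  assumes b: "continuous_on {0..1} b" and K: "continuous_on UNIV K" "\<And>x. 0 \<le> K x" and \<zeta>: "0 \<le> \<zeta>"
    and \<kappa>: "0 < \<kappa>" and s: "\<kappa> \<le> s" "s < y" "U_limit K \<zeta> b s < c" and y: "y \<le> 1"
  obtains q where "\<kappa> \<le> q" "q < y" "q = \<kappa> \<or> q \<in> \<rat>" "U_limit K \<zeta> b q < c"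
proof -
  have "0 \<le> U_limit K \<zeta> b s"
    unfolding U_limit_eq using s \<kappa> y
    by (intro divide_nonneg_nonneg mult_nonneg_nonneg limit_num_nonneg limit_den_nonneg b K \<zeta>) auto
  then have c: "0 < c" using s by simp
  consider "limit_den b \<kappa> = 0" | "s = \<kappa>" | "0 < limit_den b \<kappa>" "\<kappa> < s"
    using limit_den_nonneg[OF b, of \<kappa>] \<kappa> s y by fastforce
  then show ?thesis
  proof cases
    case 1
    then show ?thesis using c s by (intro that[of \<kappa>]) (auto simp: U_limit_eq)
  next
    case 2
    then show ?thesis using s by (intro that[of \<kappa>]) auto
  next
    case 3
    have den: "0 < limit_den b t" if "\<kappa> \<le> t" "t \<le> 1" for t
      using limit_den_mono[OF b, of \<kappa> t] 3 \<kappa> that by simp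
    have "gap K \<zeta> c b s < 0"
      using s den[of s] \<kappa> y U_limit_less_iff[of s b K \<zeta> c] by simp
    moreover have "isCont (gap K \<zeta> c b) s"
      by (rule continuous_on_interior[OF continuous_on_gap[OF b K(1)]]) (use s \<kappa> y 3 in auto)
    ultimately have "\<forall>\<^sub>F t in at s. gap K \<zeta> c b t < 0"
      by (intro order_tendstoD(2)[where y = "gap K \<zeta> c b s"]) (auto simp: isCont_def)
    then obtain d where d: "0 < d" "\<And>t. t \<noteq> s \<Longrightarrow> dist t s < d \<Longrightarrow> gap K \<zeta> c b t < 0"
      by (auto simp: eventually_at)
    obtain q where q: "q \<in> \<rat>" "s < q" "q < min y (s + d)"
      using Rats_dense_in_real[of s "min y (s + d)"] s d by auto
    then have "gap K \<zeta> c b q < 0" by (intro d(2)) (auto simp: dist_real_def)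
    then show ?thesis
      using q s y \<kappa> den[of q] U_limit_less_iff[of q b K \<zeta> c] by (intro that[of q]) auto
  qed
qed

lemma limit_time_measurable:
  assumes B_meas: "\<And>t. t \<in> {0..1} \<Longrightarrow> B t \<in> borel_measurable M"
    and B_cont: "\<And>\<omega>. \<omega> \<in> space M \<Longrightarrow> continuous_on {0..1} (\<lambda>t. B t \<omega>)"
    and K: "continuous_on UNIV K" "\<And>x. 0 \<le> K x" and \<zeta>: "0 < \<zeta>" and \<kappa>: "0 < \<kappa>"
  shows "(\<lambda>\<omega>. limit_time K \<zeta> c \<kappa> (\<lambda>t. B t \<omega>)) \<in> borel_measurable M"
  unfolding borel_measurable_iff_less
proof
  fix y :: real
  show "{\<omega> \<in> space M. limit_time K \<zeta> c \<kappa> (\<lambda>t. B t \<omega>) < y} \<in> sets M"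
  proof (cases "y \<le> 1")
    case False
    then have "limit_time K \<zeta> c \<kappa> b < y" for b using limit_time_le_1[of K \<zeta> c \<kappa> b] by simp
    then show ?thesis by simp
  next
    case True
    define D where "D = {q. \<kappa> \<le> q \<and> q < y \<and> (q = \<kappa> \<or> q \<in> \<rat>)}"
    have D: "countable D"
      by (rule countable_subset[of _ "insert \<kappa> \<rat>"]) (auto simp: D_def countable_rat)
    have "limit_time K \<zeta> c \<kappa> (\<lambda>t. B t \<omega>) < y \<longleftrightarrow> (\<exists>q\<in>D. U_limit K \<zeta> (\<lambda>t. B t \<omega>) q < c)"
      if \<omega>: "\<omega> \<in> space M" for \<omega>
    proof
      assume "limit_time K \<zeta> c \<kappa> (\<lambda>t. B t \<omega>) < y"
      then obtain s where s: "\<kappa> \<le> s" "s < y" "U_limit K \<zeta> (\<lambda>t. B t \<omega>) s < c"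
        using limit_time_lessE True by metis
      show "\<exists>q\<in>D. U_limit K \<zeta> (\<lambda>t. B t \<omega>) q < c"
        by (rule rational_crossing[OF B_cont[OF \<omega>] K _ \<kappa> s True]) (use \<zeta> in \<open>auto simp: D_def\<close>)
    next
      assume "\<exists>q\<in>D. U_limit K \<zeta> (\<lambda>t. B t \<omega>) q < c"
      then obtain q where "\<kappa> \<le> q" "q < y" "U_limit K \<zeta> (\<lambda>t. B t \<omega>) q < c" by (auto simp: D_def)
      then show "limit_time K \<zeta> c \<kappa> (\<lambda>t. B t \<omega>) < y"
        using limit_time_le[of \<kappa> q K \<zeta> "\<lambda>t. B t \<omega>" c] True by simp
    qed
    then have eq: "{\<omega> \<in> space M. limit_time K \<zeta> c \<kappa> (\<lambda>t. B t \<omega>) < y}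
        = {\<omega> \<in> space M. \<exists>q\<in>D. U_limit K \<zeta> (\<lambda>t. B t \<omega>) q < c}" by auto
    show ?thesis
      unfolding eq
    proof (rule predE, rule measurable_pred_countable(2)[OF D])
      fix q assume "q \<in> D"
      then have "(\<lambda>\<omega>. U_limit K \<zeta> (\<lambda>t. B t \<omega>) q) \<in> borel_measurable M"
        using \<kappa> True by (intro U_limit_measurable B_meas B_cont K \<zeta>) (auto simp: D_def)
      then have "{\<omega> \<in> space M. U_limit K \<zeta> (\<lambda>t. B t \<omega>) q < c} \<in> sets M"
        by (rule borel_measurable_less) simp
      then show "Measurable.pred M (\<lambda>\<omega>. U_limit K \<zeta> (\<lambda>t. B t \<omega>) q < c)" by (simp add: pred_def)
    qed
  qed
qed

text \<open>Continuity and compactness reduce touching to countably many conditions, which makes it a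
measurable event.\<close>

lemma touches_zero_closure_iff:
  fixes f :: "real \<Rightarrow> real"
  assumes f: "continuous_on (closure D) f" and D: "compact (closure D)" "D \<noteq> {}"
  shows "touches_zero f (closure D) \<longleftrightarrow> (\<forall>q\<in>D. 0 \<le> f q) \<and> (\<forall>m::nat. \<exists>q\<in>D. f q < 1 / real (Suc m))"
proof safe
  assume t: "touches_zero f (closure D)"
  then show "0 \<le> f q" if "q \<in> D" for q
    using that closure_subset[of D] by (auto simp: touches_zero_def)
  fix m :: nat
  obtain s where s: "s \<in> closure D" "f s = 0" using t by (auto simp: touches_zero_def)
  show "\<exists>q\<in>D. f q < 1 / real (Suc m)"
  proof (rule ccontr)
    assume "\<not> ?thesis"
    then have "1 / real (Suc m) \<le> f s"
      by (intro continuous_ge_on_closure[OF f s(1)]) (auto simp: not_less)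
    then show False using s by simp
  qed
next
  assume nn: "\<forall>q\<in>D. 0 \<le> f q" and small: "\<forall>m::nat. \<exists>q\<in>D. f q < 1 / real (Suc m)"
  have nonneg: "0 \<le> f s" if "s \<in> closure D" for s
    using nn by (intro continuous_ge_on_closure[OF f that]) auto
  obtain s where s: "s \<in> closure D" "\<And>t. t \<in> closure D \<Longrightarrow> f s \<le> f t"
    using continuous_attains_inf[OF D(1) _ f] D(2) by (auto simp: closure_eq_empty)
  have "f s = 0"
  proof (rule ccontr)
    assume "f s \<noteq> 0"
    then have "0 < f s" using nonneg[OF s(1)] by simp
    then obtain m where "1 / real (Suc m) < f s" using nat_approx_posE by blast
    moreover obtain q where "q \<in> D" "f q < 1 / real (Suc m)" using small by blast
    ultimately show False using s(2)[of q] closure_subset[of D] by auto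
  qed
  then show "touches_zero f (closure D)" using nonneg s(1) by (auto simp: touches_zero_def)
qed

text \<open>Touching is expressed by an event \<open>E\<close> of the product \<open>\<sigma>\<close>-algebra over the time interval, with the gap
replaced by the limit of its sampled versions; on continuous paths the two agree. At most two
translates along a suitable tent lie in \<open>E\<close>, so \<open>E\<close> is null for Brownian motion.\<close>

lemma AE_not_touching:
  assumes BM: "brownian_motion01 M B" and K: "continuous_on UNIV K"
    and c: "0 < c" and \<zeta>: "0 < \<zeta>" and \<kappa>: "0 < \<kappa>" "\<kappa> < x" "x < 1"
  shows "AE \<omega> in M. \<not> touches_zero (gap K \<zeta> c (\<lambda>t. B t \<omega>)) {\<kappa>..x}"
proof -
  have B_cont: "continuous_on {0..1} (\<lambda>t. B t \<omega>)" if "\<omega> \<in> space M" for \<omega>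
    using BM that by (simp add: brownian_motion01_def)
  define D where "D = {\<kappa><..<x} \<inter> \<rat>"
  have clD: "closure D = {\<kappa>..x}"
    unfolding D_def using \<kappa> by (subst closure_open_Int_superset) (auto simp: Rats_closure_real)
  have "D \<noteq> {}" using clD \<kappa> by (metis atLeastatMost_empty_iff2 closure_empty less_imp_le)
  have "countable D" unfolding D_def by (simp add: countable_rat countable_Int2)
  have D01: "0 \<le> q" "q \<le> 1" if "q \<in> D" for q using that \<kappa> by (auto simp: D_def)
  let ?P = "PiM {0..1} (\<lambda>_. borel :: real measure)"
  define G where "G b q = lim (\<lambda>j. sample_num K (real (Suc j) / \<zeta>) (Suc j) b (grid_index q j))
      - c * (q * lim (\<lambda>j. sample_den (Suc j) b (grid_index q j)))" for b q
  have G_meas: "(\<lambda>b. G b q) \<in> borel_measurable ?P" if "q \<in> D" for q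
  proof -
    have "(\<lambda>b. b t) \<in> borel_measurable ?P" if "t \<in> {0..1}" for t
      using that by (rule measurable_component_singleton)
    then show ?thesis
      unfolding G_def using D01[OF that]
      by (intro borel_measurable_diff borel_measurable_times borel_measurable_const
          borel_measurable_lim_metric sample_num_measurable sample_den_measurable grid_index_le)
  qed
  have G_eq: "G (\<lambda>t\<in>{0..1}. f t) q = gap K \<zeta> c f q" if q: "q \<in> D" and f: "continuous_on {0..1} f" for f q
  proof -
    have r: "(\<lambda>t\<in>{0..1}. f t) (real l / real (Suc j)) = f (real l / real (Suc j))" if "l \<le> Suc j" for l j
      using that by (auto simp: divide_le_eq_1)
    have "sample_num K H (Suc j) (\<lambda>t\<in>{0..1}. f t) n = sample_num K H (Suc j) f n"
      "sample_den (Suc j) (\<lambda>t\<in>{0..1}. f t) n = sample_den (Suc j) f n" if "n \<le> Suc j" for H j n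
      unfolding sample_num_def sample_den_def using that
      by (intro sum.cong arg_cong2[where f = "(/)"] arg_cong2[where f = "(*)"] arg_cong[where f = "\<lambda>x. x\<^sup>2"] refl r; simp)+
    then show ?thesis
      unfolding G_def gap_def using grid_index_le[OF D01(2)[OF q]]
        limI[OF grid_functionals_tendsto(1)[OF f K \<zeta> D01[OF q]]]
        limI[OF grid_functionals_tendsto(2)[OF f K \<zeta> D01[OF q]]] by simp
  qed
  define E where "E = {b \<in> space ?P. (\<forall>q\<in>D. 0 \<le> G b q) \<and> (\<forall>m::nat. \<exists>q\<in>D. G b q < 1 / real (Suc m))}"
  have E: "E \<in> sets ?P"
    unfolding E_def
  proof (intro predE pred_intros_logic pred_intros_countable measurable_pred_countable \<open>countable D\<close>)
    fix q and m :: nat assume "q \<in> D"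
    then have [measurable]: "(\<lambda>b. G b q) \<in> borel_measurable ?P" by (rule G_meas)
    show "Measurable.pred ?P (\<lambda>b. 0 \<le> G b q)" "Measurable.pred ?P (\<lambda>b. G b q < 1 / real (Suc m))"
      by measurable
  qed
  have E_iff: "(\<lambda>t\<in>{0..1}. f t) \<in> E \<longleftrightarrow> touches_zero (gap K \<zeta> c f) {\<kappa>..x}" if f: "continuous_on {0..1} f" for f
  proof -
    have "continuous_on (closure D) (gap K \<zeta> c f)"
      unfolding clD by (rule continuous_on_subset[OF continuous_on_gap[OF f K]]) (use \<kappa> in auto)
    from touches_zero_closure_iff[OF this _ \<open>D \<noteq> {}\<close>]
    have "touches_zero (gap K \<zeta> c f) {\<kappa>..x} \<longleftrightarrow>
        (\<forall>q\<in>D. 0 \<le> gap K \<zeta> c f q) \<and> (\<forall>m::nat. \<exists>q\<in>D. gap K \<zeta> c f q < 1 / real (Suc m))"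
      unfolding clD by simp
    then show ?thesis unfolding E_def using G_eq[OF _ f] by (simp add: space_PiM)
  qed
  obtain \<eta> where \<eta>: "0 < \<eta>" "2 * \<eta> \<le> 1" "\<And>s. \<kappa> \<le> s \<Longrightarrow> s \<le> 1 \<Longrightarrow> gap K \<zeta> c (tent \<eta>) s < 0"
    using exists_tent_with_negative_gap[OF K c \<kappa>(1) _ less_imp_le[OF \<zeta>]] \<kappa> by (metis less_trans)
  have "AE \<omega> in M. (\<lambda>t\<in>{0..1}. B t \<omega>) \<notin> E"
  proof (rule null_set_if_finitely_many_translates[OF BM \<eta>(1,2) E])
    fix \<omega> assume \<omega>: "\<omega> \<in> space M"
    have "{\<epsilon>. (\<lambda>t\<in>{0..1}. B t \<omega> + \<epsilon> * tent \<eta> t) \<in> E}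
        = {\<epsilon>. touches_zero (gap K \<zeta> c (\<lambda>t. B t \<omega> + \<epsilon> * tent \<eta> t)) {\<kappa>..x}}"
      by (intro Collect_cong E_iff continuous_intros B_cont[OF \<omega>] continuous_on_tent)
    then show "finite {\<epsilon>. (\<lambda>t\<in>{0..1}. B t \<omega> + \<epsilon> * tent \<eta> t) \<in> E} \<and>
        card {\<epsilon>. (\<lambda>t\<in>{0..1}. B t \<omega> + \<epsilon> * tent \<eta> t) \<in> E} \<le> 2"
      using few_translates_touch_zero[OF B_cont[OF \<omega>] continuous_on_tent K, of "{\<kappa>..x}"] \<eta>(3) \<kappa> by auto
  qed
  then show ?thesis
    using AE_space by eventually_elim (use E_iff B_cont in auto)
qed

text \<open>Beyond the touching events, for countably many end points, only \<open>limit_den B \<kappa> = 0\<close> has to be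
excluded. It would force \<open>B \<kappa> = 0\<close>, whereas \<open>B \<kappa>\<close> has a normal distribution.\<close>

lemma AE_regular_path:
  assumes BM: "brownian_motion01 M B" and K: "continuous_on UNIV K"
    and \<zeta>: "0 < \<zeta>" and \<kappa>: "0 < \<kappa>" "\<kappa> < 1"
  shows "AE \<omega> in M. regular_path K \<zeta> c \<kappa> (\<lambda>t. B t \<omega>)"
proof (cases "c \<le> 0")
  case True
  then show ?thesis by (simp add: regular_path_def)
next
  case False
  have B_cont: "continuous_on {0..1} (\<lambda>t. B t \<omega>)" if "\<omega> \<in> space M" for \<omega>
    using BM that by (simp add: brownian_motion01_def)
  have d: "distributed M lborel (\<lambda>\<omega>. B \<kappa> \<omega> - B 0 \<omega>) (normal_density 0 (sqrt (\<kappa> - 0)))"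
  proof -
    have "\<forall>s t. 0 \<le> s \<and> s < t \<and> t \<le> 1 \<longrightarrow>
        distributed M lborel (\<lambda>\<omega>. B t \<omega> - B s \<omega>) (normal_density 0 (sqrt (t - s)))"
      using BM by (simp add: brownian_motion01_def)
    from this[rule_format, of 0 \<kappa>] show ?thesis using \<kappa> by simp
  qed
  have "AE \<omega> in M. B \<kappa> \<omega> - B 0 \<omega> \<noteq> 0"
  proof -
    have "AE y in density lborel (normal_density 0 (sqrt (\<kappa> - 0))). y \<noteq> 0"
      using AE_lborel_singleton[of "0::real"] by (subst AE_density) (auto elim: eventually_mono)
    then have "AE y in distr M lborel (\<lambda>\<omega>. B \<kappa> \<omega> - B 0 \<omega>). y \<noteq> 0"
      unfolding distributed_distr_eq_density[OF d] .
    then show ?thesis by (rule AE_distrD[OF distributed_measurable[OF d]])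
  qed
  moreover have "AE \<omega> in M. B 0 \<omega> = 0" using BM by (simp add: brownian_motion01_def)
  moreover have "AE \<omega> in M. \<forall>x\<in>{x\<in>\<rat>. \<kappa> < x \<and> x < 1}. \<not> touches_zero (gap K \<zeta> c (\<lambda>t. B t \<omega>)) {\<kappa>..x}"
  proof (rule AE_ball_countable')
    show "countable {x\<in>\<rat>. \<kappa> < x \<and> x < 1}" by (rule countable_subset[OF _ countable_rat]) auto
  qed (use AE_not_touching[OF BM K _ \<zeta> \<kappa>(1)] False in auto)
  ultimately show ?thesis
    using AE_space
  proof eventually_elim
    case (elim \<omega>)
    have "limit_den (\<lambda>t. B t \<omega>) \<kappa> \<noteq> 0"
    proof
      assume "limit_den (\<lambda>t. B t \<omega>) \<kappa> = 0"
      moreover have "continuous_on {0..\<kappa>} (\<lambda>t. (B t \<omega>)\<^sup>2)"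
        by (intro continuous_intros continuous_on_subset[OF B_cont[OF elim(4)]]) (use \<kappa> in auto)
      ultimately have "\<forall>t\<in>{0..\<kappa>}. (B t \<omega>)\<^sup>2 = 0"
        using integral_eq_0_iff[of 0 \<kappa> "\<lambda>t. (B t \<omega>)\<^sup>2"] \<kappa> by (simp add: limit_den_def)
      then have "B \<kappa> \<omega> = 0" using \<kappa> by simp
      then show False using elim by simp
    qed
    then have "0 < limit_den (\<lambda>t. B t \<omega>) \<kappa>"
      using limit_den_nonneg[OF B_cont[OF elim(4)], of \<kappa>] \<kappa> by simp
    then show ?case using elim(3) by (auto simp: regular_path_def)
  qed
qed

section \<open>Convergence of the stopping times\<close>

text \<open>Numerator and denominator are both quadratic in the series, so a common factor cancels. This lets
the normalisation \<open>1 / sqrt N\<close> be inserted into the series.\<close>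

lemma U_process_cong_scale:
  assumes "a \<noteq> 0" "\<And>l. 1 \<le> l \<Longrightarrow> l \<le> n \<Longrightarrow> y' l = a * y l" "n \<le> N" "1 \<le> N"
  shows "U_process K h y' N (real n / real N) = U_process K h y N (real n / real N)"
proof -
  have n: "nat \<lfloor>real N * (real n / real N)\<rfloor> = n" using assms by simp
  have num: "(\<Sum>i=1..n. (\<Sum>j=1..i. y' j)\<^sup>2 * scaled_kernel K (h N) (real i - real n))
      = a\<^sup>2 * (\<Sum>i=1..n. (\<Sum>j=1..i. y j)\<^sup>2 * scaled_kernel K (h N) (real i - real n))"
    unfolding sum_distrib_left
  proof (intro sum.cong refl)
    fix i assume i: "i \<in> {1..n}"
    have "(\<Sum>j=1..i. y' j) = (\<Sum>j=1..i. a * y j)" using i assms(2) by (intro sum.cong) auto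
    then show "(\<Sum>j=1..i. y' j)\<^sup>2 * scaled_kernel K (h N) (real i - real n)
        = a\<^sup>2 * ((\<Sum>j=1..i. y j)\<^sup>2 * scaled_kernel K (h N) (real i - real n))"
      by (simp add: power_mult_distrib flip: sum_distrib_left)
  qed
  have den: "(\<Sum>j=1..n. (y' j)\<^sup>2) = a\<^sup>2 * (\<Sum>j=1..n. (y j)\<^sup>2)"
    unfolding sum_distrib_left using assms(2) by (intro sum.cong) (auto simp: power_mult_distrib)
  show ?thesis
    unfolding U_process_def n Let_def num den using assms(1) by simp
qed

lemma stopping_time_R_cong_scale:
  assumes "a \<noteq> 0" "\<And>l. 1 \<le> l \<Longrightarrow> l \<le> N \<Longrightarrow> y' l = a * y l" "1 \<le> N"
  shows "stopping_time_R K h c \<kappa> y' N = stopping_time_R K h c \<kappa> y N"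
proof -
  have "U_process K h y' N (real n / real N) = U_process K h y N (real n / real N)" if "n \<le> N" for n
    using that assms by (intro U_process_cong_scale) auto
  then have "{n. nat \<lfloor>\<kappa> * real N\<rfloor> \<le> n \<and> n \<le> N \<and> U_process K h y' N (real n / real N) < c}
      = {n. nat \<lfloor>\<kappa> * real N\<rfloor> \<le> n \<and> n \<le> N \<and> U_process K h y N (real n / real N) < c}"
    by auto
  then show ?thesis unfolding stopping_time_R_def by simp
qed

lemma stopping_time_R_rescaled_path:
  assumes "1 \<le> N"
  shows "stopping_time_R K h c \<kappa> (\<lambda>l. path01 (rescaled_path y N) (real l / real N)) N
       = stopping_time_R K h c \<kappa> y N"
proof (rule stopping_time_R_cong_scale[where a = "1 / sqrt (real N)"])
  fix l assume l: "1 \<le> l" "l \<le> N"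
  then have "nat \<lfloor>real N * (real l / real N)\<rfloor> = l" "real l / real N \<in> {0..1}"
    using assms by (auto simp: divide_le_eq_1)
  then show "path01 (rescaled_path y N) (real l / real N) = 1 / sqrt (real N) * y l"
    using l by (simp add: path01_def rescaled_path_def Let_def)
qed (use assms in auto)

lemma stopping_time_R_measurable:
  assumes Y: "\<And>n. 1 \<le> n \<Longrightarrow> Y n \<in> borel_measurable M"
  shows "(\<lambda>\<omega>. real (stopping_time_R K h c \<kappa> (\<lambda>n. Y n \<omega>) N)) \<in> borel_measurable M"
  unfolding borel_measurable_iff_less
proof
  fix x :: real
  define I where "I = {n. nat \<lfloor>\<kappa> * real N\<rfloor> \<le> n \<and> n \<le> N \<and> real n < x}"
  have U: "(\<lambda>\<omega>. U_process K h (\<lambda>n. Y n \<omega>) N s) \<in> borel_measurable M" for s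
  proof (cases "s < 1 / real N")
    case False
    define S where "S i \<omega> = (\<Sum>j=1..i. Y j \<omega>)" for i \<omega>
    have "S i \<in> borel_measurable M" for i
      unfolding S_def[abs_def] using Y by (intro borel_measurable_sum) auto
    moreover have "(\<lambda>\<omega>. \<Sum>j=1..n. (Y j \<omega>)\<^sup>2) \<in> borel_measurable M" for n
      using Y by (intro borel_measurable_sum borel_measurable_power) auto
    ultimately show ?thesis
      using False unfolding U_process_def S_def[symmetric] Let_def
      by (simp only: if_False)
        (intro borel_measurable_divide borel_measurable_times borel_measurable_sum
          borel_measurable_power borel_measurable_const Y; simp)
  qed (simp add: U_process_def)
  have "real (stopping_time_R K h c \<kappa> y N) < x \<longleftrightarrow>
      real N < x \<or> (\<exists>n\<in>I. U_process K h y N (real n / real N) < c)" for y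
  proof (rule stopping_time_R_cases[of K h c \<kappa> y N])
    assume "stopping_time_R K h c \<kappa> y N = N"
      and "\<And>n. nat \<lfloor>\<kappa> * real N\<rfloor> \<le> n \<Longrightarrow> n \<le> N \<Longrightarrow> \<not> U_process K h y N (real n / real N) < c"
    then show ?thesis by (auto simp: I_def)
  next
    let ?R = "stopping_time_R K h c \<kappa> y N"
    assume R: "nat \<lfloor>\<kappa> * real N\<rfloor> \<le> ?R" "?R \<le> N" "U_process K h y N (real ?R / real N) < c"
    show ?thesis
    proof
      assume "real ?R < x"
      then show "real N < x \<or> (\<exists>n\<in>I. U_process K h y N (real n / real N) < c)"
        using R by (intro disjI2 bexI[of _ ?R]) (auto simp: I_def)
    next
      assume "real N < x \<or> (\<exists>n\<in>I. U_process K h y N (real n / real N) < c)"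
      then show "real ?R < x"
      proof
        assume "\<exists>n\<in>I. U_process K h y N (real n / real N) < c"
        then obtain n where n: "n \<in> I" "U_process K h y N (real n / real N) < c" by blast
        then have "?R \<le> n" by (intro stopping_time_R_le) (auto simp: I_def)
        then show ?thesis using n by (auto simp: I_def)
      qed (use R in linarith)
    qed
  qed
  then have "{\<omega> \<in> space M. real (stopping_time_R K h c \<kappa> (\<lambda>n. Y n \<omega>) N) < x}
      = {\<omega> \<in> space M. real N < x \<or> (\<exists>n\<in>I. U_process K h (\<lambda>n. Y n \<omega>) N (real n / real N) < c)}" by simp
  also have "\<dots> \<in> sets M"
    using U by measurable
  finally show "{\<omega> \<in> space M. real (stopping_time_R K h c \<kappa> (\<lambda>n. Y n \<omega>) N) < x} \<in> sets M" .
qed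

text \<open>The sequential convergence of the stopping times, restated with neighbourhoods in the Skorohod
metric.\<close>

lemma stopping_time_continuous_at_regular_path:
  assumes h: "\<And>N. N \<ge> 1 \<Longrightarrow> 0 < h N" and Nh: "(\<lambda>N. real N / h N) \<longlonglongrightarrow> \<zeta>"
    and b: "path01 b \<in> D01" "continuous_on {0..1} b" and K: "continuous_on UNIV K" "\<And>x. 0 \<le> K x"
    and \<zeta>: "0 \<le> \<zeta>" and \<kappa>: "0 < \<kappa>" "\<kappa> < 1"
    and reg: "regular_path K \<zeta> c \<kappa> b" and \<epsilon>: "0 < \<epsilon>"
  shows "\<exists>\<delta>>0. \<exists>N0. \<forall>N\<ge>N0. \<forall>a\<in>D01. skorohod_dist a (path01 b) < \<delta> \<longrightarrow>
     \<bar>real (stopping_time_R K h c \<kappa> (\<lambda>l. a (real l / real N)) N) / real N - limit_time K \<zeta> c \<kappa> b\<bar> < \<epsilon>"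
proof (rule ccontr)
  define g where "g N a = real (stopping_time_R K h c \<kappa> (\<lambda>l. a (real l / real N)) N) / real N" for N a
  assume neg: "\<not> ?thesis"
  have bad: "\<exists>N\<ge>N0. \<exists>a\<in>D01. skorohod_dist a (path01 b) < \<delta> \<and> \<not> \<bar>g N a - limit_time K \<zeta> c \<kappa> b\<bar> < \<epsilon>"
    if "0 < \<delta>" for \<delta> N0
  proof (rule ccontr)
    assume "\<not> ?thesis"
    then have "\<forall>N\<ge>N0. \<forall>a\<in>D01. skorohod_dist a (path01 b) < \<delta> \<longrightarrow> \<bar>g N a - limit_time K \<zeta> c \<kappa> b\<bar> < \<epsilon>"
      by blast
    then show False using neg that unfolding g_def by blast
  qed
  have "continuous_on {0..1} (path01 b)"
    by (rule continuous_on_eq[OF b(2)]) (simp add: path01_def)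
  have "\<exists>N a. j < N \<and> (\<forall>t\<in>{0..1}. \<bar>a t - b t\<bar> \<le> 1 / real (Suc j)) \<and> \<not> \<bar>g N a - limit_time K \<zeta> c \<kappa> b\<bar> < \<epsilon>" for j
  proof -
    obtain \<delta> where \<delta>: "0 < \<delta>" "\<And>x t. x \<in> D01 \<Longrightarrow> skorohod_dist x (path01 b) < \<delta> \<Longrightarrow> t \<in> {0..1} \<Longrightarrow>
        \<bar>x t - path01 b t\<bar> \<le> 1 / real (Suc j)"
      by (rule skorohod_close_to_continuous_imp_uniformly_close[OF b(1) \<open>continuous_on {0..1} (path01 b)\<close>,
            of "1 / real (Suc j)"]) auto
    obtain N a where "Suc j \<le> N" "a \<in> D01" "skorohod_dist a (path01 b) < \<delta>"
      "\<not> \<bar>g N a - limit_time K \<zeta> c \<kappa> b\<bar> < \<epsilon>"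
      using bad[OF \<delta>(1), of "Suc j"] by blast
    then show ?thesis
      using \<delta>(2)[of a] by (intro exI[of _ N] exI[of _ a]) (auto simp: path01_def)
  qed
  then obtain N a where N: "\<And>j. j < N j" and a: "\<And>j t. t \<in> {0..1} \<Longrightarrow> \<bar>a j t - b t\<bar> \<le> 1 / real (Suc j)"
    and far: "\<And>j. \<not> \<bar>g (N j) (a j) - limit_time K \<zeta> c \<kappa> b\<bar> < \<epsilon>"
    by metis
  have Npos: "0 < N j" for j using N[of j] by simp
  have Ninf: "filterlim N at_top sequentially"
    by (rule filterlim_at_top_mono[OF filterlim_ident]) (use N in \<open>auto intro!: always_eventually less_imp_le\<close>)
  have e: "(\<lambda>j. 1 / real (Suc j)) \<longlonglongrightarrow> 0"
    using LIMSEQ_inverse_real_of_nat by (simp add: inverse_eq_divide)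
  have "(\<lambda>j. g (N j) (a j)) \<longlonglongrightarrow> limit_time K \<zeta> c \<kappa> b"
    unfolding g_def
    by (rule stopping_time_tendsto_limit_time[OF Ninf Npos h Nh a e b(2) K \<zeta> \<kappa> reg])
  then have "\<forall>\<^sub>F j in sequentially. dist (g (N j) (a j)) (limit_time K \<zeta> c \<kappa> b) < \<epsilon>"
    using \<epsilon> by (rule tendstoD)
  then show False using far by (auto simp: dist_real_def eventually_sequentially)
qed

theorem corollary2p1:
  fixes M :: "'a measure" and Y :: "nat \<Rightarrow> 'a \<Rightarrow> real"
    and M' :: "'b measure" and B :: "real \<Rightarrow> 'b \<Rightarrow> real"
    and K :: "real \<Rightarrow> real" and h :: "nat \<Rightarrow> real" and \<zeta> \<kappa> c :: real
  assumes "prob_space M"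
    and "\<And>n. n \<ge> 1 \<Longrightarrow> Y n \<in> borel_measurable M"
    and "brownian_motion01 M' B"
    and "integrated_I1 M Y M' B"
    and "admissible_kernel K"
    and "\<And>N. N \<ge> 1 \<Longrightarrow> h N > 0"
    and "\<zeta> \<ge> 1"
    and "(\<lambda>N. real N / h N) \<longlonglongrightarrow> \<zeta>"
    and "0 < \<kappa>" and "\<kappa> < 1"
  shows "converges_in_distribution
           M (\<lambda>N \<omega>. real (stopping_time_R K h c \<kappa> (\<lambda>n. Y n \<omega>) N) / real N)
           M' (\<lambda>\<omega>. limit_time K \<zeta> c \<kappa> (\<lambda>t. B t \<omega>))"
proof -
  have M': "prob_space M'" and B_meas: "\<And>t. t \<in> {0..1} \<Longrightarrow> B t \<in> borel_measurable M'"
    and B_cont: "\<And>\<omega>. \<omega> \<in> space M' \<Longrightarrow> continuous_on {0..1} (\<lambda>t. B t \<omega>)"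
    using assms(3) by (auto simp: brownian_motion01_def)
  have K: "continuous_on UNIV K" "\<And>x. 0 \<le> K x"
    using assms(5) by (auto simp: admissible_kernel_def intro: lipschitz_on_continuous_on)
  have \<zeta>: "0 < \<zeta>" using assms(7) by simp
  obtain \<sigma> where \<sigma>: "0 < \<sigma>"
    and W: "weakly_converges_in skorohod_topology M (\<lambda>N \<omega>. path01 (rescaled_path (\<lambda>n. Y n \<omega>) N))
        M' (\<lambda>\<omega>. path01 (\<lambda>s. \<sigma> * B s \<omega>))"
    using assms(4) by (auto simp: integrated_I1_def)
  define g where "g N a = real (stopping_time_R K h c \<kappa> (\<lambda>l. a (real l / real N)) N) / real N" for N a
  have g: "g N (path01 (rescaled_path (\<lambda>n. Y n \<omega>) N)) = real (stopping_time_R K h c \<kappa> (\<lambda>n. Y n \<omega>) N) / real N" for N \<omega>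
    unfolding g_def by (cases "N = 0") (simp_all add: stopping_time_R_rescaled_path)
  have Z: "path01 (\<lambda>s. \<sigma> * B s \<omega>) \<in> D01" if "\<omega> \<in> space M'" for \<omega>
  proof -
    have "space (borel_of skorohod_topology) = D01"
      by (simp add: borel_of_def skorohod_topology_def space_measure_of_conv
          Metric_space.topspace_mtopology[OF Metric_space_skorohod])
    moreover have "(\<lambda>\<omega>. path01 (\<lambda>s. \<sigma> * B s \<omega>)) \<in> measurable M' (borel_of skorohod_topology)"
      using W by (simp add: weakly_converges_in_def)
    ultimately show ?thesis using measurable_space[OF _ that] by metis
  qed
  have "converges_in_distribution M (\<lambda>N \<omega>. g N (path01 (rescaled_path (\<lambda>n. Y n \<omega>) N)))
      M' (\<lambda>\<omega>. limit_time K \<zeta> c \<kappa> (\<lambda>t. B t \<omega>))"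
  proof (rule extended_continuous_mapping[OF Metric_space_skorohod assms(1) M' W[unfolded skorohod_topology_def]])
    show "(\<lambda>\<omega>. g N (path01 (rescaled_path (\<lambda>n. Y n \<omega>) N))) \<in> borel_measurable M" for N
      unfolding g by (intro borel_measurable_divide stopping_time_R_measurable assms(2) borel_measurable_const)
    show "(\<lambda>\<omega>. limit_time K \<zeta> c \<kappa> (\<lambda>t. B t \<omega>)) \<in> borel_measurable M'"
      by (intro limit_time_measurable B_meas B_cont K \<zeta> assms(9))
    show "AE \<omega> in M'. \<forall>e>0. \<exists>\<delta>>0. \<exists>N0. \<forall>N\<ge>N0. \<forall>a\<in>D01.
        skorohod_dist a (path01 (\<lambda>s. \<sigma> * B s \<omega>)) < \<delta> \<longrightarrow> \<bar>g N a - limit_time K \<zeta> c \<kappa> (\<lambda>t. B t \<omega>)\<bar> < e"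
      using AE_regular_path[OF assms(3) K(1) \<zeta> assms(9,10), of c] AE_space
    proof eventually_elim
      case (elim \<omega>)
      have "regular_path K \<zeta> c \<kappa> (\<lambda>t. \<sigma> * B t \<omega>)"
        using elim(1) \<sigma> by (simp add: regular_path_scale)
      moreover have "continuous_on {0..1} (\<lambda>t. \<sigma> * B t \<omega>)"
        by (intro continuous_intros B_cont elim(2))
      moreover have "limit_time K \<zeta> c \<kappa> (\<lambda>t. \<sigma> * B t \<omega>) = limit_time K \<zeta> c \<kappa> (\<lambda>t. B t \<omega>)"
        using \<sigma> by (simp add: limit_time_scale)
      ultimately show ?case
        using stopping_time_continuous_at_regular_path[OF assms(6,8) Z[OF elim(2)] _ K less_imp_le[OF \<zeta>] assms(9,10), of c]
        unfolding g_def by simp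
    qed
  qed
  then show ?thesis by (simp only: g)
qed

end
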